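(* Let $\alpha>\frac{d-1}{2}$ and $\beta>\frac{d-1}{2}$. Let $R=(R(n),n\ge0)$ be the multiplicative random walk on $\mathcal{P}_d$ defined recursively by $$R(n)=R(n-1)^{1/2}X(n)R(n-1)^{1/2},\qquad n\ge1,$$ where $(X(n),n\ge1)$ is a sequence of i.i.d. random matrices in $\mathcal{P}_d$, independent of the initial state $R(0)$. Set $$A(n):=\sum_{k=0}^n R(k)\quad(n\ge0),\qquad S(n):=A(n-1)^{-1}R(n)A(n)^{-1}\quad(n\ge1).$$ If the initial state $R(0)$ has the inverse Wishart distribution of parameter $\beta$ and the increments $X(n)$ have the matrix Beta type II distribution of parameters $\alpha$ and $\beta$, then $S=(S(n),n\ge1)$ is a Markov process in its own filtration with an explicit transition kernel, namely the kernel $\overline{Q}$ given in the context.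
   Context: $\mathcal{P}_d$ is the set of $d\times d$ real symmetric positive definite matrices. For $x\in\mathcal{P}_d$, $|x|$ is the determinant, $\mathrm{tr}[x]$ the trace, and $x^{1/2}$ the unique $b\in\mathcal{P}_d$ with $bb=x$; $|\cdot|$ also denotes the determinant of a general square matrix. $I$ is the $d\times d$ identity matrix. Reference measure on $\mathcal{P}_d$: $\mu(\mathrm{d}x):=|x|^{-(d+1)/2}\prod_{1\le i\le j\le d}\mathrm{d}x_{ij}$. For $\alpha,\beta>\frac{d-1}{2}$: $\Gamma_d(\alpha):=\int_{\mathcal{P}_d}|x|^{\alpha}e^{-\mathrm{tr}[x]}\mu(\mathrm{d}x)$ and $B_d(\alpha,\beta):=\Gamma_d(\alpha)\Gamma_d(\beta)/\Gamma_d(\alpha+\beta)$. The inverse Wishart distribution of parameter $\beta$ on $\mathcal{P}_d$ is $\Gamma_d(\beta)^{-1}|x|^{-\beta}e^{-\mathrm{tr}[x^{-1}]}\mu(\mathrm{d}x)$. The matrix Beta type II distribution of parameters $\alpha$ and $\beta$ on $\mathcal{P}_d$ is $B_d(\alpha,\beta)^{-1}|x|^{\alpha}|I+x|^{-(\alpha+\beta)}\mu(\mathrm{d}x)$; it is orthogonally invariant, i.e. invariant under $x\mapsto k^{\top}xk$ for every orthogonal $k$. The explicit transition kernel is, for $s,\tilde s\in\mathcal{P}_d$, $$\overline{Q}(s;\mathrm{d}\tilde s):=\frac{\varphi(\tilde s)}{\varphi(s)}\,B_d(\alpha,\beta)^{-1}|s^{-1}\tilde s|^{\alpha}|I+s^{-1}\tilde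 s|^{-(\alpha+\beta)}e^{-\mathrm{tr}[\tilde s]}\mu(\mathrm{d}\tilde s),$$ where $$\varphi(s):=\int_{\mathcal{P}_d}|a|^{\alpha-\beta}|I+sa|^{-\alpha}e^{-\mathrm{tr}[a^{-1}]}\mu(\mathrm{d}a),$$ which is finite for every $s\in\mathcal{P}_d$. *)

theory Defs
  imports "HOL-Probability.Probability"
begin

section \<open>Positive definite matrices\<close>

type_synonym 'n sqmat = "((real, 'n) vec, 'n) vec"

definition posdef_mats :: "'n::finite sqmat set" where
  "posdef_mats = {x. transpose x = x \<and> (\<forall>v. v \<noteq> 0 \<longrightarrow> v \<bullet> (x *v v) > 0)}"

text \<open>The state space, with its Borel sigma-algebra; as a measure it carries no information
  beyond the sigma-algebra.\<close>

definition posdef_borel :: "'n::finite sqmat measure" where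
  "posdef_borel = restrict_space borel posdef_mats"

definition mat_sqrt :: "'n::finite sqmat \<Rightarrow> 'n sqmat" where
  "mat_sqrt x = (THE b. b \<in> posdef_mats \<and> b ** b = x)"


section \<open>Reference measure, special functions and distributions\<close>

text \<open>The linear order on the index type is only used to enumerate the entries
  \<open>x\<^sub>i\<^sub>j\<close> with \<open>i \<le> j\<close>, which are the coordinates of a symmetric matrix.\<close>

definition sym_of_upper :: "('n \<times> 'n \<Rightarrow> real) \<Rightarrow> 'n::{finite,linorder} sqmat" where
  "sym_of_upper c = (\<chi> i j. c (min i j, max i j))"

text \<open>The measure \<open>\<Prod>\<^bsub>i \<le> j\<^esub> dx\<^sub>i\<^sub>j\<close> on the space of symmetric matrices.\<close>

definition sym_lebesgue :: "'n::{finite,linorder} sqmat measure" where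
  "sym_lebesgue = distr (PiM {(i, j). i \<le> j} (\<lambda>_. lborel)) borel sym_of_upper"

definition posdef_mu :: "'n::{finite,linorder} sqmat measure" where
  "posdef_mu = density (restrict_space sym_lebesgue posdef_mats)
     (\<lambda>x. ennreal (det x powr (- (real CARD('n) + 1) / 2)))"

definition matrix_Gamma :: "'n::{finite,linorder} itself \<Rightarrow> real \<Rightarrow> real" where
  "matrix_Gamma _ \<alpha> =
     (\<integral>x. det x powr \<alpha> * exp (- trace x) \<partial>(posdef_mu :: 'n sqmat measure))"

definition matrix_Beta :: "'n::{finite,linorder} itself \<Rightarrow> real \<Rightarrow> real \<Rightarrow> real" where
  "matrix_Beta T \<alpha> \<beta> = matrix_Gamma T \<alpha> * matrix_Gamma T \<beta> / matrix_Gamma T (\<alpha> + \<beta>)"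

definition inverse_wishart :: "real \<Rightarrow> 'n::{finite,linorder} sqmat measure" where
  "inverse_wishart \<beta> = density posdef_mu
     (\<lambda>x. ennreal (inverse (matrix_Gamma TYPE('n) \<beta>) *
        det x powr (- \<beta>) * exp (- trace (matrix_inv x))))"

definition matrix_beta_II :: "real \<Rightarrow> real \<Rightarrow> 'n::{finite,linorder} sqmat measure" where
  "matrix_beta_II \<alpha> \<beta> = density posdef_mu
     (\<lambda>x. ennreal (inverse (matrix_Beta TYPE('n) \<alpha> \<beta>) *
        det x powr \<alpha> * det (mat 1 + x) powr (- (\<alpha> + \<beta>))))"

definition phi :: "real \<Rightarrow> real \<Rightarrow> 'n::{finite,linorder} sqmat \<Rightarrow> real" where
  "phi \<alpha> \<beta> s =
     (\<integral>a. det a powr (\<alpha> - \<beta>) * det (mat 1 + s ** a) powr (- \<alpha>) * exp (- trace (matrix_inv a))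
        \<partial>posdef_mu)"

definition Q_bar ::
  "real \<Rightarrow> real \<Rightarrow> 'n::{finite,linorder} sqmat \<Rightarrow> 'n sqmat measure" where
  "Q_bar \<alpha> \<beta> s = density posdef_mu
     (\<lambda>t. ennreal (phi \<alpha> \<beta> t / phi \<alpha> \<beta> s * inverse (matrix_Beta TYPE('n) \<alpha> \<beta>) *
        det (matrix_inv s ** t) powr \<alpha> *
        det (mat 1 + matrix_inv s ** t) powr (- (\<alpha> + \<beta>)) * exp (- trace t)))"


section \<open>Markov processes\<close>

text \<open>The sigma-algebra generated by \<open>Z m, \<dots>, Z n\<close>, for a process \<open>(Z k)\<close> whose time starts
  at \<open>k = m\<close>.\<close>

definition natural_filtration ::
  "'a measure \<Rightarrow> nat \<Rightarrow> 'b measure \<Rightarrow> (nat \<Rightarrow> 'a \<Rightarrow> 'b) \<Rightarrow> nat \<Rightarrow> 'a measure" where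
  "natural_filtration M m N Z n =
     sigma (space M) (\<Union>k\<in>{m..n}. {Z k -` B \<inter> space M | B. B \<in> sets N})"

text \<open>\<open>(Z n)\<^bsub>n \<ge> m\<^esub>\<close> is a time-homogeneous Markov process with state space \<open>N\<close> and
  transition kernel \<open>K\<close> in its own filtration; that \<open>K\<close> is a probability kernel on \<open>N\<close> is part
  of the notion.\<close>

definition markov_process ::
  "'a measure \<Rightarrow> nat \<Rightarrow> 'b measure \<Rightarrow> ('b \<Rightarrow> 'b measure) \<Rightarrow> (nat \<Rightarrow> 'a \<Rightarrow> 'b) \<Rightarrow> bool" where
  "markov_process M m N K Z \<longleftrightarrow>
     K \<in> measurable N (prob_algebra N) \<and>
     (\<forall>n\<ge>m. Z n \<in> measurable M N) \<and>
     (\<forall>n\<ge>m. \<forall>B\<in>sets N. AE \<omega> in M.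
        real_cond_exp M (natural_filtration M m N Z n) (\<lambda>\<omega>'. indicator B (Z (Suc n) \<omega>')) \<omega>
          = measure (K (Z n \<omega>)) B)"

end

(* Since R(n) = A(n) - A(n-1), the resolvent identity gives S(n) = A(n-1)^-1 - A(n)^-1, and with
   b(n) = A(n)^-1 the pair (S(n), b(n)) is a Markov chain: R(n) = b(n)^-1 - (b(n) + S(n))^-1, and
   b(n+1), S(n+1) are functions of b(n), R(n) and X(n+1). Let Lambda(s, .) be the probability with
   density proportional to |z|^beta |z + s|^-alpha exp(-tr z); its normalising constant is phi(s). A
   change of variables shows that Lambda intertwines the kernel of the pair with Q_bar. It also
   shows that b(1) has conditional law Lambda(S(1), .) given S(1); hence, by induction, b(n) has
   conditional law Lambda(S(n), .) given S(1), ..., S(n), and S is Markov with kernel Q_bar.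

   The Gamma and Beta integrals are not computed: that the laws of R(0) and of X(1) have mass one is
   given, and the remaining normalisations follow from the intertwining. The change of variables
   only needs that mu is invariant under congruences and under inversion, and both invariances come
   from uniqueness of invariant measures instead of Jacobian determinants. *)

theory Submission
  imports Defs
begin

section \<open>Positive definite matrices\<close>

text \<open>A function of a Markov chain need not be Markov; what rescues S is the Rogers-Pitman
  criterion, with Lambda as the intertwining kernel. Uniqueness of invariant measures is a Fubini
  argument: a linear action multiplies a translation-invariant measure by a positive character of
  the general linear group, and such a character is determined by its values on diagonal matrices,
  where the scaling is a product of one-dimensional ones. For inversion, \<open>posdef_mu\<close>
  and its image are both compared with the image of Haar measure under a |-> a a^T. That comparison
  uses square roots, and so does the walk; their existence comes from connectedness of the cone and
  their continuity from invariance of domain. Conditional laws are expressed as identities between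
  nonnegative integrals over events of the filtration, with test functions bounded by 1; real
  conditional expectations appear only at the very end.\<close>

lemma matrix_inv_eqI:
  fixes a b :: "'n::finite sqmat"
  assumes "a ** b = mat 1"
  shows "matrix_inv a = b"
proof -
  have "b ** a = mat 1" using assms matrix_left_right_inverse by blast
  with assms have "\<exists>x. a ** x = mat 1 \<and> x ** a = mat 1" by blast
  from someI_ex[OF this] have "a ** matrix_inv a = mat 1" unfolding matrix_inv_def by blast
  then have "b ** (a ** matrix_inv a) = b" by simp
  then show ?thesis using \<open>b ** a = mat 1\<close> by (simp add: matrix_mul_assoc)
qed

lemma invertible_matrix_inv:
  fixes a :: "'n::finite sqmat"
  assumes "invertible a"
  shows "a ** matrix_inv a = mat 1" "matrix_inv a ** a = mat 1"
  using someI_ex[OF assms[unfolded invertible_def]] unfolding matrix_inv_def by blast+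

lemma invertible_matrix_mult:
  fixes a b :: "'n::finite sqmat"
  shows "invertible (a ** b) \<longleftrightarrow> invertible a \<and> invertible b"
  by (simp add: invertible_det_nz det_mul)

lemma matrix_mult_inv_cancel:
  fixes a b :: "'n::finite sqmat"
  assumes "invertible a"
  shows "a ** (matrix_inv a ** b) = b" "matrix_inv a ** (a ** b) = b"
    "b ** a ** matrix_inv a = b" "b ** matrix_inv a ** a = b"
  using invertible_matrix_inv[OF assms] by (metis matrix_mul_assoc matrix_mul_lid matrix_mul_rid)+

lemma matrix_inv_mult:
  fixes a b :: "'n::finite sqmat"
  assumes "invertible a" "invertible b"
  shows "matrix_inv (a ** b) = matrix_inv b ** matrix_inv a"
  using assms by (intro matrix_inv_eqI) (simp add: matrix_mul_assoc matrix_mult_inv_cancel invertible_matrix_inv)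

lemma matrix_inv_inv:
  fixes a :: "'n::finite sqmat"
  assumes "invertible a"
  shows "matrix_inv (matrix_inv a) = a"
  using assms by (intro matrix_inv_eqI) (simp add: invertible_matrix_inv)

lemma invertible_inv:
  fixes a :: "'n::finite sqmat"
  assumes "invertible a"
  shows "invertible (matrix_inv a)"
  using invertible_matrix_inv[OF assms] unfolding invertible_def by blast

lemma invertible_transpose_iff:
  fixes a :: "'n::finite sqmat"
  shows "invertible (transpose a) \<longleftrightarrow> invertible a"
  by (simp add: invertible_det_nz)

lemma matrix_inv_transpose:
  fixes a :: "'n::finite sqmat"
  assumes "invertible a"
  shows "matrix_inv (transpose a) = transpose (matrix_inv a)"
  using assms by (intro matrix_inv_eqI)
    (simp add: matrix_transpose_mul[symmetric] invertible_matrix_inv transpose_mat)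

lemma det_matrix_inv:
  fixes a :: "'n::finite sqmat"
  assumes "invertible a"
  shows "det (matrix_inv a) = inverse (det a)"
proof -
  have "det a * det (matrix_inv a) = 1"
    using invertible_matrix_inv[OF assms] by (metis det_I det_mul)
  then show ?thesis by (metis inverse_unique)
qed

lemma dot_matrix_mult:
  fixes a :: "'n::finite sqmat"
  shows "v \<bullet> (a *v w) = (transpose a *v v) \<bullet> w"
  by (metis dot_lmul_matrix transpose_matrix_vector transpose_transpose)

lemma matrix_diff_ldistrib:
  fixes a b c :: "'n::finite sqmat"
  shows "a ** (b - c) = a ** b - a ** c"
  by (simp add: matrix_matrix_mult_def vec_eq_iff sum_subtractf[symmetric] right_diff_distrib)

lemma matrix_diff_rdistrib:
  fixes a b c :: "'n::finite sqmat"
  shows "(a - b) ** c = a ** c - b ** c"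
  by (simp add: matrix_matrix_mult_def vec_eq_iff sum_subtractf[symmetric] left_diff_distrib)

lemma matrix_add_rdistrib:
  fixes a b c :: "'n::finite sqmat"
  shows "(a + b) ** c = a ** c + b ** c"
  by (simp add: matrix_matrix_mult_def vec_eq_iff sum.distrib[symmetric] distrib_right)

lemma transpose_add: "transpose (a + b) = transpose a + transpose (b :: 'n::finite sqmat)"
  by (simp add: transpose_def vec_eq_iff)

lemma transpose_diff: "transpose (a - b) = transpose a - transpose (b :: 'n::finite sqmat)"
  by (simp add: transpose_def vec_eq_iff)

lemma transpose_scaleR: "transpose (c *\<^sub>R a) = c *\<^sub>R transpose (a :: 'n::finite sqmat)"
  by (simp add: transpose_def vec_eq_iff)

lemma transpose_zero: "transpose 0 = (0 :: 'n::finite sqmat)"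
  by (simp add: transpose_def vec_eq_iff)

lemma posdef_matsD:
  assumes "x \<in> posdef_mats"
  shows "transpose x = x" "v \<noteq> 0 \<Longrightarrow> v \<bullet> (x *v v) > 0"
  using assms by (auto simp: posdef_mats_def)

lemma posdef_matsI:
  assumes "transpose x = x" "\<And>v. v \<noteq> 0 \<Longrightarrow> v \<bullet> (x *v v) > 0"
  shows "x \<in> posdef_mats"
  using assms by (auto simp: posdef_mats_def)

lemma posdef_nonneg: "x \<in> posdef_mats \<Longrightarrow> v \<bullet> (x *v v) \<ge> 0"
  by (cases "v = 0") (auto dest: posdef_matsD(2) less_imp_le)

lemma posdef_invertible:
  fixes x :: "'n::finite sqmat"
  assumes "x \<in> posdef_mats"
  shows "invertible x"
proof -
  have "x *v v \<noteq> 0" if "v \<noteq> 0" for v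
    using posdef_matsD(2)[OF assms that] by force
  then show ?thesis
    by (metis invertible_left_inverse matrix_left_invertible_ker)
qed

lemma posdef_id: "mat 1 \<in> posdef_mats"
  by (intro posdef_matsI) (simp_all add: transpose_mat)

lemma posdef_add:
  fixes x y :: "'n::finite sqmat"
  assumes "x \<in> posdef_mats" "y \<in> posdef_mats"
  shows "x + y \<in> posdef_mats"
  using assms by (intro posdef_matsI)
    (auto simp: transpose_add posdef_matsD matrix_vector_mult_add_rdistrib inner_add_right intro!: add_pos_pos)

lemma posdef_scaleR:
  fixes x :: "'n::finite sqmat"
  assumes "x \<in> posdef_mats" "c > 0"
  shows "c *\<^sub>R x \<in> posdef_mats"
  using assms by (intro posdef_matsI)
    (auto simp: transpose_scaleR posdef_matsD scaleR_matrix_vector_assoc[symmetric])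

lemma posdef_congruence:
  fixes x a :: "'n::finite sqmat"
  assumes "x \<in> posdef_mats" "invertible a"
  shows "a ** x ** transpose a \<in> posdef_mats"
proof (intro posdef_matsI)
  show "transpose (a ** x ** transpose a) = a ** x ** transpose a"
    using posdef_matsD(1)[OF assms(1)] by (simp add: matrix_transpose_mul matrix_mul_assoc)
next
  fix v :: "(real, 'n) vec" assume "v \<noteq> 0"
  then have "transpose a *v v \<noteq> 0"
    using assms(2) inj_matrix_vector_mult[of "transpose a"]
    by (metis invertible_transpose_iff injD matrix_vector_mult_0_right)
  from posdef_matsD(2)[OF assms(1) this] show "0 < v \<bullet> (a ** x ** transpose a *v v)"
    by (simp add: matrix_vector_mul_assoc[symmetric] dot_matrix_mult)
qed

lemma posdef_inv:
  fixes x :: "'n::finite sqmat"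
  assumes "x \<in> posdef_mats"
  shows "matrix_inv x \<in> posdef_mats"
proof -
  have "matrix_inv x ** x ** transpose (matrix_inv x) = matrix_inv x"
    using assms by (metis invertible_matrix_inv(2) matrix_inv_transpose matrix_mul_lid posdef_invertible posdef_matsD(1))
  then show ?thesis
    using posdef_congruence[OF assms invertible_inv[OF posdef_invertible[OF assms]]] by simp
qed

lemma convex_posdef: "convex (posdef_mats :: 'n::finite sqmat set)"
  unfolding convex_alt
proof safe
  fix x y :: "'n sqmat" and u :: real
  assume *: "x \<in> posdef_mats" "y \<in> posdef_mats" "0 \<le> u" "u \<le> 1"
  consider "u = 0" | "u = 1" | "0 < u" "u < 1" using * by linarith
  then show "(1 - u) *\<^sub>R x + u *\<^sub>R y \<in> posdef_mats"
  proof cases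
    case 3
    with * show ?thesis by (intro posdef_add posdef_scaleR) auto
  qed (use * in simp_all)
qed

lemma continuous_on_det: "continuous_on S (det :: 'n::finite sqmat \<Rightarrow> real)"
  unfolding det_def by (intro continuous_intros)

text \<open>The determinant is continuous and has no zero on the convex, hence connected, cone; its
  value 1 at \<open>mat 1\<close> fixes the sign.\<close>

lemma posdef_det_pos:
  fixes x :: "'n::finite sqmat"
  assumes "x \<in> posdef_mats"
  shows "det x > 0"
proof (rule ccontr)
  assume "\<not> 0 < det x"
  have "connected (det ` (posdef_mats :: 'n sqmat set))"
    by (intro connected_continuous_image continuous_on_det convex_connected convex_posdef)
  moreover have "det x \<in> det ` (posdef_mats :: 'n sqmat set)" using assms by blast
  moreover have "(1::real) \<in> det ` (posdef_mats :: 'n sqmat set)"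
    using posdef_id by (metis det_I imageI)
  ultimately have "(0::real) \<in> det ` (posdef_mats :: 'n sqmat set)"
    using \<open>\<not> 0 < det x\<close> unfolding connected_iff_interval by (meson not_less zero_le_one)
  then show False using posdef_invertible invertible_det_nz by fastforce
qed

text \<open>The resolvent identity. Positivity becomes visible once the right-hand side is
  recognised as the inverse of \<open>b + b s^-1 b\<close>. The determinant formula drives all
  density computations.\<close>

lemma posdef_inv_diff:
  fixes b s :: "'n::finite sqmat"
  assumes "b \<in> posdef_mats" "s \<in> posdef_mats"
  shows "matrix_inv b - matrix_inv (b + s) = matrix_inv b ** s ** matrix_inv (b + s)"
    and "matrix_inv b - matrix_inv (b + s) \<in> posdef_mats"
    and "det (matrix_inv b - matrix_inv (b + s)) = det s / (det b * det (b + s))"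
proof -
  have b: "invertible b" and s: "invertible s" and bs: "invertible (b + s)"
    using assms posdef_invertible posdef_add by blast+
  have "matrix_inv b ** s ** matrix_inv (b + s) = matrix_inv b ** ((b + s) - b) ** matrix_inv (b + s)"
    by simp
  also have "\<dots> = matrix_inv b - matrix_inv (b + s)"
    unfolding matrix_diff_ldistrib matrix_diff_rdistrib
    using b bs by (simp add: matrix_mult_inv_cancel invertible_matrix_inv)
  finally show eq: "matrix_inv b - matrix_inv (b + s) = matrix_inv b ** s ** matrix_inv (b + s)" ..
  have "matrix_inv (b + b ** matrix_inv s ** transpose b) = matrix_inv b ** s ** matrix_inv (b + s)"
  proof (rule matrix_inv_eqI)
    have "b + b ** matrix_inv s ** transpose b = (b + s) ** matrix_inv s ** b"
      using assms s by (simp add: posdef_matsD matrix_add_rdistrib matrix_mul_assoc[symmetric] invertible_matrix_inv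
          add.commute)
    then show "(b + b ** matrix_inv s ** transpose b) ** (matrix_inv b ** s ** matrix_inv (b + s)) = mat 1"
      using b s bs by (simp add: matrix_mul_assoc matrix_mult_inv_cancel invertible_matrix_inv)
  qed
  moreover have "b + b ** matrix_inv s ** transpose b \<in> posdef_mats"
    using assms b by (intro posdef_add posdef_congruence posdef_inv)
  ultimately show "matrix_inv b - matrix_inv (b + s) \<in> posdef_mats"
    using posdef_inv eq by metis
  show "det (matrix_inv b - matrix_inv (b + s)) = det s / (det b * det (b + s))"
    unfolding eq using b bs by (simp add: det_mul det_matrix_inv field_simps)
qed

text \<open>Inversion reverses the Loewner order; the converse holds because inversion is an
  involution. Later this matches the supports of two integrands.\<close>

lemma posdef_inv_diff_iff:
  fixes z b :: "'n::finite sqmat"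
  assumes "z \<in> posdef_mats" "b \<in> posdef_mats"
  shows "matrix_inv z - matrix_inv b \<in> posdef_mats \<longleftrightarrow> b - z \<in> posdef_mats"
proof
  assume "b - z \<in> posdef_mats"
  from posdef_inv_diff(2)[OF assms(1) this] show "matrix_inv z - matrix_inv b \<in> posdef_mats" by simp
next
  assume "matrix_inv z - matrix_inv b \<in> posdef_mats"
  from posdef_inv_diff(2)[OF posdef_inv[OF assms(2)] this] show "b - z \<in> posdef_mats"
    using assms by (simp add: matrix_inv_inv posdef_invertible)
qed

section \<open>Continuity of matrix operations and norm estimates\<close>

lemma continuous_on_matrix_mult [continuous_intros]:
  fixes f g :: "'a::topological_space \<Rightarrow> 'n::finite sqmat"
  assumes "continuous_on S f" "continuous_on S g"
  shows "continuous_on S (\<lambda>x. f x ** g x)"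
  unfolding matrix_matrix_mult_def using assms by (intro continuous_intros)

lemma continuous_on_transpose [continuous_intros]:
  fixes f :: "'a::topological_space \<Rightarrow> 'n::finite sqmat"
  assumes "continuous_on S f"
  shows "continuous_on S (\<lambda>x. transpose (f x))"
  unfolding transpose_def using assms by (intro continuous_intros)

lemma continuous_on_trace [continuous_intros]:
  fixes f :: "'a::topological_space \<Rightarrow> 'n::finite sqmat"
  assumes "continuous_on S f"
  shows "continuous_on S (\<lambda>x. trace (f x))"
  unfolding trace_def using assms by (intro continuous_intros)

lemma trace_transpose_mult_self:
  fixes a :: "'n::finite sqmat"
  shows "trace (transpose a ** a) = (norm a)\<^sup>2"
proof -
  have "trace (transpose a ** a) = (\<Sum>i\<in>UNIV. \<Sum>k\<in>UNIV. (a $ k $ i)\<^sup>2)"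
    by (simp add: trace_def matrix_matrix_mult_def transpose_def power2_eq_square)
  also have "\<dots> = (\<Sum>k\<in>UNIV. \<Sum>i\<in>UNIV. (a $ k $ i)\<^sup>2)" by (rule sum.swap)
  also have "\<dots> = (norm a)\<^sup>2"
    by (simp add: norm_vec_def L2_set_def sum_nonneg)
  finally show ?thesis .
qed

text \<open>\<open>norm\<close> on matrices is the Frobenius norm, and Cauchy-Schwarz on each row
  bounds the operator norm by it.\<close>

lemma norm_matrix_vector_mult_le:
  fixes a :: "'n::finite sqmat"
  shows "norm (a *v v) \<le> norm a * norm v"
proof -
  have "(norm (a *v v))\<^sup>2 = (\<Sum>i\<in>UNIV. (a $ i \<bullet> v)\<^sup>2)"
    by (simp add: norm_vec_def L2_set_def sum_nonneg matrix_vector_mult_def inner_vec_def)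
  also have "\<dots> \<le> (\<Sum>i\<in>UNIV. (norm (a $ i) * norm v)\<^sup>2)"
    by (intro sum_mono) (metis Cauchy_Schwarz_ineq2 abs_le_square_iff abs_mult abs_norm_cancel)
  also have "\<dots> = (norm a * norm v)\<^sup>2"
    by (simp add: norm_vec_def[of a] L2_set_def sum_nonneg power_mult_distrib sum_distrib_right)
  finally show ?thesis by (simp add: power2_le_iff_abs_le)
qed

lemma continuous_on_quadratic_form [continuous_intros]:
  fixes f :: "'a::topological_space \<Rightarrow> 'n::finite sqmat"
  assumes "continuous_on S f" "continuous_on S g"
  shows "continuous_on S (\<lambda>x. g x \<bullet> (f x *v g x))"
  unfolding matrix_vector_mult_def using assms by (intro continuous_intros)

section \<open>Topology of the cone of positive definite matrices\<close>

text \<open>In dimension greater than one the cone is not open among all matrices, so openness is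
  taken relative to this subspace.\<close>

definition sym_mats :: "'n::finite sqmat set" where
  "sym_mats = {x. transpose x = x}"

lemma subspace_sym_mats: "subspace sym_mats"
  by (auto simp: subspace_def sym_mats_def transpose_add transpose_scaleR transpose_zero)

lemma posdef_subset_sym: "posdef_mats \<subseteq> sym_mats"
  by (auto simp: sym_mats_def posdef_matsD)

lemma closed_sym_mats: "closed (sym_mats :: 'n::finite sqmat set)"
  unfolding sym_mats_def by (intro closed_Collect_eq continuous_intros)

text \<open>By compactness of the unit sphere the quadratic form of \<open>x\<close> is at least
  \<open>e |v|^2\<close> with \<open>e > 0\<close>, and a symmetric perturbation of norm less than
  \<open>e\<close> cannot use that up.\<close>

lemma openin_posdef: "openin (top_of_set sym_mats) (posdef_mats :: 'n::finite sqmat set)"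
  unfolding openin_contains_ball
proof (safe)
  fix x :: "'n sqmat" assume "x \<in> posdef_mats" then show "x \<in> sym_mats" using posdef_subset_sym by blast
next
  fix x :: "'n sqmat" assume x: "x \<in> posdef_mats"
  have "(axis undefined 1 :: real^'n) \<in> sphere 0 1" by simp
  then have "sphere (0 :: real^'n) 1 \<noteq> {}" by blast
  moreover have "continuous_on (sphere 0 1) (\<lambda>v. v \<bullet> (x *v v))"
    by (intro continuous_on_quadratic_form continuous_intros)
  ultimately obtain u :: "real^'n"
    where u: "norm u = 1" "\<And>v. norm v = 1 \<Longrightarrow> u \<bullet> (x *v u) \<le> v \<bullet> (x *v v)"
    using continuous_attains_inf[of "sphere (0 :: real^'n) 1" "\<lambda>v. v \<bullet> (x *v v)"]
    by auto
  define e where "e = u \<bullet> (x *v u)"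
  have "e > 0" unfolding e_def using u(1) posdef_matsD(2)[OF x, of u] by force
  have ge: "v \<bullet> (x *v v) \<ge> e * (norm v)\<^sup>2" for v
  proof (cases "v = 0")
    case False
    then have "e \<le> (v /\<^sub>R norm v) \<bullet> (x *v (v /\<^sub>R norm v))" unfolding e_def by (intro u(2)) simp
    also have "\<dots> = v \<bullet> (x *v v) / (norm v)\<^sup>2"
      by (simp add: matrix_vector_mult_scaleR power2_eq_square field_simps)
    finally show ?thesis using False by (simp add: field_simps)
  qed simp
  have "ball x e \<inter> sym_mats \<subseteq> posdef_mats"
  proof safe
    fix y assume y: "y \<in> ball x e" "y \<in> sym_mats"
    show "y \<in> posdef_mats"
    proof (intro posdef_matsI)
      show "transpose y = y" using y by (simp add: sym_mats_def)
      fix v :: "real^'n" assume "v \<noteq> 0"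
      have "\<bar>v \<bullet> ((x - y) *v v)\<bar> \<le> norm v * (norm (x - y) * norm v)"
        by (rule order_trans[OF Cauchy_Schwarz_ineq2]) (intro mult_left_mono norm_matrix_vector_mult_le norm_ge_zero)
      also have "\<dots> < e * (norm v)\<^sup>2"
        using y \<open>v \<noteq> 0\<close> by (simp add: dist_norm power2_eq_square field_simps)
      finally show "0 < v \<bullet> (y *v v)"
        using ge[of v] by (simp add: matrix_vector_mult_diff_rdistrib inner_diff_right)
    qed
  qed
  with \<open>e > 0\<close> show "\<exists>e>0. ball x e \<inter> sym_mats \<subseteq> posdef_mats" by blast
qed

text \<open>If the form vanished at some nonzero \<open>v\<close>, its first-order change along
  \<open>w = x v\<close>, nonzero by invertibility, would be \<open>2 t |w|^2\<close>; a small
  negative \<open>t\<close> would then make the form negative.\<close>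

lemma posdef_of_nonneg_invertible:
  fixes x :: "'n::finite sqmat"
  assumes "transpose x = x" "\<And>v. v \<bullet> (x *v v) \<ge> 0" "invertible x"
  shows "x \<in> posdef_mats"
proof (intro posdef_matsI assms(1))
  fix v :: "real^'n" assume "v \<noteq> 0"
  define w where "w = x *v v"
  have w: "w \<noteq> 0" unfolding w_def using \<open>v \<noteq> 0\<close> inj_matrix_vector_mult[OF assms(3)]
    by (metis injD matrix_vector_mult_0_right)
  show "0 < v \<bullet> (x *v v)"
  proof (rule ccontr)
    assume "\<not> ?thesis"
    with assms(2)[of v] have 0: "v \<bullet> w = 0" by (simp add: w_def)
    have eq: "(v + t *\<^sub>R w) \<bullet> (x *v (v + t *\<^sub>R w)) = t * (2 * (w \<bullet> w) + t * (w \<bullet> (x *v w)))" for t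
    proof -
      have "v \<bullet> (x *v w) = w \<bullet> w" using dot_matrix_mult[of v x w] assms(1) by (simp add: w_def)
      then show ?thesis using 0
        by (simp add: matrix_vector_right_distrib matrix_vector_mult_scaleR w_def[symmetric]
            inner_add_left inner_add_right algebra_simps)
    qed
    define c where "c = w \<bullet> (x *v w)"
    have c: "c \<ge> 0" using assms(2) c_def by blast
    \<comment> \<open>This \<open>t\<close> is negative and keeps the second-order term under
      control: \<open>|t| c \<le> |w|^2 < 2 |w|^2\<close>. The 1 in the denominator covers
      \<open>c = 0\<close>.\<close>
    define t where "t = - (w \<bullet> w) / (1 + c)"
    have ww: "w \<bullet> w > 0" using w by simp
    have "t < 0" using ww c by (simp add: t_def divide_neg_pos)
    moreover have "2 * (w \<bullet> w) + t * c > 0"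
    proof -
      have "(w \<bullet> w) * c / (1 + c) \<le> w \<bullet> w" using c ww by (simp add: field_simps)
      then have "(w \<bullet> w) * c / (1 + c) < 2 * (w \<bullet> w)" using ww by linarith
      then show ?thesis by (simp add: t_def)
    qed
    ultimately have "t * (2 * (w \<bullet> w) + t * (w \<bullet> (x *v w))) < 0"
      unfolding c_def[symmetric] by (rule mult_neg_pos)
    then show False using assms(2)[of "v + t *\<^sub>R w"] unfolding eq by simp
  qed
qed

section \<open>Existence, uniqueness and continuity of the positive definite square root\<close>

text \<open>For \<open>h = b - c\<close> the hypothesis reads \<open>b h + h c = 0\<close>. The
  trace against \<open>h\<close> gives \<open>tr (h b h) + tr (h c h) = 0\<close>, a sum of
  nonnegative terms, so the form of \<open>b\<close> vanishes on every column of
  \<open>h\<close>.\<close>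

lemma posdef_square_inj:
  fixes b c :: "'n::finite sqmat"
  assumes "b \<in> posdef_mats" "c \<in> posdef_mats" "b ** b = c ** c"
  shows "b = c"
proof -
  define h where "h = b - c"
  have th: "transpose h = h" using assms by (simp add: h_def transpose_diff posdef_matsD)
  have "b ** h + h ** c = 0"
    using assms(3) by (simp add: h_def matrix_diff_ldistrib matrix_diff_rdistrib)
  then have "trace (h ** (b ** h + h ** c)) = 0" by (simp add: trace_def)
  then have 0: "trace (h ** b ** h) + trace (h ** c ** h) = 0"
    by (simp add: matrix_add_ldistrib trace_add matrix_mul_assoc) (metis matrix_mul_assoc trace_mul_sym)
  have tr: "trace (h ** x ** h) = (\<Sum>i\<in>UNIV. column i h \<bullet> (x *v column i h))" for x
  proof -
    have "(h ** x ** h) $ i $ i = column i h \<bullet> (x *v column i h)" for i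
    proof -
      have "(h ** x ** h) $ i $ i = (transpose h ** (x ** h)) $ i $ i" by (simp add: th matrix_mul_assoc)
      also have "\<dots> = column i h \<bullet> (x *v column i h)"
        by (simp add: matrix_matrix_mult_def transpose_def inner_vec_def column_def matrix_vector_mult_def)
      finally show ?thesis .
    qed
    then show ?thesis by (simp add: trace_def)
  qed
  have nn: "trace (h ** x ** h) \<ge> 0" if "x \<in> posdef_mats" for x
    unfolding tr by (intro sum_nonneg posdef_nonneg that)
  have "trace (h ** b ** h) = 0" using 0 nn[OF assms(1)] nn[OF assms(2)] by linarith
  then have "\<forall>i. column i h \<bullet> (b *v column i h) = 0"
    unfolding tr by (subst (asm) sum_nonneg_eq_0_iff) (auto intro: posdef_nonneg assms)
  then have "column i h = 0" for i using posdef_matsD(2)[OF assms(1)] by (metis less_irrefl)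
  then have "h = 0" by (simp add: column_def vec_eq_iff)
  then show ?thesis by (simp add: h_def)
qed

lemma posdef_square:
  fixes b :: "'n::finite sqmat"
  assumes "b \<in> posdef_mats"
  shows "b ** b \<in> posdef_mats"
  using posdef_congruence[OF posdef_id posdef_invertible[OF assms]] assms by (simp add: posdef_matsD)

text \<open>Invariance of domain on the vector space of symmetric matrices: a continuous injective
  map from an open subset into a space of the same dimension is open.\<close>

lemma open_map_square:
  fixes U :: "'n::finite sqmat set"
  assumes "openin (top_of_set posdef_mats) U"
  shows "openin (top_of_set sym_mats) ((\<lambda>b. b ** b) ` U)"
proof (rule invariance_of_domain_subspaces)
  show "openin (top_of_set sym_mats) U" using assms openin_posdef openin_trans by blast
  have U: "U \<subseteq> posdef_mats" using assms openin_imp_subset by blast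
  show "(\<lambda>b. b ** b) \<in> U \<rightarrow> sym_mats" using U posdef_square posdef_subset_sym by blast
  show "inj_on (\<lambda>b. b ** b) U" using U posdef_square_inj by (meson inj_onI subsetD)
qed (intro subspace_sym_mats order_refl continuous_intros)+

text \<open>If the squares of \<open>b n\<close> converge, their traces \<open>|b n|^2\<close> are
  bounded, so a subsequence of \<open>b n\<close> converges. The limit is positive semidefinite, and
  it is invertible because its square is.\<close>

lemma closedin_square_image:
  "closedin (top_of_set posdef_mats) ((\<lambda>b. b ** b) ` (posdef_mats :: 'n::finite sqmat set))"
  unfolding closedin_limpt islimpt_sequential
proof safe
  fix b :: "'n sqmat" assume "b \<in> posdef_mats" then show "b ** b \<in> posdef_mats" by (rule posdef_square)
next
  fix y :: "nat \<Rightarrow> 'n sqmat" and a :: "'n sqmat"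
  assume y: "\<forall>n. y n \<in> (\<lambda>b. b ** b) ` posdef_mats - {a}" and a: "a \<in> posdef_mats"
    and lim: "y \<longlonglongrightarrow> a"
  then have "\<forall>n. \<exists>b \<in> posdef_mats. y n = b ** b" by blast
  then obtain b where b: "\<And>n. b n \<in> posdef_mats" "\<And>n. y n = b n ** b n"
    by metis
  have "(\<lambda>n. trace (y n)) \<longlonglongrightarrow> trace a"
    unfolding trace_def by (intro tendsto_intros lim)
  moreover have "trace (y n) = (norm (b n))\<^sup>2" for n
    using trace_transpose_mult_self[of "b n"] b by (simp add: posdef_matsD)
  ultimately have "(\<lambda>n. (norm (b n))\<^sup>2) \<longlonglongrightarrow> trace a" by simp
  then have "Bseq (\<lambda>n. (norm (b n))\<^sup>2)" by (intro convergent_imp_Bseq convergentI)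
  then obtain K where K: "\<And>n. (norm (b n))\<^sup>2 \<le> K" by (auto simp: Bseq_def)
  have "norm (b n) \<le> sqrt K" for n using K[of n] by (simp add: real_le_rsqrt)
  then have "bounded (range b)" by (auto simp: bounded_iff)
  then obtain l r where r: "strict_mono r" and l: "(b \<circ> r) \<longlonglongrightarrow> l"
    using bounded_imp_convergent_subsequence by blast
  have "(\<lambda>n. b (r n) ** b (r n)) \<longlonglongrightarrow> l ** l"
    unfolding matrix_matrix_mult_def using l by (intro tendsto_intros) (simp_all add: o_def)
  moreover have "(\<lambda>n. b (r n) ** b (r n)) \<longlonglongrightarrow> a"
    using LIMSEQ_subseq_LIMSEQ[OF lim r] by (simp add: b(2) o_def)
  ultimately have ll: "l ** l = a" by (rule LIMSEQ_unique)
  have "l \<in> posdef_mats"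
  proof (rule posdef_of_nonneg_invertible)
    show "transpose l = l"
    proof (rule LIMSEQ_unique)
      show "(\<lambda>n. transpose (b (r n))) \<longlonglongrightarrow> transpose l"
        unfolding transpose_def using l by (intro tendsto_intros) (simp add: o_def)
      show "(\<lambda>n. transpose (b (r n))) \<longlonglongrightarrow> l"
        using l b by (simp add: posdef_matsD o_def)
    qed
    show "invertible l" using ll a posdef_invertible invertible_matrix_mult by metis
    fix v
    have "(\<lambda>n. v \<bullet> (b (r n) *v v)) \<longlonglongrightarrow> v \<bullet> (l *v v)"
      unfolding matrix_vector_mult_def using l by (intro tendsto_intros) (simp add: o_def)
    then show "0 \<le> v \<bullet> (l *v v)"
      by (rule LIMSEQ_le_const) (use b posdef_nonneg in blast)
  qed
  then show "a \<in> (\<lambda>b. b ** b) ` posdef_mats" using ll by blast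
qed

text \<open>The squares form a nonempty subset that is both open and closed in a connected set; this
  is where square roots come from.\<close>

lemma square_image_posdef:
  "(\<lambda>b. b ** b) ` posdef_mats = (posdef_mats :: 'n::finite sqmat set)"
proof -
  let ?q = "\<lambda>b :: 'n sqmat. b ** b"
  have sub: "?q ` posdef_mats \<subseteq> posdef_mats" using posdef_square by blast
  have "openin (top_of_set posdef_mats) (?q ` posdef_mats)"
    by (rule openin_subset_trans[OF open_map_square sub posdef_subset_sym]) simp
  moreover have "connected (posdef_mats :: 'n sqmat set)" by (rule convex_connected[OF convex_posdef])
  moreover have "?q ` posdef_mats \<noteq> {}" using posdef_id by blast
  ultimately show ?thesis using closedin_square_image unfolding connected_clopen by blast
qed

lemma mat_sqrt:
  fixes x :: "'n::finite sqmat"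
  assumes "x \<in> posdef_mats"
  shows "mat_sqrt x \<in> posdef_mats" "mat_sqrt x ** mat_sqrt x = x"
proof -
  have "x \<in> (\<lambda>b. b ** b) ` posdef_mats" using assms unfolding square_image_posdef .
  then obtain b where "b \<in> posdef_mats" "b ** b = x" by blast
  then have "\<exists>!b. b \<in> posdef_mats \<and> b ** b = x" using posdef_square_inj by metis
  from theI'[OF this] show "mat_sqrt x \<in> posdef_mats" "mat_sqrt x ** mat_sqrt x = x"
    unfolding mat_sqrt_def by blast+
qed

lemma mat_sqrt_square: "b \<in> posdef_mats \<Longrightarrow> mat_sqrt (b ** b) = b"
  by (meson mat_sqrt posdef_square posdef_square_inj)

text \<open>The preimage of an open set under \<open>mat_sqrt\<close> is its image under squaring,
  which is an open map. Continuity supplies the Borel measurability of the walk.\<close>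

lemma continuous_on_mat_sqrt: "continuous_on posdef_mats (mat_sqrt :: 'n::finite sqmat \<Rightarrow> _)"
proof -
  have "openin (top_of_set posdef_mats) (posdef_mats \<inter> mat_sqrt -` U)"
    if "openin (top_of_set posdef_mats) U" for U :: "'n sqmat set"
  proof -
    have U: "U \<subseteq> posdef_mats" using that openin_imp_subset by blast
    have "posdef_mats \<inter> mat_sqrt -` U = (\<lambda>b. b ** b) ` U"
      using U mat_sqrt mat_sqrt_square posdef_square by (force simp: image_iff)
    with open_map_square[OF that]
    have "openin (top_of_set sym_mats) (posdef_mats \<inter> mat_sqrt -` U)" by simp
    then show ?thesis by (rule openin_subset_trans[OF _ _ posdef_subset_sym]) blast
  qed
  then show ?thesis
    using continuous_on_open_gen[of mat_sqrt posdef_mats posdef_mats] mat_sqrt(1) by blast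
qed

section \<open>Linear actions of the general linear group on invariant measures\<close>

abbreviation diag_mat :: "('n \<Rightarrow> real) \<Rightarrow> 'n::finite sqmat" where
  "diag_mat d \<equiv> (\<chi> i j. if i = j then d i else 0)"

lemma det_diag_mat: "det (diag_mat d) = (\<Prod>i\<in>UNIV. d i)"
  by (subst det_diagonal) auto

lemma diag_mat_mult: "(diag_mat d ** a) $ i $ j = d i * a $ i $ j"
  "(a ** diag_mat d) $ i $ j = a $ i $ j * d j"
  by (simp_all add: matrix_matrix_mult_def if_distrib if_distribR cong: if_cong)

text \<open>A shear \<open>e\<close> is conjugate to its square by a diagonal matrix and a swap is an
  involution, so positive characters are trivial on both.\<close>

lemma matrix_character_eqI:
  fixes f g :: "'n::finite sqmat \<Rightarrow> real"
  assumes f: "\<And>a b. invertible a \<Longrightarrow> invertible b \<Longrightarrow> f (a ** b) = f a * f b"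
    and g: "\<And>a b. invertible a \<Longrightarrow> invertible b \<Longrightarrow> g (a ** b) = g a * g b"
    and pos: "\<And>a. invertible a \<Longrightarrow> f a > 0" "\<And>a. invertible a \<Longrightarrow> g a > 0"
    and diag: "\<And>d. (\<forall>i. d i \<noteq> 0) \<Longrightarrow> f (diag_mat d) = g (diag_mat d)"
  assumes "invertible a"
  shows "f a = g a"
proof -
  have one: "h (mat 1) = 1" "\<And>s. s ** s = mat 1 \<Longrightarrow> h s = 1"
    "\<And>m n. m \<noteq> n \<Longrightarrow> invertible ((\<chi> i j. of_bool (i = m \<and> j = n \<or> i = j)) :: 'n sqmat) \<Longrightarrow>
      h (\<chi> i j. of_bool (i = m \<and> j = n \<or> i = j)) = 1"
    if h: "\<And>a b. invertible a \<Longrightarrow> invertible b \<Longrightarrow> h (a ** b) = h a * h b" "\<And>a. invertible a \<Longrightarrow> h a > 0"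
    for h :: "'n sqmat \<Rightarrow> real"
  proof -
    show 1: "h (mat 1) = 1"
      using h(1)[of "mat 1" "mat 1"] h(2)[of "mat 1"] by (simp add: invertible_det_nz)
    show "h s = 1" if "s ** s = mat 1" for s
    proof -
      have "invertible s" using that unfolding invertible_def by blast
      with h(1)[of s s] h(2)[of s] that 1 show ?thesis
        by (metis abs_of_pos abs_square_eq_1 power2_eq_square)
    qed
    fix m n :: 'n
    let ?e = "(\<chi> i j. of_bool (i = m \<and> j = n \<or> i = j)) :: 'n sqmat"
    assume mn: "m \<noteq> n" and e: "invertible ?e"
    \<comment> \<open>Conjugation by \<open>d\<close> doubles the entry at \<open>(m, n)\<close> and
      fixes the diagonal; squaring \<open>?e\<close> has the same effect.\<close>
    define d :: "'n sqmat" where "d = diag_mat (\<lambda>i. if i = m then 2 else 1)"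
    have d: "invertible d" unfolding d_def by (simp add: invertible_det_nz det_diag_mat)
    have "d ** ?e = (\<chi> i j. if i = m then 2 * of_bool (j = n \<or> j = m) else of_bool (i = j))"
      by (auto simp: d_def vec_eq_iff diag_mat_mult)
    moreover have ee: "?e ** ?e = (\<chi> i j. if i = m \<and> j = n then 2 else of_bool (i = j))"
    proof -
      have "(\<Sum>k\<in>UNIV. of_bool (i = m \<and> k = n \<or> i = k) * of_bool (k = m \<and> j = n \<or> k = j))
          = (if i = m \<and> j = n then 2 else of_bool (i = j) :: real)" for i j
      proof -
        have "(\<Sum>k\<in>UNIV. of_bool (i = m \<and> k = n \<or> i = k) * of_bool (k = m \<and> j = n \<or> k = j) :: real)
          = (\<Sum>k\<in>UNIV. (if k = i then of_bool (i = m \<and> j = n \<or> i = j) else 0)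
              + (if k = n then of_bool (i = m \<and> n = j) else 0))"
          by (intro sum.cong refl) (use mn in auto)
        also have "\<dots> = (if i = m \<and> j = n then 2 else of_bool (i = j))"
          using mn by (auto simp: sum.distrib)
        finally show ?thesis .
      qed
      then show ?thesis by (simp add: matrix_matrix_mult_def vec_eq_iff)
    qed
    moreover have "(\<chi> i j. if i = m \<and> j = n then 2 else of_bool (i = j)) ** d
        = (\<chi> i j. if i = m then 2 * of_bool (j = n \<or> j = m) else of_bool (i = j))"
      using mn by (auto simp: d_def vec_eq_iff diag_mat_mult)
    ultimately have "d ** ?e = ?e ** ?e ** d" by metis
    then have "h d * h ?e = h ?e * h ?e * h d"
      using h(1)[OF d e] h(1)[of "?e ** ?e" d] h(1)[OF e e] d e invertible_matrix_mult[of ?e ?e] by simp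
    then show "h ?e = 1" using h(2)[OF d] h(2)[OF e] by simp
  qed
  have "invertible a \<longrightarrow> f a = g a"
  \<comment> \<open>The induction over products of elementary matrices also passes through singular
    factors, hence the invertibility premise inside the predicate; a zero row contradicts
    it.\<close>
  proof (rule induct_matrix_elementary_alt[where P = "\<lambda>a. invertible a \<longrightarrow> f a = g a"])
    fix A B :: "'n sqmat"
    assume "invertible A \<longrightarrow> f A = g A" "invertible B \<longrightarrow> f B = g B"
    then show "invertible (A ** B) \<longrightarrow> f (A ** B) = g (A ** B)" using f g by (metis invertible_matrix_mult)
  next
    fix A :: "'n sqmat" and i assume "row i A = 0"
    then show "invertible A \<longrightarrow> f A = g A" by (metis det_zero_row(2) invertible_det_nz)
  next
    fix A :: "'n sqmat" assume "\<And>i j. i \<noteq> j \<Longrightarrow> A $ i $ j = 0"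
    then have A: "A = diag_mat (\<lambda>i. A $ i $ i)" by (auto simp: vec_eq_iff)
    show "invertible A \<longrightarrow> f A = g A"
    proof
      assume "invertible A"
      then have "\<forall>i. A $ i $ i \<noteq> 0"
        by (subst (asm) A) (simp add: invertible_det_nz det_diag_mat)
      from diag[OF this] show "f A = g A" using A by simp
    qed
  next
    fix m n :: 'n
    let ?s = "(\<chi> i j. mat 1 $ i $ Transposition.transpose m n j) :: 'n sqmat"
    have "(?s ** ?s) $ i $ j = mat 1 $ i $ j" for i j
    proof -
      have "(?s ** ?s) $ i $ j = (\<Sum>k\<in>UNIV. if k = Transposition.transpose m n j
          then mat 1 $ i $ Transposition.transpose m n k else 0)"
        unfolding matrix_matrix_mult_def vec_lambda_beta by (intro sum.cong) (auto simp: mat_def)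
      then show ?thesis by simp
    qed
    then have "?s ** ?s = mat 1" by (simp add: vec_eq_iff)
    then show "invertible ?s \<longrightarrow> f ?s = g ?s" using one(2)[of f, OF f pos(1)] one(2)[of g, OF g pos(2)] by simp
  next
    fix m n :: 'n assume "m \<noteq> n"
    then show "invertible ((\<chi> i j. of_bool (i = m \<and> j = n \<or> i = j)) :: 'n sqmat) \<longrightarrow>
        f (\<chi> i j. of_bool (i = m \<and> j = n \<or> i = j)) = g (\<chi> i j. of_bool (i = m \<and> j = n \<or> i = j))" using one(3)[of f, OF f pos(1)] one(3)[of g, OF g pos(2)] by simp
  qed
  with assms show ?thesis by blast
qed

section \<open>Uniqueness of translation-invariant measures\<close>

text \<open>The image of \<open>L\<close> under \<open>\<rho> a\<close> is again invariant under
  translations by \<open>W\<close>, hence a multiple \<open>c a\<close> of \<open>L\<close>.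
  Multiplicativity makes \<open>c\<close> a positive character, which \<open>diag\<close> identifies
  with \<open>|det a|^-k\<close>. The set \<open>W\<close> admits measures carried by a proper
  subspace, such as the symmetric matrices; \<open>w\<close> is a test function that normalises
  \<open>c\<close>.\<close>

lemma nn_integral_linear_action:
  fixes L :: "'a::euclidean_space measure" and \<rho> :: "'n::finite sqmat \<Rightarrow> 'a \<Rightarrow> 'a"
  assumes L [measurable_cong]: "sets L = sets borel" and sf: "sigma_finite_measure L"
    and W: "AE x in L. x \<in> W" "\<And>x. x \<in> W \<Longrightarrow> - x \<in> W"
    and transl: "\<And>t f. t \<in> W \<Longrightarrow> f \<in> borel_measurable borel \<Longrightarrow>
      (\<integral>\<^sup>+x. f (x + t) \<partial>L) = (\<integral>\<^sup>+x. f x \<partial>L)"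
    and lin: "\<And>a. linear (\<rho> a)" "\<And>a x. invertible a \<Longrightarrow> x \<in> W \<Longrightarrow> \<rho> a x \<in> W"
    and act: "\<And>a b x. \<rho> (a ** b) x = \<rho> a (\<rho> b x)" "\<And>x. \<rho> (mat 1) x = x"
    and w: "w \<in> borel_measurable borel" "(\<integral>\<^sup>+x. w x \<partial>L) > 0" "(\<integral>\<^sup>+x. w x \<partial>L) < \<infinity>"
    and diag: "\<And>d f. (\<forall>i. d i \<noteq> 0) \<Longrightarrow> f \<in> borel_measurable borel \<Longrightarrow>
      ennreal (\<bar>\<Prod>i\<in>UNIV. d i\<bar> ^ k) * (\<integral>\<^sup>+x. f (\<rho> (diag_mat d) x) \<partial>L) = (\<integral>\<^sup>+x. f x \<partial>L)"
    and a: "invertible a" and f: "f \<in> borel_measurable borel"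
  shows "ennreal (\<bar>det a\<bar> ^ k) * (\<integral>\<^sup>+x. f (\<rho> a x) \<partial>L) = (\<integral>\<^sup>+x. f x \<partial>L)"
proof -
  interpret sigma_finite_measure L by fact
  interpret P: pair_sigma_finite L L ..
  note w(1)[measurable]
  have [measurable]: "\<rho> a \<in> borel_measurable borel" for a
    by (intro borel_measurable_continuous_onI linear_continuous_on linear_conv_bounded_linear[THEN iffD1] lin)
  define I where "I = (\<integral>\<^sup>+x. w x \<partial>L)"
  define c where "c a = (\<integral>\<^sup>+x. w (- \<rho> a x) \<partial>L) / I" for a
  have I: "I \<noteq> 0" "I \<noteq> \<top>" using w unfolding I_def by auto
  have c: "(\<integral>\<^sup>+x. g (\<rho> a x) \<partial>L) = c a * (\<integral>\<^sup>+x. g x \<partial>L)"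
    if a: "invertible a" and [measurable]: "g \<in> borel_measurable borel" for a and g :: "'a \<Rightarrow> ennreal"
  proof -
    have inv: "\<rho> a (\<rho> (matrix_inv a) x) = x" for x
      using invertible_matrix_inv[OF a] act by metis
    have add: "\<rho> a (x + y) = \<rho> a x + \<rho> a y" for x y using lin(1) linear_add by blast
    \<comment> \<open>Three translations separate the variables: \<open>y\<close> by
      \<open>\<rho> (a^-1) x\<close>, then \<open>x\<close> by \<open>- \<rho> a y\<close>, then
      \<open>y\<close> again by \<open>\<rho> (a^-1) x\<close>. What remains is the integral of
      \<open>g\<close> times the integral of \<open>w (- \<rho> a y)\<close>, the numerator of
      \<open>c a\<close>.\<close>
    have "I * (\<integral>\<^sup>+y. g (\<rho> a y) \<partial>L) = (\<integral>\<^sup>+x. \<integral>\<^sup>+y. w x * g (\<rho> a y) \<partial>L \<partial>L)"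
      by (simp add: I_def nn_integral_cmult nn_integral_multc)
    also have "\<dots> = (\<integral>\<^sup>+x. \<integral>\<^sup>+y. w x * g (\<rho> a y + x) \<partial>L \<partial>L)"
    proof (rule nn_integral_cong_AE, use W(1) in eventually_elim)
      fix x assume "x \<in> W"
      then have "\<rho> (matrix_inv a) x \<in> W" using lin(2) invertible_inv[OF a] by blast
      from transl[OF this, of "\<lambda>y. w x * g (\<rho> a y)"]
      show "(\<integral>\<^sup>+y. w x * g (\<rho> a y) \<partial>L) = (\<integral>\<^sup>+y. w x * g (\<rho> a y + x) \<partial>L)"
        by (simp add: add inv)
    qed
    also have "\<dots> = (\<integral>\<^sup>+y. \<integral>\<^sup>+x. w x * g (\<rho> a y + x) \<partial>L \<partial>L)"
      by (rule P.Fubini'[symmetric]) measurable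
    also have "\<dots> = (\<integral>\<^sup>+y. \<integral>\<^sup>+x. w (x - \<rho> a y) * g x \<partial>L \<partial>L)"
    proof (rule nn_integral_cong_AE, use W(1) in eventually_elim)
      fix y assume "y \<in> W"
      then have "- \<rho> a y \<in> W" using W(2) lin(2)[OF a] by blast
      from transl[OF this, of "\<lambda>x. w x * g (\<rho> a y + x)"]
      show "(\<integral>\<^sup>+x. w x * g (\<rho> a y + x) \<partial>L) = (\<integral>\<^sup>+x. w (x - \<rho> a y) * g x \<partial>L)"
        by simp
    qed
    also have "\<dots> = (\<integral>\<^sup>+x. \<integral>\<^sup>+y. w (x - \<rho> a y) * g x \<partial>L \<partial>L)"
      by (rule P.Fubini') measurable
    also have "\<dots> = (\<integral>\<^sup>+x. \<integral>\<^sup>+y. w (- \<rho> a y) * g x \<partial>L \<partial>L)"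
    proof (rule nn_integral_cong_AE, use W(1) in eventually_elim)
      fix x assume "x \<in> W"
      then have "\<rho> (matrix_inv a) x \<in> W" using lin(2) invertible_inv[OF a] by blast
      from transl[OF this, of "\<lambda>y. w (x - \<rho> a y) * g x"]
      show "(\<integral>\<^sup>+y. w (x - \<rho> a y) * g x \<partial>L) = (\<integral>\<^sup>+y. w (- \<rho> a y) * g x \<partial>L)"
        by (simp add: add inv)
    qed
    also have "\<dots> = (\<integral>\<^sup>+y. w (- \<rho> a y) \<partial>L) * (\<integral>\<^sup>+x. g x \<partial>L)"
      by (simp add: nn_integral_cmult nn_integral_multc)
    finally have "I * (\<integral>\<^sup>+y. g (\<rho> a y) \<partial>L) = (\<integral>\<^sup>+y. w (- \<rho> a y) \<partial>L) * (\<integral>\<^sup>+x. g x \<partial>L)" .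
    moreover have "I * (\<integral>\<^sup>+y. g (\<rho> a y) \<partial>L) / I = (\<integral>\<^sup>+y. g (\<rho> a y) \<partial>L)"
      using I by (subst mult.commute) (simp add: mult_divide_eq_ennreal)
    ultimately show ?thesis unfolding c_def by (metis ennreal_times_divide mult.commute)
  qed
  have cancel: "x = y" if "x * I = y * I" for x y :: ennreal
    using arg_cong[OF that, of "\<lambda>z. z / I"] I by (simp add: mult_divide_eq_ennreal)
  have c_mult: "c (a ** b) = c a * c b" if "invertible a" "invertible b" for a b
  proof (rule cancel)
    have "c (a ** b) * I = (\<integral>\<^sup>+x. w (\<rho> (a ** b) x) \<partial>L)"
      using c[of "a ** b" w] that by (simp add: I_def invertible_matrix_mult)
    also have "\<dots> = c b * (\<integral>\<^sup>+x. w (\<rho> a x) \<partial>L)"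
      unfolding act by (rule c[OF that(2), of "\<lambda>x. w (\<rho> a x)"]) measurable
    also have "\<dots> = c a * c b * I" using c[OF that(1) w(1)] by (simp add: I_def mult.left_commute mult.assoc)
    finally show "c (a ** b) * I = c a * c b * I" .
  qed
  have c_one: "c (mat 1) = 1"
  proof (rule cancel)
    have "(\<integral>\<^sup>+x. w (\<rho> (mat 1) x) \<partial>L) = c (mat 1) * (\<integral>\<^sup>+x. w x \<partial>L)"
      by (rule c[OF _ w(1)]) (simp add: invertible_det_nz)
    then show "c (mat 1) * I = 1 * I" unfolding act I_def[symmetric] by simp
  qed
  \<comment> \<open>In the extended nonnegative reals \<open>c a * c (a^-1) = 1\<close> excludes
    both 0 and infinity.\<close>
  have c_fin: "c a \<noteq> 0" "c a \<noteq> \<top>" if "invertible a" for a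
  proof -
    have "c a * c (matrix_inv a) = 1" "c (matrix_inv a) * c a = 1"
      using c_mult[OF that invertible_inv[OF that]] c_mult[OF invertible_inv[OF that] that]
        invertible_matrix_inv[OF that] c_one by simp_all
    then show "c a \<noteq> 0" "c a \<noteq> \<top>" by (auto simp: ennreal_top_mult split: if_splits)
  qed
  have "enn2real (c a) = inverse (\<bar>det a\<bar> ^ k)"
  proof (rule matrix_character_eqI[OF _ _ _ _ _ a])
    show "enn2real (c (a ** b)) = enn2real (c a) * enn2real (c b)" if "invertible a" "invertible b" for a b
      using c_mult[OF that] by (simp add: enn2real_mult)
    show "0 < enn2real (c a)" if "invertible a" for a
      using c_fin[OF that] by (simp add: enn2real_positive_iff less_top zero_less_iff_neq_zero)
    show "inverse (\<bar>det (a ** b)\<bar> ^ k) = inverse (\<bar>det a\<bar> ^ k) * inverse (\<bar>det b\<bar> ^ k)" for a b :: "'n sqmat"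
      by (simp add: det_mul abs_mult power_mult_distrib)
    show "inverse (\<bar>det a\<bar> ^ k) > 0" if "invertible a" for a :: "'n sqmat"
      using that by (simp add: invertible_det_nz)
    fix d :: "'n \<Rightarrow> real" assume d: "\<forall>i. d i \<noteq> 0"
    then have inv: "invertible (diag_mat d)" by (simp add: invertible_det_nz det_diag_mat)
    let ?p = "\<bar>\<Prod>i\<in>UNIV. d i\<bar> ^ k"
    have "ennreal ?p * c (diag_mat d) * I = 1 * I"
      using diag[OF d w(1)] c[OF inv w(1)] by (simp add: I_def mult.assoc)
    then have "ennreal ?p * c (diag_mat d) = 1" by (rule cancel)
    then have "enn2real (ennreal ?p * c (diag_mat d)) = enn2real 1" by (rule arg_cong)
    then have "?p * enn2real (c (diag_mat d)) = 1" by (simp add: enn2real_mult)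
    then show "enn2real (c (diag_mat d)) = inverse (\<bar>det (diag_mat d)\<bar> ^ k)"
      unfolding det_diag_mat by (simp add: inverse_unique)
  qed
  then have "c a = ennreal (inverse (\<bar>det a\<bar> ^ k))"
    using ennreal_enn2real[of "c a"] c_fin[OF a] by (simp add: less_top)
  then have "ennreal (\<bar>det a\<bar> ^ k) * c a = 1"
    using a by (simp add: ennreal_mult[symmetric] invertible_det_nz)
  then show ?thesis by (simp add: c[OF a f] mult.assoc[symmetric])
qed

text \<open>It suffices to compare boxes, where both sides factorise into one-dimensional affine
  substitutions. With \<open>s = 1\<close> it yields translations, with \<open>t = 0\<close>
  diagonal congruences of symmetric matrices.\<close>

lemma nn_integral_PiM_affine:
  fixes s t :: "'i \<Rightarrow> real"
  assumes "finite I" and s: "\<And>i. i \<in> I \<Longrightarrow> s i \<noteq> 0"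
    and f: "f \<in> borel_measurable (PiM I (\<lambda>_. lborel))"
  shows "ennreal (\<Prod>i\<in>I. \<bar>s i\<bar>) * (\<integral>\<^sup>+c. f (\<lambda>i\<in>I. t i + s i * c i) \<partial>PiM I (\<lambda>_. lborel))
    = (\<integral>\<^sup>+c. f c \<partial>PiM I (\<lambda>_. lborel))"
proof -
  let ?M = "PiM I (\<lambda>_. lborel :: real measure)"
  interpret product_sigma_finite "\<lambda>_ :: 'i. lborel :: real measure" ..
  define T where "T c = (\<lambda>i\<in>I. t i + s i * c i)" for c
  have T [measurable]: "T \<in> measurable ?M ?M"
    unfolding T_def by measurable
  have "density (distr ?M ?M T) (\<lambda>_. ennreal (\<Prod>i\<in>I. \<bar>s i\<bar>)) = ?M"
  proof (rule PiM_eqI)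
    fix A assume A: "\<And>i. i \<in> I \<Longrightarrow> A i \<in> sets (lborel :: real measure)"
    have box: "Pi\<^sub>E I A \<in> sets ?M" using A assms(1) by (intro sets_PiM_I_finite) auto
    have pre: "(\<lambda>x. t i + s i * x) -` A i \<in> sets lborel" if "i \<in> I" for i
      using measurable_sets[of "\<lambda>x. t i + s i * x" lborel lborel "A i"] A[OF that] by simp
    have vim: "T -` Pi\<^sub>E I A \<inter> space ?M = Pi\<^sub>E I (\<lambda>i. (\<lambda>x. t i + s i * x) -` A i)"
      by (auto simp: T_def space_PiM PiE_iff)
    have coord: "ennreal \<bar>s i\<bar> * emeasure lborel ((\<lambda>x. t i + s i * x) -` A i) = emeasure lborel (A i)"
      if "i \<in> I" for i
    proof -
      have "emeasure lborel (A i) =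
          emeasure (density (distr lborel borel (\<lambda>x. t i + s i * x)) (\<lambda>_. ennreal \<bar>s i\<bar>)) (A i)"
        using lborel_real_affine[OF s[OF that], of "t i"] by simp
      also have "\<dots> = ennreal \<bar>s i\<bar> * emeasure (distr lborel borel (\<lambda>x. t i + s i * x)) (A i)"
        using A[OF that] by (subst emeasure_density_const) auto
      also have "\<dots> = ennreal \<bar>s i\<bar> * emeasure lborel ((\<lambda>x. t i + s i * x) -` A i)"
        using A[OF that] by (subst emeasure_distr) auto
      finally show ?thesis ..
    qed
    have "emeasure (density (distr ?M ?M T) (\<lambda>_. ennreal (\<Prod>i\<in>I. \<bar>s i\<bar>))) (Pi\<^sub>E I A)
        = ennreal (\<Prod>i\<in>I. \<bar>s i\<bar>) * emeasure ?M (T -` Pi\<^sub>E I A \<inter> space ?M)"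
      using box by (subst emeasure_density_const) (auto simp: emeasure_distr)
    also have "\<dots> = (\<Prod>i\<in>I. ennreal \<bar>s i\<bar>) * (\<Prod>i\<in>I. emeasure lborel ((\<lambda>x. t i + s i * x) -` A i))"
      unfolding vim using assms(1) pre by (subst emeasure_PiM) (auto simp: prod_ennreal)
    also have "\<dots> = (\<Prod>i\<in>I. emeasure lborel (A i))"
      unfolding prod.distrib[symmetric] by (intro prod.cong refl coord)
    finally show "emeasure (density (distr ?M ?M T) (\<lambda>_. ennreal (\<Prod>i\<in>I. \<bar>s i\<bar>))) (Pi\<^sub>E I A)
      = (\<Prod>i\<in>I. emeasure lborel (A i))" .
  qed (use assms(1) in simp_all)
  then have "(\<integral>\<^sup>+c. f c \<partial>?M) = (\<integral>\<^sup>+c. f c \<partial>density (distr ?M ?M T) (\<lambda>_. ennreal (\<Prod>i\<in>I. \<bar>s i\<bar>)))"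
    by simp
  also have "\<dots> = ennreal (\<Prod>i\<in>I. \<bar>s i\<bar>) * (\<integral>\<^sup>+c. f (T c) \<partial>?M)"
    using f by (subst nn_integral_density) (auto simp: nn_integral_cmult nn_integral_distr)
  finally show ?thesis unfolding T_def by simp
qed

lemma borel_measurable_matrix_iff:
  fixes f :: "'a \<Rightarrow> 'n::finite sqmat"
  shows "f \<in> borel_measurable M \<longleftrightarrow> (\<forall>i j. (\<lambda>x. f x $ i $ j) \<in> borel_measurable M)"
proof
  assume [measurable]: "f \<in> borel_measurable M"
  show "\<forall>i j. (\<lambda>x. f x $ i $ j) \<in> borel_measurable M"
  proof safe
    fix i j
    have "(\<lambda>a :: 'n sqmat. a $ i $ j) \<in> borel_measurable borel"
      by (intro borel_measurable_continuous_onI continuous_intros)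
    then show "(\<lambda>x. f x $ i $ j) \<in> borel_measurable M" by measurable
  qed
next
  assume "\<forall>i j. (\<lambda>x. f x $ i $ j) \<in> borel_measurable M"
  then show "f \<in> borel_measurable M"
    by (subst borel_measurable_euclidean_space) (auto simp: Basis_vec_def inner_axis)
qed

text \<open>Right multiplication by a diagonal matrix scales the entry \<open>(i, j)\<close> by
  \<open>d j\<close>, so each \<open>d j\<close> enters the Jacobian once per row.\<close>

lemma nn_integral_matrix_diag:
  fixes d :: "'n::finite \<Rightarrow> real" and f :: "'n sqmat \<Rightarrow> ennreal"
  assumes d: "\<forall>i. d i \<noteq> 0" and [measurable]: "f \<in> borel_measurable borel"
  shows "ennreal (\<bar>\<Prod>i\<in>UNIV. d i\<bar> ^ CARD('n)) * (\<integral>\<^sup>+x. f (x ** transpose (diag_mat d)) \<partial>lborel)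
    = (\<integral>\<^sup>+x. f x \<partial>lborel)"
proof -
  let ?D = "transpose (diag_mat d)"
  define c where "c b = b \<bullet> (b ** ?D)" for b :: "'n sqmat"
  have tD: "?D = diag_mat d" by (auto simp: transpose_def vec_eq_iff)
  have inner: "x \<bullet> axis i (axis j 1) = x $ i $ j" for x :: "'n sqmat" and i j
    by (simp add: inner_axis)
  have c: "c (axis i (axis j 1)) = d j" for i j
    unfolding c_def inner_commute[of "axis i (axis j 1)"] inner tD diag_mat_mult by (simp add: axis_def)
  have Basis: "Basis = (\<lambda>(i, j). axis i (axis j 1) :: 'n sqmat) ` UNIV"
    by (auto simp: Basis_vec_def)
  have inj: "inj (\<lambda>(i, j). axis i (axis j 1) :: 'n sqmat)"
    by (auto simp: inj_def axis_eq_axis)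
  have T: "x ** ?D = 0 + (\<Sum>b\<in>Basis. (c b * (x \<bullet> b)) *\<^sub>R b)" for x
  proof (rule euclidean_eqI)
    fix b :: "'n sqmat" assume b: "b \<in> Basis"
    then obtain i j where "b = axis i (axis j 1)" by (auto simp: Basis)
    then show "(x ** ?D) \<bullet> b = (0 + (\<Sum>b\<in>Basis. (c b * (x \<bullet> b)) *\<^sub>R b)) \<bullet> b"
      using b unfolding add_0 inner_sum_left_Basis[OF b] by (simp only: c inner tD diag_mat_mult mult.commute)
  qed
  have "(\<Prod>b\<in>Basis. \<bar>c b\<bar>) = (\<Prod>p\<in>UNIV. case p of (i :: 'n, j) \<Rightarrow> \<bar>d j\<bar>)"
    unfolding Basis by (subst prod.reindex[OF inj]) (auto simp: c intro!: prod.cong)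
  also have "\<dots> = (\<Prod>i\<in>(UNIV::'n set). \<Prod>j\<in>UNIV. \<bar>d j\<bar>)"
    by (subst prod.cartesian_product) (simp add: case_prod_unfold)
  also have "\<dots> = \<bar>\<Prod>i\<in>UNIV. d i\<bar> ^ CARD('n)" by (simp add: abs_prod)
  finally have prod: "(\<Prod>b\<in>Basis. \<bar>c b\<bar>) = \<bar>\<Prod>i\<in>UNIV. d i\<bar> ^ CARD('n)" .
  have [measurable]: "(\<lambda>x :: 'n sqmat. x ** ?D) \<in> borel_measurable borel"
    by (intro borel_measurable_continuous_onI continuous_intros)
  have "lborel = density (distr lborel borel (\<lambda>x :: 'n sqmat. x ** ?D)) (\<lambda>_. (\<Prod>b\<in>Basis. \<bar>c b\<bar>))"
    unfolding T using d by (rule_tac lborel_affine_euclidean) (auto simp: Basis c)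
  then have "(\<integral>\<^sup>+x. f x \<partial>lborel) =
      (\<integral>\<^sup>+x. f x \<partial>density (distr lborel borel (\<lambda>x :: 'n sqmat. x ** ?D)) (\<lambda>_. (\<Prod>b\<in>Basis. \<bar>c b\<bar>)))"
    by simp
  also have "\<dots> = ennreal (\<Prod>b\<in>Basis. \<bar>c b\<bar>) * (\<integral>\<^sup>+x. f (x ** ?D) \<partial>lborel)"
    by (subst nn_integral_density) (auto simp: nn_integral_cmult nn_integral_distr)
  finally show ?thesis unfolding prod by simp
qed

lemma matrix_mult_scaleR:
  fixes a b c :: "'n::finite sqmat"
  shows "(r *\<^sub>R a) ** b = r *\<^sub>R (a ** b)" "a ** (r *\<^sub>R b) = r *\<^sub>R (a ** b)"
  by (simp_all add: matrix_matrix_mult_def vec_eq_iff sum_distrib_left mult_ac)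

text \<open>The transpose makes right multiplication a left action, as
  \<open>nn_integral_linear_action\<close> requires. The rows of \<open>x\<close> transform
  separately, so the exponent is the number \<open>n\<close> of rows; thus
  \<open>|det a|^-n da\<close> is invariant under right multiplication.\<close>

lemma nn_integral_matrix_mult_right:
  fixes a :: "'n::finite sqmat" and f :: "'n sqmat \<Rightarrow> ennreal"
  assumes "invertible a" and "f \<in> borel_measurable borel"
  shows "ennreal (\<bar>det a\<bar> ^ CARD('n)) * (\<integral>\<^sup>+x. f (x ** transpose a) \<partial>lborel) = (\<integral>\<^sup>+x. f x \<partial>lborel)"
proof (rule nn_integral_linear_action[where W = UNIV and w = "indicator (cball 0 1)"
      and \<rho> = "\<lambda>a x. x ** transpose a" and f = f and a = a and k = "CARD('n)"])
  fix d :: "'n \<Rightarrow> real" and g :: "'n sqmat \<Rightarrow> ennreal"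
  assume "\<forall>i. d i \<noteq> 0" "g \<in> borel_measurable borel"
  then show gg: "ennreal (\<bar>\<Prod>i\<in>UNIV. d i\<bar> ^ CARD('n)) * (\<integral>\<^sup>+x. g (x ** transpose (diag_mat d)) \<partial>lborel)
    = (\<integral>\<^sup>+x. g x \<partial>lborel)"
    by (rule nn_integral_matrix_diag)
next
  show "sigma_finite_measure lborel" by (rule sigma_finite_lborel)
  fix t :: "'n sqmat" and f :: "'n sqmat \<Rightarrow> ennreal"
  assume "f \<in> borel_measurable borel"
  then show "(\<integral>\<^sup>+x. f (x + t) \<partial>lborel) = (\<integral>\<^sup>+x. f x \<partial>lborel)"
    by (subst (2) lborel_distr_plus[of t, symmetric]) (simp add: nn_integral_distr add.commute)
next
  show "linear (\<lambda>x :: 'n sqmat. x ** transpose a)" for a :: "'n sqmat"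
    by (rule linearI) (simp_all add: matrix_add_rdistrib matrix_mult_scaleR)
  show "x ** transpose (a ** b) = x ** transpose b ** transpose a" for a b x :: "'n sqmat"
    by (simp add: matrix_transpose_mul matrix_mul_assoc)
  show "0 < integral\<^sup>N lborel (indicator (cball (0 :: 'n sqmat) 1))"
    using content_cball_pos[of 1 "0 :: 'n sqmat"] emeasure_lborel_cball_finite[of "0 :: 'n sqmat" 1]
    by (simp add: measure_def enn2real_positive_iff)
  show "integral\<^sup>N lborel (indicator (cball (0 :: 'n sqmat) 1)) < \<infinity>"
    using emeasure_lborel_cball_finite[of "0 :: 'n sqmat" 1] by simp
  show "(indicator (cball 0 1) :: 'n sqmat \<Rightarrow> ennreal) \<in> borel_measurable borel"
    by (intro borel_measurable_indicator) simp
qed (use assms in \<open>simp_all add: transpose_mat\<close>)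

section \<open>Monotonicity of the determinant\<close>

text \<open>A volume comparison: if \<open>a\<close> does not shrink vectors, then
  \<open>x |-> x a^T\<close> does not shrink matrices. The preimage of the unit ball lies in the
  unit ball, which forces \<open>|det a|^n\<close> to be at least 1.\<close>

lemma det_ge_1_of_norm_le:
  fixes a :: "'n::finite sqmat"
  assumes "invertible a" and le: "\<And>v. norm v \<le> norm (a *v v)"
  shows "\<bar>det a\<bar> \<ge> 1"
proof -
  have norm: "norm x \<le> norm (x ** transpose a)" for x :: "'n sqmat"
  proof -
    have "(x ** transpose a) $ i = a *v (x $ i)" for i
      by (simp add: matrix_matrix_mult_def matrix_vector_mult_def transpose_def vec_eq_iff mult.commute)
    then show ?thesis unfolding norm_vec_def[of x] norm_vec_def[of "x ** transpose a"]
      using le by (intro L2_set_mono) auto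
  qed
  let ?B = "cball (0 :: 'n sqmat) 1"
  have fin: "emeasure lborel ?B \<noteq> 0" "emeasure lborel ?B \<noteq> \<top>"
    using content_cball_pos[of 1 "0 :: 'n sqmat"] emeasure_lborel_cball_finite[of "0 :: 'n sqmat" 1]
    by (auto simp: measure_def)
  have "1 * emeasure lborel ?B = (\<integral>\<^sup>+x. indicator ?B x \<partial>lborel)" by simp
  also have "\<dots> = ennreal (\<bar>det a\<bar> ^ CARD('n)) * (\<integral>\<^sup>+x. indicator ?B (x ** transpose a) \<partial>lborel)"
    by (rule nn_integral_matrix_mult_right[OF assms(1), symmetric]) (intro borel_measurable_indicator, simp)
  also have "(\<integral>\<^sup>+x. indicator ?B (x ** transpose a) \<partial>lborel) \<le> (\<integral>\<^sup>+x. indicator ?B x \<partial>lborel)"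
    by (intro nn_integral_mono) (auto simp: indicator_def intro: order_trans[OF norm])
  finally have "1 * emeasure lborel ?B \<le> ennreal (\<bar>det a\<bar> ^ CARD('n)) * emeasure lborel ?B"
    by (simp add: mult_left_mono)
  then have "1 \<le> ennreal (\<bar>det a\<bar> ^ CARD('n))"
    unfolding mult.commute[of _ "emeasure lborel ?B"] ennreal_mult_le_mult_iff[OF fin] .
  then have "1 \<le> \<bar>det a\<bar> ^ CARD('n)" by simp
  then show ?thesis
    by (metis abs_ge_zero not_le power_less_one_iff zero_less_card_finite)
qed

text \<open>Cauchy-Schwarz gives
  \<open>|v|^2 \<le> v \<bullet> (1 + x) v \<le> |v| |(1 + x) v|\<close>, so \<open>1 + x\<close>
  does not shrink vectors.\<close>

lemma det_id_add_ge_1: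
  fixes x :: "'n::finite sqmat"
  assumes "x \<in> posdef_mats"
  shows "det (mat 1 + x) \<ge> 1"
proof -
  let ?a = "mat 1 + x"
  have pd: "?a \<in> posdef_mats" using assms posdef_add posdef_id by blast
  have "norm v \<le> norm (?a *v v)" for v
  proof -
    have "norm v * norm v \<le> v \<bullet> (?a *v v)"
      using posdef_nonneg[OF assms, of v]
      by (simp add: matrix_vector_mult_add_rdistrib inner_add_right norm_eq_sqrt_inner)
    also have "\<dots> \<le> norm v * norm (?a *v v)" by (rule norm_cauchy_schwarz)
    finally show ?thesis by (cases "v = 0") auto
  qed
  with det_ge_1_of_norm_le[OF posdef_invertible[OF pd]] show ?thesis
    using posdef_det_pos[OF pd] by simp
qed

text \<open>Congruence by the square root of \<open>x\<close> reduces the claim to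
  \<open>1 + z\<close> with \<open>z\<close> positive definite. For \<open>\<alpha> \<ge> 0\<close>
  it later bounds \<open>det (z + s) powr - \<alpha>\<close> uniformly in \<open>z\<close>, which
  makes \<open>phi\<close> finite.\<close>

lemma posdef_det_mono:
  fixes x y :: "'n::finite sqmat"
  assumes "x \<in> posdef_mats" "y \<in> posdef_mats"
  shows "det x \<le> det (x + y)"
proof -
  let ?r = "mat_sqrt x"
  note r = mat_sqrt[OF assms(1)]
  have inv: "invertible ?r" and t: "transpose ?r = ?r" using r posdef_invertible posdef_matsD by blast+
  let ?z = "matrix_inv ?r ** y ** transpose (matrix_inv ?r)"
  have "x + y = ?r ** (mat 1 + ?z) ** ?r"
    using inv r(2) by (simp add: matrix_add_ldistrib matrix_add_rdistrib matrix_mul_assoc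
        matrix_mult_inv_cancel invertible_matrix_inv matrix_inv_transpose[symmetric] t)
  moreover have "det x = det ?r * det ?r" using r(2) by (metis det_mul)
  ultimately have "det (x + y) = det x * det (mat 1 + ?z)" by (simp add: det_mul)
  moreover have "det (mat 1 + ?z) \<ge> 1"
    by (intro det_id_add_ge_1 posdef_congruence assms invertible_inv inv)
  ultimately show ?thesis using posdef_det_pos[OF assms(1)] by simp
qed

section \<open>Lebesgue measure on symmetric matrices\<close>

lemma borel_measurable_det [measurable]: "det \<in> borel_measurable (borel :: 'n::finite sqmat measure)"
  by (intro borel_measurable_continuous_onI continuous_on_det)

lemma borel_measurable_trace [measurable]:
  "trace \<in> borel_measurable (borel :: 'n::finite sqmat measure)"
  by (intro borel_measurable_continuous_onI continuous_intros)

lemma borel_measurable_transpose [measurable]: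
  "transpose \<in> borel_measurable (borel :: 'n::finite sqmat measure)"
  by (intro borel_measurable_continuous_onI continuous_intros)

lemma borel_measurable_matrix_mult [measurable (raw)]:
  fixes f g :: "'a \<Rightarrow> 'n::finite sqmat"
  assumes "f \<in> borel_measurable M" "g \<in> borel_measurable M"
  shows "(\<lambda>x. f x ** g x) \<in> borel_measurable M"
  using assms unfolding borel_measurable_matrix_iff matrix_matrix_mult_def by (auto intro!: borel_measurable_sum borel_measurable_times)

text \<open>Cramer's rule expresses the inverse of a nonsingular matrix through determinants. On
  singular matrices the choice in \<open>matrix_inv\<close> is made from an unsatisfiable predicate,
  so it returns one and the same matrix \<open>k\<close>.\<close>

lemma borel_measurable_matrix_inv [measurable]:
  "matrix_inv \<in> borel_measurable (borel :: 'n::finite sqmat measure)"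
proof -
  define k :: "'n sqmat" where "k = (SOME x. False)"
  define c where "c a = (\<chi> i j. det (\<chi> p q. if q = i then axis j 1 $ p else a $ p $ q) / det a)" for a :: "'n sqmat"
  have eq: "matrix_inv a = (if det a = 0 then k else c a)" for a
  proof (cases "det a = 0")
    case True
    then have "\<not> invertible a" by (simp add: invertible_det_nz)
    then have "(\<lambda>b. a ** b = mat 1 \<and> b ** a = mat 1) = (\<lambda>b. False)" unfolding invertible_def by blast
    then show ?thesis using True unfolding matrix_inv_def k_def by simp
  next
    case False
    have "a *v (\<chi> i. det (\<chi> p q. if q = i then axis j 1 $ p else a $ p $ q) / det a) = axis j 1" for j
      using cramer[OF False] by blast
    then have "(a ** c a) $ i $ j = axis j 1 $ i" for i j
      by (simp add: c_def matrix_matrix_mult_def matrix_vector_mult_def vec_eq_iff)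
    then have "a ** c a = mat 1" by (simp add: vec_eq_iff mat_def axis_def)
    then show ?thesis using False matrix_inv_eqI by auto
  qed
  have M: "(\<lambda>a :: 'n sqmat. (\<chi> p q. if q = i then axis j 1 $ p else a $ p $ q) :: 'n sqmat) \<in> borel_measurable borel"
    for i j
    unfolding borel_measurable_matrix_iff
  proof (intro allI)
    fix p q
    have "(\<lambda>x :: 'n sqmat. x $ p $ q) \<in> borel_measurable borel"
      using borel_measurable_matrix_iff[of "\<lambda>x :: 'n sqmat. x" borel] by simp
    then show "(\<lambda>x :: 'n sqmat. (\<chi> p q. if q = i then axis j 1 $ p else x $ p $ q) $ p $ q) \<in> borel_measurable borel"
      by (cases "q = i") simp_all
  qed
  have "c \<in> borel_measurable borel"
    by (subst borel_measurable_matrix_iff)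
      (auto simp: c_def intro!: borel_measurable_divide measurable_compose[OF M borel_measurable_det])
  then show ?thesis unfolding eq[abs_def] by measurable
qed

lemma posdef_borel_set [measurable]: "posdef_mats \<in> sets (borel :: 'n::finite sqmat measure)"
proof -
  obtain T where "open T" "(posdef_mats :: 'n sqmat set) = sym_mats \<inter> T"
    using openin_posdef unfolding openin_open by blast
  then show ?thesis using closed_sym_mats by (metis borel_closed borel_open sets.Int)
qed

text \<open>Outside the cone the description in \<open>mat_sqrt\<close> has no solution and denotes
  the constant \<open>k\<close>; on the cone the function is continuous.\<close>

lemma borel_measurable_mat_sqrt [measurable]:
  "mat_sqrt \<in> borel_measurable (borel :: 'n::finite sqmat measure)"
proof -
  define k :: "'n sqmat" where "k = (THE x. False)"
  have "mat_sqrt x = k" if "x \<notin> posdef_mats" for x :: "'n sqmat"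
  proof -
    have "(\<lambda>b. b \<in> posdef_mats \<and> b ** b = x) = (\<lambda>b. False)" using that posdef_square by blast
    then show ?thesis unfolding mat_sqrt_def k_def by simp
  qed
  then have eq: "mat_sqrt = (\<lambda>x. if x \<in> posdef_mats then mat_sqrt x else k)" by auto
  show ?thesis
    by (subst eq, intro borel_measurable_continuous_on_if continuous_on_mat_sqrt posdef_borel_set) auto
qed

section \<open>Translations and congruences in the coordinates on and above the diagonal\<close>

lemma sets_sym_lebesgue [measurable_cong, simp]: "sets sym_lebesgue = sets borel"
  by (simp add: sym_lebesgue_def)

lemma borel_measurable_sym_of_upper [measurable]:
  "sym_of_upper \<in> borel_measurable (PiM {(i, j). i \<le> j} (\<lambda>_. lborel :: real measure))"
  unfolding borel_measurable_matrix_iff sym_of_upper_def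
  by (auto intro!: measurable_component_singleton[where M = "\<lambda>_. lborel", simplified] simp: min_le_iff_disj le_max_iff_disj)

lemma finite_upper: "finite {(i, j). i \<le> (j :: 'n::{finite,linorder})}"
  by (rule finite_subset[of _ UNIV]) auto

lemma nn_integral_sym_lebesgue:
  assumes "f \<in> borel_measurable borel"
  shows "(\<integral>\<^sup>+x. f x \<partial>sym_lebesgue) = (\<integral>\<^sup>+c. f (sym_of_upper c) \<partial>PiM {(i, j). i \<le> j} (\<lambda>_. lborel))"
  unfolding sym_lebesgue_def using assms by (subst nn_integral_distr) auto

lemma sym_of_upper_sym: "sym_of_upper c \<in> sym_mats"
  by (simp add: sym_mats_def sym_of_upper_def transpose_def vec_eq_iff min.commute max.commute)

lemma AE_sym_lebesgue: "AE x in sym_lebesgue. x \<in> sym_mats"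
  unfolding sym_lebesgue_def using borel_closed[OF closed_sym_mats] by (subst AE_distr_iff) (auto simp: sym_of_upper_sym)

lemma sym_mats_nth: "x \<in> sym_mats \<Longrightarrow> x $ min i j $ max i j = x $ i $ (j :: 'n::{finite,linorder})"
  by (auto simp: sym_mats_def transpose_def vec_eq_iff min_def max_def)

text \<open>Cubes of finite measure exhaust the space, which gives sigma-finiteness; the one with
  \<open>r = 1\<close> has positive measure and serves as the test function for the congruence
  action.\<close>

lemma sym_lebesgue_box:
  assumes "r \<ge> 0"
  shows "emeasure sym_lebesgue {x :: 'n::{finite,linorder} sqmat. \<forall>i j. \<bar>x $ i $ j\<bar> \<le> r}
    = ennreal ((2 * r) ^ card {(i, j :: 'n). i \<le> j})"
proof -
  interpret product_sigma_finite "\<lambda>_ :: 'n \<times> 'n. lborel :: real measure" ..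
  let ?I = "{(i, j). i \<le> (j :: 'n)}"
  let ?B = "{x :: 'n sqmat. \<forall>i j. \<bar>x $ i $ j\<bar> \<le> r}"
  have "closed ?B"
    by (intro closed_Collect_all closed_Collect_le continuous_intros)
  moreover have "sym_of_upper -` ?B \<inter> space (PiM ?I (\<lambda>_. lborel)) = Pi\<^sub>E ?I (\<lambda>_. {-r..r})"
  proof (intro set_eqI iffI)
    fix c assume "c \<in> sym_of_upper -` ?B \<inter> space (PiM ?I (\<lambda>_. lborel))"
    then have c: "c \<in> space (PiM ?I (\<lambda>_. lborel))" "\<And>i j. \<bar>sym_of_upper c $ i $ j\<bar> \<le> r" by auto
    have "- r \<le> c (i, j) \<and> c (i, j) \<le> r" if "i \<le> j" for i j
      using c(2)[of i j] that by (auto simp: sym_of_upper_def min_def max_def split: if_splits)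
    with c(1) show "c \<in> Pi\<^sub>E ?I (\<lambda>_. {-r..r})" by (auto simp: space_PiM PiE_iff)
  next
    fix c assume c: "c \<in> Pi\<^sub>E ?I (\<lambda>_. {-r..r})"
    have "c (min i j, max i j) \<in> {-r..r}" for i j
      using c by (auto simp: PiE_iff min_le_iff_disj le_max_iff_disj)
    then have "\<bar>sym_of_upper c $ i $ j\<bar> \<le> r" for i j
      by (simp add: sym_of_upper_def abs_le_iff) (metis atLeastAtMost_iff minus_le_iff)
    with c show "c \<in> sym_of_upper -` ?B \<inter> space (PiM ?I (\<lambda>_. lborel))"
      by (auto simp: space_PiM PiE_iff)
  qed
  moreover have "?B \<in> sets borel" using calculation(1) by (rule borel_closed)
  ultimately have "emeasure sym_lebesgue ?B = emeasure (PiM ?I (\<lambda>_. lborel)) (Pi\<^sub>E ?I (\<lambda>_. {-r..r}))"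
    unfolding sym_lebesgue_def by (subst emeasure_distr) auto
  also have "\<dots> = ennreal ((2 * r) ^ card ?I)"
    using assms by (subst emeasure_PiM[OF finite_upper]) (auto simp: ennreal_power)
  finally show ?thesis .
qed

lemma sigma_finite_sym_lebesgue: "sigma_finite_measure (sym_lebesgue :: 'n::{finite,linorder} sqmat measure)"
proof
  let ?A = "range (\<lambda>n. {x :: 'n sqmat. \<forall>i j. \<bar>x $ i $ j\<bar> \<le> real n})"
  have "?A \<subseteq> sets sym_lebesgue"
    by (auto intro!: borel_closed closed_Collect_all closed_Collect_le continuous_intros)
  moreover have "\<Union>?A = space sym_lebesgue"
  proof -
    have "\<exists>n. \<forall>i j. \<bar>x $ i $ j\<bar> \<le> real n" for x :: "'n sqmat"
    proof -
      obtain n where "norm x \<le> real n" using real_arch_simple by blast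
      moreover have "\<bar>x $ i $ j\<bar> \<le> norm x" for i j
        using component_le_norm_cart[of "x $ i" j] Finite_Cartesian_Product.norm_nth_le[of x i] by linarith
      ultimately show ?thesis by (meson order_trans)
    qed
    then show ?thesis by (auto simp: sym_lebesgue_def)
  qed
  ultimately show "\<exists>A. countable A \<and> A \<subseteq> sets sym_lebesgue \<and> \<Union>A = space (sym_lebesgue :: 'n sqmat measure) \<and>
      (\<forall>a\<in>A. emeasure sym_lebesgue a \<noteq> \<infinity>)"
    by (intro exI[of _ ?A]) (auto simp: sym_lebesgue_box)
qed

lemma nn_integral_sym_lebesgue_transl:
  fixes t :: "'n::{finite,linorder} sqmat"
  assumes t: "t \<in> sym_mats" and f [measurable]: "f \<in> borel_measurable borel"
  shows "(\<integral>\<^sup>+x. f (x + t) \<partial>sym_lebesgue) = (\<integral>\<^sup>+x. f x \<partial>sym_lebesgue)"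
proof -
  have "sym_of_upper c + t = sym_of_upper (\<lambda>p\<in>{(i, j). i \<le> j}. t $ fst p $ snd p + 1 * c p)" for c
    by (auto simp: sym_of_upper_def vec_eq_iff sym_mats_nth[OF t] min_le_iff_disj le_max_iff_disj)
  then show ?thesis
    using nn_integral_PiM_affine[OF finite_upper, of "\<lambda>_. 1" "\<lambda>c. f (sym_of_upper c)" "\<lambda>p. t $ fst p $ snd p"]
    by (simp add: nn_integral_sym_lebesgue)
qed

text \<open>Reflecting the second factors across the diagonal turns the product into one over the
  whole square times one over the diagonal. Each \<open>d i\<close> thus occurs \<open>n + 1\<close>
  times, which is the Jacobian exponent of a congruence.\<close>

lemma prod_upper:
  fixes d :: "'n::{finite,linorder} \<Rightarrow> real"
  shows "(\<Prod>p\<in>{(i, j). i \<le> j}. d (fst p) * d (snd p)) = (\<Prod>i\<in>UNIV. d i) ^ (CARD('n) + 1)"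
proof -
  let ?U = "{(i, j). i \<le> (j :: 'n)}" and ?L = "{(i, j). j \<le> (i :: 'n)}"
  have "(\<Prod>p\<in>?U. d (snd p)) = (\<Prod>p\<in>?L. d (fst p))"
    by (rule prod.reindex_bij_witness[of _ prod.swap prod.swap]) auto
  then have "(\<Prod>p\<in>?U. d (fst p) * d (snd p)) = (\<Prod>p\<in>?U. d (fst p)) * (\<Prod>p\<in>?L. d (fst p))"
    by (simp add: prod.distrib)
  also have "\<dots> = (\<Prod>p\<in>?U \<union> ?L. d (fst p)) * (\<Prod>p\<in>?U \<inter> ?L. d (fst p))"
    by (rule prod.union_inter[symmetric]) (auto intro: finite_subset[of _ UNIV])
  also have "?U \<union> ?L = UNIV \<times> UNIV" by auto
  also have "?U \<inter> ?L = (\<lambda>i. (i, i)) ` UNIV" by auto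
  also have "(\<Prod>p\<in>UNIV \<times> (UNIV :: 'n set). d (fst p)) = (\<Prod>i\<in>UNIV. \<Prod>j\<in>(UNIV :: 'n set). d i)"
    by (subst prod.cartesian_product) (simp add: case_prod_unfold)
  also have "(\<Prod>p\<in>(\<lambda>i. (i, i)) ` UNIV. d (fst p)) = (\<Prod>i\<in>UNIV. d i)"
    by (subst prod.reindex) (auto simp: inj_on_def)
  finally show ?thesis by (simp add: prod_power_distrib mult.commute)
qed

lemma nn_integral_sym_lebesgue_diag:
  fixes d :: "'n::{finite,linorder} \<Rightarrow> real"
  assumes d: "\<forall>i. d i \<noteq> 0" and f [measurable]: "f \<in> borel_measurable borel"
  shows "ennreal (\<bar>\<Prod>i\<in>UNIV. d i\<bar> ^ (CARD('n) + 1)) *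
      (\<integral>\<^sup>+x. f (diag_mat d ** x ** transpose (diag_mat d)) \<partial>sym_lebesgue) = (\<integral>\<^sup>+x. f x \<partial>sym_lebesgue)"
proof -
  let ?s = "\<lambda>p. d (fst p) * d (snd p)"
  have tD: "transpose (diag_mat d) = diag_mat d" by (auto simp: transpose_def vec_eq_iff)
  have eq: "diag_mat d ** sym_of_upper c ** transpose (diag_mat d)
      = sym_of_upper (\<lambda>p\<in>{(i, j). i \<le> j}. 0 + ?s p * c p)" for c
    unfolding tD
    by (auto simp: sym_of_upper_def vec_eq_iff diag_mat_mult min_le_iff_disj le_max_iff_disj min_def max_def)
  have prod: "(\<Prod>p\<in>{(i, j). i \<le> j}. \<bar>?s p\<bar>) = \<bar>\<Prod>i\<in>UNIV. d i\<bar> ^ (CARD('n) + 1)"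
    unfolding abs_prod[symmetric] prod_upper power_abs ..
  show ?thesis
    using nn_integral_PiM_affine[OF finite_upper, of ?s "\<lambda>c. f (sym_of_upper c)" "\<lambda>_. 0"] d
    unfolding prod eq[symmetric] by (simp add: nn_integral_sym_lebesgue)
qed

text \<open>For diagonal \<open>a\<close> the Jacobian is a product over the entries on and above
  the diagonal; the character argument carries it over to every invertible \<open>a\<close>.\<close>

lemma nn_integral_sym_lebesgue_congruence:
  fixes a :: "'n::{finite,linorder} sqmat" and f :: "'n sqmat \<Rightarrow> ennreal"
  assumes "invertible a" "f \<in> borel_measurable borel"
  shows "ennreal (\<bar>det a\<bar> ^ (CARD('n) + 1)) * (\<integral>\<^sup>+x. f (a ** x ** transpose a) \<partial>sym_lebesgue)
    = (\<integral>\<^sup>+x. f x \<partial>sym_lebesgue)"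
proof (rule nn_integral_linear_action[where W = sym_mats and \<rho> = "\<lambda>a x. a ** x ** transpose a"
      and f = f and a = a and k = "CARD('n) + 1"
      and w = "indicator {x. \<forall>i j. \<bar>x $ i $ j\<bar> \<le> 1}"])
  show "sigma_finite_measure (sym_lebesgue :: 'n sqmat measure)" by (rule sigma_finite_sym_lebesgue)
  show "AE x in (sym_lebesgue :: 'n sqmat measure). x \<in> sym_mats" by (rule AE_sym_lebesgue)
  show "linear (\<lambda>x. a ** x ** transpose a)" for a :: "'n sqmat"
    by (rule linearI) (simp_all add: matrix_add_rdistrib matrix_add_ldistrib matrix_mult_scaleR)
  show "- x \<in> sym_mats" if "x \<in> sym_mats" for x :: "'n sqmat"
    using that subspace_sym_mats subspace_neg by blast
  show "a ** x ** transpose a \<in> sym_mats" if "x \<in> sym_mats" for a x :: "'n sqmat"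
    using that by (simp add: sym_mats_def matrix_transpose_mul matrix_mul_assoc)
  show "a ** b ** x ** transpose (a ** b) = a ** (b ** x ** transpose b) ** transpose a" for a b x :: "'n sqmat"
    by (simp add: matrix_transpose_mul matrix_mul_assoc)
  let ?B = "{x :: 'n sqmat. \<forall>i j. \<bar>x $ i $ j\<bar> \<le> 1}"
  have B: "?B \<in> sets borel"
    by (intro borel_closed closed_Collect_all closed_Collect_le continuous_intros)
  then show "(indicator ?B :: _ \<Rightarrow> ennreal) \<in> borel_measurable borel" by simp
  show "integral\<^sup>N sym_lebesgue (indicator ?B) > 0" "integral\<^sup>N sym_lebesgue (indicator ?B) < \<infinity>"
    using B sym_lebesgue_box[of 1, where 'n = 'n] by (simp_all add: ennreal_power)
  fix d :: "'n \<Rightarrow> real" and f :: "'n sqmat \<Rightarrow> ennreal"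
  assume "\<forall>i. d i \<noteq> 0" "f \<in> borel_measurable borel"
  then show "ennreal (\<bar>\<Prod>i\<in>UNIV. d i\<bar> ^ (CARD('n) + 1)) *
      (\<integral>\<^sup>+x. f (diag_mat d ** x ** transpose (diag_mat d)) \<partial>sym_lebesgue) = (\<integral>\<^sup>+x. f x \<partial>sym_lebesgue)"
    by (rule nn_integral_sym_lebesgue_diag)
qed (use assms in \<open>simp_all add: transpose_mat nn_integral_sym_lebesgue_transl\<close>)

section \<open>Invariance of the reference measure\<close>

lemma sets_posdef_mu [measurable_cong, simp]:
  "sets (posdef_mu :: 'n::{finite,linorder} sqmat measure) = sets (restrict_space borel posdef_mats)"
  by (simp add: posdef_mu_def sets_restrict_space)

lemma space_posdef_mu [simp]: "space (posdef_mu :: 'n::{finite,linorder} sqmat measure) = posdef_mats"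
  by (simp add: posdef_mu_def space_restrict_space sym_lebesgue_def)

lemma borel_measurable_posdef_mu:
  "f \<in> measurable borel N \<Longrightarrow> f \<in> measurable (posdef_mu :: 'n::{finite,linorder} sqmat measure) N"
  by (simp cong: measurable_cong_sets add: measurable_restrict_space1)

lemma measurable_lborel_posdef_mu:
  assumes "f \<in> measurable (borel \<Otimes>\<^sub>M borel) N"
  shows "f \<in> measurable (lborel \<Otimes>\<^sub>M (posdef_mu :: 'n::{finite,linorder} sqmat measure)) N"
proof -
  have "(\<lambda>p. (fst p, snd p)) \<in> measurable (lborel \<Otimes>\<^sub>M (posdef_mu :: 'n sqmat measure)) (borel \<Otimes>\<^sub>M borel)"
    by (intro measurable_Pair measurable_compose[OF measurable_snd borel_measurable_posdef_mu]) measurable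
  from measurable_compose[OF this assms] show ?thesis by simp
qed

lemma measurable_posdef_mu_pair:
  assumes "f \<in> measurable (borel \<Otimes>\<^sub>M borel) N"
  shows "f \<in> measurable ((posdef_mu :: 'n::{finite,linorder} sqmat measure) \<Otimes>\<^sub>M
    (posdef_mu :: 'm::{finite,linorder} sqmat measure)) N"
proof -
  have "(\<lambda>p. (fst p, snd p)) \<in> measurable ((posdef_mu :: 'n sqmat measure) \<Otimes>\<^sub>M
      (posdef_mu :: 'm sqmat measure)) (borel \<Otimes>\<^sub>M borel)"
    by (intro measurable_Pair measurable_compose[OF measurable_fst borel_measurable_posdef_mu]
        measurable_compose[OF measurable_snd borel_measurable_posdef_mu]) measurable
  from measurable_compose[OF this assms] show ?thesis by simp
qed

lemma nn_integral_posdef_mu: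
  fixes f :: "'n::{finite,linorder} sqmat \<Rightarrow> ennreal"
  assumes [measurable]: "f \<in> borel_measurable borel"
  shows "(\<integral>\<^sup>+x. f x \<partial>posdef_mu) =
    (\<integral>\<^sup>+x. indicator posdef_mats x * (ennreal (det x powr (- (real CARD('n) + 1) / 2)) * f x) \<partial>sym_lebesgue)"
proof -
  have [measurable]: "g \<in> borel_measurable (restrict_space sym_lebesgue posdef_mats)"
    if "g \<in> borel_measurable borel" for g :: "'n sqmat \<Rightarrow> ennreal"
    using that by (intro measurable_restrict_space1) measurable
  show ?thesis unfolding posdef_mu_def
    by (subst nn_integral_density) (measurable, simp add: nn_integral_restrict_space sym_lebesgue_def ac_simps)
qed

lemma sigma_finite_posdef_mu: "sigma_finite_measure (posdef_mu :: 'n::{finite,linorder} sqmat measure)"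
proof -
  have 1: "sigma_finite_measure (restrict_space sym_lebesgue (posdef_mats :: 'n sqmat set))"
    using sigma_finite_sym_lebesgue by (intro sigma_finite_measure_restrict_space) simp_all
  have "(\<lambda>x :: 'n sqmat. ennreal (det x powr (- (real CARD('n) + 1) / 2)))
      \<in> borel_measurable (restrict_space sym_lebesgue posdef_mats)"
    by (intro measurable_restrict_space1) measurable
  from sigma_finite_measure.sigma_finite_iff_density_finite[OF 1 this] show ?thesis
    unfolding posdef_mu_def by simp
qed

text \<open>The exponent \<open>- (n + 1) / 2\<close> in \<open>posdef_mu\<close> is made for this:
  \<open>det (a x a^T)\<close> carries the factor \<open>(det a)^2\<close>, whose power cancels the
  Jacobian \<open>|det a|^(n + 1)\<close>.\<close>

lemma nn_integral_posdef_mu_congruence: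
  fixes a :: "'n::{finite,linorder} sqmat" and f :: "'n sqmat \<Rightarrow> ennreal"
  assumes a: "invertible a" and [measurable]: "f \<in> borel_measurable borel"
  shows "(\<integral>\<^sup>+x. f (a ** x ** transpose a) \<partial>posdef_mu) = (\<integral>\<^sup>+x. f x \<partial>posdef_mu)"
proof -
  let ?e = "- (real CARD('n) + 1) / 2"
  let ?g = "\<lambda>x :: 'n sqmat. indicator posdef_mats x * (ennreal (det x powr ?e) * f x)"
  have iff: "a ** x ** transpose a \<in> posdef_mats \<longleftrightarrow> x \<in> posdef_mats" for x
  proof
    assume "a ** x ** transpose a \<in> posdef_mats"
    from posdef_congruence[OF this invertible_inv[OF a]] show "x \<in> posdef_mats"
      using a by (simp add: matrix_inv_transpose[symmetric] matrix_mul_assoc matrix_mult_inv_cancel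
        invertible_matrix_inv invertible_transpose_iff)
  qed (rule posdef_congruence[OF _ a])
  have scale: "\<bar>det a\<bar> ^ (CARD('n) + 1) * det (a ** x ** transpose a) powr ?e = det x powr ?e"
    if "x \<in> posdef_mats" for x
  proof -
    have d: "\<bar>det a\<bar> > 0" using a by (simp add: invertible_det_nz)
    have "det (a ** x ** transpose a) = \<bar>det a\<bar> powr 2 * det x"
      using d by (simp add: det_mul powr_numeral power2_eq_square)
    then have "det (a ** x ** transpose a) powr ?e = (\<bar>det a\<bar> powr 2) powr ?e * det x powr ?e"
      using posdef_det_pos[OF that] by (simp add: powr_mult)
    also have "(\<bar>det a\<bar> powr 2) powr ?e = \<bar>det a\<bar> powr - real (CARD('n) + 1)"
    proof -
      have "2 * ?e = - real (CARD('n) + 1)" by (simp add: field_simps)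
      then show ?thesis by (simp only: powr_powr)
    qed
    finally have "det (a ** x ** transpose a) powr ?e = inverse (\<bar>det a\<bar> ^ (CARD('n) + 1)) * det x powr ?e"
      using d by (simp only: powr_minus powr_realpow)
    then show ?thesis using d by (simp add: field_simps)
  qed
  have "(\<integral>\<^sup>+x. f (a ** x ** transpose a) \<partial>posdef_mu) =
      (\<integral>\<^sup>+x. indicator posdef_mats x * (ennreal (det x powr ?e) * f (a ** x ** transpose a)) \<partial>sym_lebesgue)"
    by (subst nn_integral_posdef_mu) simp_all
  also have "\<dots> = (\<integral>\<^sup>+x. ennreal (\<bar>det a\<bar> ^ (CARD('n) + 1)) * ?g (a ** x ** transpose a) \<partial>sym_lebesgue)"
  proof (rule nn_integral_cong)
    fix x :: "'n sqmat"
    show "indicator posdef_mats x * (ennreal (det x powr ?e) * f (a ** x ** transpose a))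
        = ennreal (\<bar>det a\<bar> ^ (CARD('n) + 1)) * ?g (a ** x ** transpose a)"
    proof (cases "x \<in> posdef_mats")
      case True
      have "ennreal (det x powr ?e)
          = ennreal (\<bar>det a\<bar> ^ (CARD('n) + 1)) * ennreal (det (a ** x ** transpose a) powr ?e)"
        unfolding scale[OF True, symmetric] by (rule ennreal_mult) auto
      then show ?thesis using True unfolding iff indicator_def by (simp only: mult_1 mult.assoc if_True of_bool_eq)
    qed (simp add: iff)
  qed
  also have "\<dots> = ennreal (\<bar>det a\<bar> ^ (CARD('n) + 1)) * (\<integral>\<^sup>+x. ?g (a ** x ** transpose a) \<partial>sym_lebesgue)"
    by (rule nn_integral_cmult) measurable
  also have "\<dots> = (\<integral>\<^sup>+x. ?g x \<partial>sym_lebesgue)"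
    by (rule nn_integral_sym_lebesgue_congruence[OF a]) measurable
  also have "\<dots> = (\<integral>\<^sup>+x. f x \<partial>posdef_mu)"
    by (subst nn_integral_posdef_mu) simp_all
  finally show ?thesis .
qed

text \<open>The integrals against \<open>lborel\<close> are with respect to the Haar measure \<open>|det a|\<^sup>-\<^sup>n da\<close> of the general
  linear group. Both sides arise from the integral of \<open>f (a x a\<^sup>T) g (a a\<^sup>T)\<close> over \<open>a\<close> and \<open>x\<close>, one of
  them after the substitution \<open>a = b x\<^sup>-\<^sup>1\<^sup>/\<^sup>2\<close>.\<close>

lemma posdef_mu_haar:
  fixes f g :: "'n::{finite,linorder} sqmat \<Rightarrow> ennreal"
  assumes [measurable]: "f \<in> borel_measurable borel" "g \<in> borel_measurable borel"
  defines "\<delta> \<equiv> \<lambda>a :: 'n sqmat. ennreal (inverse (\<bar>det a\<bar> ^ CARD('n)))"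
  shows "(\<integral>\<^sup>+x. f x \<partial>posdef_mu) * (\<integral>\<^sup>+a. \<delta> a * g (a ** transpose a) \<partial>lborel)
    = (\<integral>\<^sup>+a. \<delta> a * f (a ** transpose a) \<partial>lborel) * (\<integral>\<^sup>+x. g (matrix_inv x) \<partial>posdef_mu)"
proof -
  interpret sigma_finite_measure "posdef_mu :: 'n sqmat measure" by (rule sigma_finite_posdef_mu)
  interpret P: pair_sigma_finite lborel "posdef_mu :: 'n sqmat measure" ..
  have [measurable]: "\<delta> \<in> borel_measurable borel" unfolding \<delta>_def by measurable
  \<comment> \<open>Because \<open>inverse 0 = 0\<close>, the weight \<open>\<delta>\<close>
    vanishes on singular matrices, so the substitutions below only have to treat invertible
    ones.\<close>
  have \<delta>0: "\<delta> a = 0" if "\<not> invertible a" for a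
    using that by (simp add: \<delta>_def invertible_det_nz zero_power)
  have haar: "(\<integral>\<^sup>+a. \<delta> a * h (a ** transpose c) \<partial>lborel) = (\<integral>\<^sup>+a. \<delta> a * h a \<partial>lborel)"
    if c: "invertible c" and [measurable]: "h \<in> borel_measurable borel" for c and h :: "'n sqmat \<Rightarrow> ennreal"
  proof -
    have \<delta>: "\<delta> a = ennreal (\<bar>det c\<bar> ^ CARD('n)) * \<delta> (a ** transpose c)" for a
      using c by (simp add: \<delta>_def det_mul invertible_det_nz ennreal_mult[symmetric] abs_mult power_mult_distrib)
    have "(\<integral>\<^sup>+a. \<delta> a * h (a ** transpose c) \<partial>lborel)
        = (\<integral>\<^sup>+a. ennreal (\<bar>det c\<bar> ^ CARD('n)) * (\<delta> (a ** transpose c) * h (a ** transpose c)) \<partial>lborel)"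
      by (intro nn_integral_cong, subst \<delta>, rule mult.assoc)
    also have "\<dots> = ennreal (\<bar>det c\<bar> ^ CARD('n)) * (\<integral>\<^sup>+a. \<delta> (a ** transpose c) * h (a ** transpose c) \<partial>lborel)"
      by (rule nn_integral_cmult) measurable
    also have "\<dots> = (\<integral>\<^sup>+a. \<delta> a * h a \<partial>lborel)"
      by (rule nn_integral_matrix_mult_right[OF c]) measurable
    finally show ?thesis .
  qed
  have "(\<integral>\<^sup>+x. f x \<partial>posdef_mu) * (\<integral>\<^sup>+a. \<delta> a * g (a ** transpose a) \<partial>lborel)
      = (\<integral>\<^sup>+a. \<delta> a * g (a ** transpose a) * (\<integral>\<^sup>+x. f x \<partial>posdef_mu) \<partial>lborel)"
    by (subst nn_integral_multc) (measurable, rule mult.commute)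
  also have "\<dots> = (\<integral>\<^sup>+a. \<integral>\<^sup>+x. \<delta> a * g (a ** transpose a) * f (a ** x ** transpose a) \<partial>posdef_mu \<partial>lborel)"
  proof (rule nn_integral_cong)
    fix a :: "'n sqmat"
    have [measurable]: "(\<lambda>x. f (a ** x ** transpose a)) \<in> borel_measurable posdef_mu"
      by (intro borel_measurable_posdef_mu) measurable
    show "\<delta> a * g (a ** transpose a) * (\<integral>\<^sup>+x. f x \<partial>posdef_mu)
        = (\<integral>\<^sup>+x. \<delta> a * g (a ** transpose a) * f (a ** x ** transpose a) \<partial>posdef_mu)"
      by (cases "invertible a") (simp_all add: nn_integral_cmult nn_integral_posdef_mu_congruence \<delta>0)
  qed
  also have "\<dots> = (\<integral>\<^sup>+x. \<integral>\<^sup>+a. \<delta> a * g (a ** transpose a) * f (a ** x ** transpose a) \<partial>lborel \<partial>posdef_mu)"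
    by (intro P.Fubini'[symmetric] measurable_lborel_posdef_mu) measurable
  also have "\<dots> = (\<integral>\<^sup>+x. \<integral>\<^sup>+b. \<delta> b * f (b ** transpose b) * g (b ** matrix_inv x ** transpose b) \<partial>lborel \<partial>posdef_mu)"
  proof (rule nn_integral_cong)
    fix x :: "'n sqmat" assume "x \<in> space posdef_mu"
    then have x: "x \<in> posdef_mats" by simp
    let ?r = "mat_sqrt x"
    note r = mat_sqrt[OF x]
    have inv: "invertible ?r" and t: "transpose ?r = ?r" using r posdef_invertible posdef_matsD by blast+
    have ix: "matrix_inv x = matrix_inv ?r ** matrix_inv ?r"
      using matrix_inv_mult[OF inv inv] r(2) by simp
    have 1: "a ** ?r ** matrix_inv x ** transpose (a ** ?r) = a ** transpose a"
      and 2: "a ** ?r ** transpose (a ** ?r) = a ** x ** transpose a" for a :: "'n sqmat"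
    proof -
      show "a ** ?r ** matrix_inv x ** transpose (a ** ?r) = a ** transpose a"
        using inv by (simp add: ix matrix_transpose_mul t matrix_mul_assoc matrix_mult_inv_cancel)
      have "a ** ?r ** transpose (a ** ?r) = a ** (?r ** ?r) ** transpose a"
        by (simp add: matrix_transpose_mul t matrix_mul_assoc)
      then show "a ** ?r ** transpose (a ** ?r) = a ** x ** transpose a" by (simp only: r(2))
    qed
    have "(\<integral>\<^sup>+b. \<delta> b * (f (b ** transpose b) * g (b ** matrix_inv x ** transpose b)) \<partial>lborel)
      = (\<integral>\<^sup>+a. \<delta> a * (f (a ** x ** transpose a) * g (a ** transpose a)) \<partial>lborel)"
      using haar[OF inv, of "\<lambda>b. f (b ** transpose b) * g (b ** matrix_inv x ** transpose b)", symmetric]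
      unfolding t 1 2 by simp
    then show "(\<integral>\<^sup>+a. \<delta> a * g (a ** transpose a) * f (a ** x ** transpose a) \<partial>lborel)
      = (\<integral>\<^sup>+b. \<delta> b * f (b ** transpose b) * g (b ** matrix_inv x ** transpose b) \<partial>lborel)"
      by (simp add: ac_simps)
  qed
  also have "\<dots> = (\<integral>\<^sup>+b. \<integral>\<^sup>+x. \<delta> b * f (b ** transpose b) * g (b ** matrix_inv x ** transpose b) \<partial>posdef_mu \<partial>lborel)"
    by (intro P.Fubini' measurable_lborel_posdef_mu) measurable
  also have "\<dots> = (\<integral>\<^sup>+b. \<delta> b * f (b ** transpose b) * (\<integral>\<^sup>+x. g (matrix_inv x) \<partial>posdef_mu) \<partial>lborel)"
  proof (rule nn_integral_cong)
    fix b :: "'n sqmat"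
    have [measurable]: "(\<lambda>x. g (b ** matrix_inv x ** transpose b)) \<in> borel_measurable posdef_mu"
      by (intro borel_measurable_posdef_mu) measurable
    have "(\<integral>\<^sup>+x. g (b ** matrix_inv x ** transpose b) \<partial>posdef_mu) = (\<integral>\<^sup>+x. g (matrix_inv x) \<partial>posdef_mu)"
      if b: "invertible b"
    proof -
      \<comment> \<open>\<open>b x^-1 b^T\<close> is the inverse of the congruence of
        \<open>x\<close> by the inverse transpose of \<open>b\<close>.\<close>
      let ?c = "transpose (matrix_inv b)"
      have c: "invertible ?c" using b by (simp add: invertible_inv invertible_transpose_iff)
      have "b ** matrix_inv x ** transpose b = matrix_inv (?c ** x ** transpose ?c)"
        if "x \<in> posdef_mats" for x
        using b c posdef_invertible[OF that]
        by (simp add: matrix_inv_mult invertible_matrix_mult invertible_transpose_iff invertible_inv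
            matrix_inv_transpose matrix_inv_inv matrix_mul_assoc)
      then have "(\<integral>\<^sup>+x. g (b ** matrix_inv x ** transpose b) \<partial>posdef_mu)
          = (\<integral>\<^sup>+x. g (matrix_inv (?c ** x ** transpose ?c)) \<partial>posdef_mu)"
        by (intro nn_integral_cong) simp
      also have "\<dots> = (\<integral>\<^sup>+x. g (matrix_inv x) \<partial>posdef_mu)"
        by (rule nn_integral_posdef_mu_congruence[OF c]) measurable
      finally show ?thesis .
    qed
    then show "(\<integral>\<^sup>+x. \<delta> b * f (b ** transpose b) * g (b ** matrix_inv x ** transpose b) \<partial>posdef_mu)
        = \<delta> b * f (b ** transpose b) * (\<integral>\<^sup>+x. g (matrix_inv x) \<partial>posdef_mu)"
      by (cases "invertible b") (simp_all add: nn_integral_cmult \<delta>0)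
  qed
  also have "\<dots> = (\<integral>\<^sup>+a. \<delta> a * f (a ** transpose a) \<partial>lborel) * (\<integral>\<^sup>+x. g (matrix_inv x) \<partial>posdef_mu)"
    by (simp add: nn_integral_multc)
  finally show ?thesis .
qed

text \<open>With \<open>H f\<close> the Haar integral of \<open>f (a a^T)\<close>,
  \<open>posdef_mu_haar\<close> reads \<open>mu f * H g = H f * mu (g o inv)\<close>. If
  \<open>H k\<close> is positive and finite, then \<open>f = g = k\<close> gives
  \<open>mu k = mu (k o inv)\<close>, and the instances \<open>(k, f)\<close> and
  \<open>(f, k)\<close> together leave only the claim.\<close>

lemma nn_integral_posdef_mu_inv:
  fixes f :: "'n::{finite,linorder} sqmat \<Rightarrow> ennreal"
  assumes f [measurable]: "f \<in> borel_measurable borel"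
  shows "(\<integral>\<^sup>+x. f (matrix_inv x) \<partial>posdef_mu) = (\<integral>\<^sup>+x. f x \<partial>posdef_mu)"
proof -
  let ?d = "CARD('n)"
  let ?mu = "\<lambda>f. \<integral>\<^sup>+x. f x \<partial>(posdef_mu :: 'n sqmat measure)"
  define H where "H f = (\<integral>\<^sup>+a. ennreal (inverse (\<bar>det a\<bar> ^ ?d)) * f (a ** transpose a) \<partial>lborel)"
    for f :: "'n sqmat \<Rightarrow> ennreal"
  \<comment> \<open>The bounds leave room around \<open>mat 1\<close>, which has determinant 1 and
    trace \<open>?d\<close>, so the preimage \<open>V\<close> of \<open>K\<close> under a |-> a a^T
    is a nonempty open set. The trace bounds the norm of \<open>a\<close> and the determinant bounds
    the weight, so \<open>H k\<close> is finite.\<close>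
  define K :: "'n sqmat set" where "K = {x \<in> posdef_mats. det x > 1 / 2 \<and> trace x < real ?d + 1}"
  define k :: "'n sqmat \<Rightarrow> ennreal" where "k = indicator K"
  have [measurable]: "K \<in> sets borel" unfolding K_def by measurable
  then have k [measurable]: "k \<in> borel_measurable borel" unfolding k_def by measurable
  define V where "V = {a :: 'n sqmat. det (a ** transpose a) > 1 / 2 \<and> trace (a ** transpose a) < real ?d + 1}"
  have V: "a ** transpose a \<in> K \<longleftrightarrow> a \<in> V" for a
  proof -
    have "a ** transpose a \<in> posdef_mats" if "det (a ** transpose a) > 1 / 2"
    proof -
      have "det a \<noteq> 0" using that by (auto simp: det_mul)
      then show ?thesis using posdef_congruence[OF posdef_id, of a] by (simp add: invertible_det_nz)
    qed
    then show ?thesis unfolding K_def V_def by auto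
  qed
  have open_V: "open V" unfolding V_def
    by (intro open_Collect_conj open_Collect_less continuous_intros continuous_on_compose2[OF continuous_on_det[of UNIV]]) auto
  then have [measurable]: "V \<in> sets borel" by simp
  have "mat 1 \<in> V" unfolding V_def by (simp add: transpose_mat trace_I)
  have HV: "H k = (\<integral>\<^sup>+a. ennreal (inverse (\<bar>det a\<bar> ^ ?d)) * indicator V a \<partial>lborel)"
    unfolding H_def k_def using V by (simp add: indicator_def)
  have "H k \<noteq> 0"
  proof
    assume "H k = 0"
    then have "AE a in lborel. ennreal (inverse (\<bar>det a\<bar> ^ ?d)) * indicator V a = 0"
      unfolding HV by (subst (asm) nn_integral_0_iff_AE) auto
    then have "AE a in lborel. a \<notin> V"
      by eventually_elim (auto simp: V_def det_mul indicator_def zero_power split: if_splits)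
    then have "V \<in> null_sets lborel"
      by (simp add: AE_iff_null_sets)
    then have "negligible V" unfolding negligible_iff_null_sets by (rule null_sets_completionI)
    then show False using open_not_negligible[OF open_V] \<open>mat 1 \<in> V\<close> by blast
  qed
  have "H k \<noteq> \<top>"
  proof -
    have sub: "V \<subseteq> cball 0 (sqrt (real ?d + 1))"
    proof
      fix a assume "a \<in> V"
      then have "(norm a)\<^sup>2 \<le> real ?d + 1"
        unfolding V_def using trace_transpose_mult_self[of a] trace_mul_sym[of a "transpose a"] by simp
      then show "a \<in> cball 0 (sqrt (real ?d + 1))" by (simp add: real_le_rsqrt)
    qed
    have "inverse (\<bar>det a\<bar> ^ ?d) \<le> 2 ^ ?d" if "a \<in> V" for a
    proof -
      have "\<bar>det a\<bar> * \<bar>det a\<bar> > 1 / 2" using that by (simp add: V_def det_mul)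
      then have "\<bar>det a\<bar> \<ge> 1 / 2"
        using mult_mono[of "\<bar>det a\<bar>" "1 / 2" "\<bar>det a\<bar>" "1 / 2"] by (cases "\<bar>det a\<bar> \<ge> 1 / 2") auto
      then have "(1 / 2) ^ ?d \<le> \<bar>det a\<bar> ^ ?d" by (intro power_mono) auto
      then have "inverse (\<bar>det a\<bar> ^ ?d) \<le> inverse ((1 / 2) ^ ?d)" by (intro le_imp_inverse_le) auto
      then show ?thesis by (simp add: power_one_over field_simps)
    qed
    then have "H k \<le> (\<integral>\<^sup>+a. ennreal (2 ^ ?d) * indicator (cball 0 (sqrt (real ?d + 1))) a \<partial>(lborel :: 'n sqmat measure))"
      unfolding HV using sub by (intro nn_integral_mono) (auto simp: indicator_def ennreal_leI)
    also have "\<dots> < \<top>"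
      by (subst nn_integral_cmult_indicator) (auto simp: ennreal_mult_less_top emeasure_lborel_cball_finite[unfolded infinity_ennreal_def])
    finally show ?thesis by simp
  qed
  have eq: "?mu f * H g = H f * ?mu (\<lambda>x. g (matrix_inv x))"
    if "f \<in> borel_measurable borel" "g \<in> borel_measurable borel" for f g
    unfolding H_def by (rule posdef_mu_haar[OF that])
  have canc: "x = y" if "H k * x = H k * y" for x y
    using that \<open>H k \<noteq> 0\<close> \<open>H k \<noteq> \<top>\<close> by (simp add: ennreal_mult_cancel_left)
  have kk: "?mu k = ?mu (\<lambda>x. k (matrix_inv x))"
    using eq[OF k k] unfolding mult.commute[of "?mu k"] by (rule canc)
  have "H k * ?mu (\<lambda>x. f (matrix_inv x)) = ?mu k * H f" using eq[OF k f] by simp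
  also have "\<dots> = H k * ?mu f" using eq[OF f k] unfolding kk mult.commute[of "?mu f"] mult.commute[of "H f"] by (rule sym)
  finally show ?thesis by (rule canc)
qed

section \<open>The intertwining relation\<close>

text \<open>The map \<open>(b, y) \<mapsto> (z, t)\<close> with \<open>z = (b\<^sup>-\<^sup>1 + y)\<^sup>-\<^sup>1\<close> and \<open>t = b - z\<close> preserves
  \<open>posdef_mu \<times> posdef_mu\<close>.\<close>

lemma posdef_mu_pair_change:
  fixes H :: "'n::{finite,linorder} sqmat \<Rightarrow> 'n sqmat \<Rightarrow> ennreal"
  assumes H [measurable]: "(\<lambda>(b, y). H b y) \<in> borel_measurable (borel \<Otimes>\<^sub>M borel)"
  shows "(\<integral>\<^sup>+b. \<integral>\<^sup>+y. H b y \<partial>posdef_mu \<partial>posdef_mu)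
    = (\<integral>\<^sup>+z. \<integral>\<^sup>+t. H (z + t) (matrix_inv z - matrix_inv (z + t)) \<partial>posdef_mu \<partial>posdef_mu)"
proof -
  interpret sigma_finite_measure "posdef_mu :: 'n sqmat measure" by (rule sigma_finite_posdef_mu)
  interpret P: pair_sigma_finite "posdef_mu :: 'n sqmat measure" "posdef_mu :: 'n sqmat measure" ..
  define e where "e = (real CARD('n) + 1) / 2"
  have e: "- (real CARD('n) + 1) / 2 = - e" unfolding e_def by (simp only: minus_divide_left)
  define w where "w x = ennreal (det x powr - e)" for x :: "'n sqmat"
  \<comment> \<open>The inner integrand for fixed \<open>b\<close> in the variable
    \<open>z = (b^-1 + y)^-1\<close>; the power of the determinant accounts for the return from
    Lebesgue measure to \<open>posdef_mu\<close>.\<close>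
  define F where "F b z = ennreal (det (matrix_inv z) powr e) *
      (indicator posdef_mats (matrix_inv z - matrix_inv b) * (w (matrix_inv z - matrix_inv b) *
        H b (matrix_inv z - matrix_inv b)))" for b z
  have [measurable]: "w \<in> borel_measurable borel" unfolding w_def by measurable
  have F [measurable]: "(\<lambda>(b, z). F b z) \<in> borel_measurable (borel \<Otimes>\<^sub>M borel)" unfolding F_def by measurable
  have mu: "(\<integral>\<^sup>+x. f x \<partial>posdef_mu) = (\<integral>\<^sup>+x. indicator posdef_mats x * (w x * f x) \<partial>sym_lebesgue)"
    if "f \<in> borel_measurable borel" for f :: "'n sqmat \<Rightarrow> ennreal"
    unfolding w_def using nn_integral_posdef_mu[OF that] unfolding e .
  have sym: "matrix_inv x \<in> sym_mats" "x \<in> sym_mats" "- x \<in> sym_mats" "- matrix_inv x \<in> sym_mats"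
    if "x \<in> posdef_mats" for x :: "'n sqmat"
    using posdef_inv[OF that] that posdef_subset_sym subspace_neg[OF subspace_sym_mats] by blast+
  have "(\<integral>\<^sup>+y. H b y \<partial>posdef_mu) = (\<integral>\<^sup>+z. F b z \<partial>posdef_mu)" if b: "b \<in> posdef_mats" for b
  proof -
    let ?c = "matrix_inv b"
    have [measurable]: "H b \<in> borel_measurable borel" using H by measurable
    have "(\<integral>\<^sup>+y. H b y \<partial>posdef_mu) = (\<integral>\<^sup>+y. indicator posdef_mats y * (w y * H b y) \<partial>sym_lebesgue)"
      by (rule mu) measurable
    also have "\<dots> = (\<integral>\<^sup>+u. indicator posdef_mats (u + (- ?c)) * (w (u + (- ?c)) * H b (u + (- ?c))) \<partial>sym_lebesgue)"
      by (rule nn_integral_sym_lebesgue_transl[symmetric], use sym[OF b] in simp) measurable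
    \<comment> \<open>\<open>det u powr e\<close> cancels the density \<open>w u\<close>, so the
      Lebesgue integral becomes one against \<open>posdef_mu\<close>, where inversion is available.
      The new indicator of \<open>u\<close> changes nothing, since \<open>u\<close> lies in the cone
      whenever \<open>u - b^-1\<close> does.\<close>
    also have "\<dots> = (\<integral>\<^sup>+u. indicator posdef_mats u * (w u * (ennreal (det u powr e) *
        (indicator posdef_mats (u - ?c) * (w (u - ?c) * H b (u - ?c))))) \<partial>sym_lebesgue)"
    proof (rule nn_integral_cong)
      fix u :: "'n sqmat"
      show "indicator posdef_mats (u + (- ?c)) * (w (u + (- ?c)) * H b (u + (- ?c))) =
          indicator posdef_mats u * (w u * (ennreal (det u powr e) *
          (indicator posdef_mats (u - ?c) * (w (u - ?c) * H b (u - ?c)))))"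
      proof (cases "u - ?c \<in> posdef_mats")
        case True
        then have u: "u \<in> posdef_mats" using posdef_add[OF True posdef_inv[OF b]] by simp
        have "w u * ennreal (det u powr e) = 1"
          using posdef_det_pos[OF u] by (simp add: w_def ennreal_mult[symmetric] powr_add[symmetric])
        then show ?thesis using True u by (simp add: mult.assoc[symmetric])
      qed simp
    qed
    also have "\<dots> = (\<integral>\<^sup>+u. ennreal (det u powr e) *
        (indicator posdef_mats (u - ?c) * (w (u - ?c) * H b (u - ?c))) \<partial>posdef_mu)"
      by (rule mu[symmetric]) measurable
    also have "\<dots> = (\<integral>\<^sup>+z. F b z \<partial>posdef_mu)"
      unfolding F_def by (rule nn_integral_posdef_mu_inv[symmetric]) measurable
    finally show ?thesis .
  qed
  then have "(\<integral>\<^sup>+b. \<integral>\<^sup>+y. H b y \<partial>posdef_mu \<partial>posdef_mu) = (\<integral>\<^sup>+b. \<integral>\<^sup>+z. F b z \<partial>posdef_mu \<partial>posdef_mu)"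
    by (rule_tac nn_integral_cong) simp
  also have "\<dots> = (\<integral>\<^sup>+z. \<integral>\<^sup>+b. F b z \<partial>posdef_mu \<partial>posdef_mu)"
    by (intro P.Fubini'[symmetric] measurable_posdef_mu_pair F)
  also have "\<dots> = (\<integral>\<^sup>+z. \<integral>\<^sup>+t. H (z + t) (matrix_inv z - matrix_inv (z + t)) \<partial>posdef_mu \<partial>posdef_mu)"
  proof (rule nn_integral_cong)
    fix z :: "'n sqmat" assume "z \<in> space posdef_mu"
    then have z: "z \<in> posdef_mats" by simp
    have [measurable]: "(\<lambda>b. F b z) \<in> borel_measurable borel" using F by measurable
    have "(\<integral>\<^sup>+b. F b z \<partial>posdef_mu) = (\<integral>\<^sup>+b. indicator posdef_mats b * (w b * F b z) \<partial>sym_lebesgue)"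
      by (rule mu) measurable
    also have "\<dots> = (\<integral>\<^sup>+t. indicator posdef_mats (t + z) * (w (t + z) * F (t + z) z) \<partial>sym_lebesgue)"
      by (rule nn_integral_sym_lebesgue_transl[symmetric], use sym[OF z] in simp) measurable
    also have "\<dots> = (\<integral>\<^sup>+t. indicator posdef_mats t * (w t * H (z + t) (matrix_inv z - matrix_inv (z + t))) \<partial>sym_lebesgue)"
    proof (rule nn_integral_cong)
      fix t :: "'n sqmat"
      have iff: "matrix_inv z - matrix_inv (t + z) \<in> posdef_mats \<longleftrightarrow> t \<in> posdef_mats" if "t + z \<in> posdef_mats"
        using posdef_inv_diff_iff[OF z that] by simp
      show "indicator posdef_mats (t + z) * (w (t + z) * F (t + z) z)
          = indicator posdef_mats t * (w t * H (z + t) (matrix_inv z - matrix_inv (z + t)))"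
      proof (cases "t \<in> posdef_mats")
        case True
        have tz: "t + z \<in> posdef_mats" by (rule posdef_add[OF True z])
        have pos: "det t > 0" "det z > 0" "det (z + t) > 0"
          using posdef_det_pos True z tz by (auto simp: add.commute)
        \<comment> \<open>Since
          \<open>det (z^-1 - (z + t)^-1) = det t / (det z det (z + t))\<close>, the three powers
          collapse to the density at \<open>t\<close>; hence the product measure is
          preserved.\<close>
        have "det (z + t) powr - e * (det (matrix_inv z) powr e * (det (matrix_inv z - matrix_inv (z + t)) powr - e))
            = det t powr - e"
          unfolding posdef_inv_diff(3)[OF z True] det_matrix_inv[OF posdef_invertible[OF z]]
          using pos by (simp add: powr_divide powr_mult powr_minus inverse_eq_divide field_simps)
        then have "w (z + t) * (ennreal (det (matrix_inv z) powr e) * w (matrix_inv z - matrix_inv (z + t))) = w t"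
          unfolding w_def by (simp add: ennreal_mult[symmetric])
        then show ?thesis using True tz iff[OF tz]
          by (simp add: F_def add.commute[of t z] mult.assoc[symmetric])
      next
        case False
        then show ?thesis using iff by (cases "t + z \<in> posdef_mats") (auto simp: F_def)
      qed
    qed
    also have "\<dots> = (\<integral>\<^sup>+t. H (z + t) (matrix_inv z - matrix_inv (z + t)) \<partial>posdef_mu)"
      by (rule mu[symmetric]) measurable
    finally show "(\<integral>\<^sup>+b. F b z \<partial>posdef_mu) = (\<integral>\<^sup>+t. H (z + t) (matrix_inv z - matrix_inv (z + t)) \<partial>posdef_mu)" .
  qed
  finally show ?thesis .
qed

text \<open>\<open>walk_density \<alpha> \<beta> r\<close> is the density of \<open>r\<^sup>1\<^sup>/\<^sup>2 X r\<^sup>1\<^sup>/\<^sup>2\<close>, and \<open>phi_density \<alpha> \<beta> s\<close> is, up to the factor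
  \<open>phi \<alpha> \<beta> s\<close>, the conditional density of \<open>A(n)\<^sup>-\<^sup>1\<close> given \<open>S(n) = s\<close>.\<close>

definition walk_density :: "real \<Rightarrow> real \<Rightarrow> 'n::{finite,linorder} sqmat \<Rightarrow> 'n sqmat \<Rightarrow> real" where
  "walk_density \<alpha> \<beta> r y = inverse (matrix_Beta TYPE('n) \<alpha> \<beta>) * det r powr \<beta> * det y powr \<alpha> *
    det (r + y) powr (- (\<alpha> + \<beta>))"

definition phi_density :: "real \<Rightarrow> real \<Rightarrow> 'n::{finite,linorder} sqmat \<Rightarrow> 'n sqmat \<Rightarrow> real" where
  "phi_density \<alpha> \<beta> s z = det z powr \<beta> * det (z + s) powr (- \<alpha>) * exp (- trace z)"

lemma borel_measurable_densities [measurable]: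
  "(\<lambda>(r, y). walk_density \<alpha> \<beta> r y) \<in> borel_measurable (borel \<Otimes>\<^sub>M borel)"
  "(\<lambda>(s, z). phi_density \<alpha> \<beta> s z) \<in> borel_measurable (borel \<Otimes>\<^sub>M borel)"
  unfolding walk_density_def phi_density_def by measurable

lemma phi_density_nonneg: "phi_density \<alpha> \<beta> s z \<ge> 0"
  by (simp add: phi_density_def)

text \<open>Up to \<open>phi\<close>, the left side is the density of the old
  \<open>b = z + t\<close> given \<open>s\<close> times that of the move leading to
  \<open>z\<close>: the walk goes from \<open>b^-1 - (b + s)^-1\<close> to
  \<open>z^-1 - b^-1\<close>. Their sum telescopes, so every determinant comes from
  \<open>posdef_inv_diff\<close>, and the product regroups into a kernel from \<open>s\<close> to
  \<open>t\<close> times the density of \<open>z\<close> given \<open>t\<close>.\<close>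

lemma intertwining_densities:
  fixes s t z :: "'n::{finite,linorder} sqmat"
  assumes "s \<in> posdef_mats" "t \<in> posdef_mats" "z \<in> posdef_mats"
  shows "phi_density \<alpha> \<beta> s (z + t) *
      walk_density \<alpha> \<beta> (matrix_inv (z + t) - matrix_inv (z + t + s)) (matrix_inv z - matrix_inv (z + t))
    = walk_density \<alpha> \<beta> s t * exp (- trace t) * phi_density \<alpha> \<beta> t z"
proof -
  have zt: "z + t \<in> posdef_mats" and ts: "t + s \<in> posdef_mats" and zts: "z + t + s \<in> posdef_mats"
    using assms by (auto intro: posdef_add)
  have sum: "matrix_inv (z + t) - matrix_inv (z + t + s) + (matrix_inv z - matrix_inv (z + t))
      = matrix_inv z - matrix_inv (z + t + s)" by simp
  have det: "det (matrix_inv z - matrix_inv (z + t + s)) = det (t + s) / (det z * det (z + t + s))"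
    using posdef_inv_diff(3)[OF assms(3) ts] by (simp only: add.assoc)
  have pos: "det s > 0" "det t > 0" "det z > 0" "det (z + t) > 0" "det (t + s) > 0" "det (z + t + s) > 0"
    using assms zt ts zts posdef_det_pos by blast+
  show ?thesis
    unfolding phi_density_def walk_density_def sum posdef_inv_diff(3)[OF zt assms(1)]
      posdef_inv_diff(3)[OF assms(3,2)] det add.commute[of s t] trace_add
    using pos by (simp add: powr_def ln_mult ln_div exp_add[symmetric] algebra_simps)
qed

text \<open>The same regrouping at time 0, where \<open>z + t\<close> is the inverse of
  \<open>R 0\<close>: up to the Wishart constant, the joint density splits into a function of
  \<open>t\<close> and \<open>phi_density\<close> at \<open>(t, z)\<close>.\<close>

lemma initial_densities:
  fixes t z :: "'n::{finite,linorder} sqmat"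
  assumes "t \<in> posdef_mats" "z \<in> posdef_mats"
  shows "det (z + t) powr \<beta> * exp (- trace (z + t)) *
      walk_density \<alpha> \<beta> (matrix_inv (z + t)) (matrix_inv z - matrix_inv (z + t))
    = inverse (matrix_Beta TYPE('n) \<alpha> \<beta>) * det t powr \<alpha> * exp (- trace t) * phi_density \<alpha> \<beta> t z"
proof -
  have zt: "z + t \<in> posdef_mats" using assms by (auto intro: posdef_add)
  have sum: "matrix_inv (z + t) + (matrix_inv z - matrix_inv (z + t)) = matrix_inv z" by simp
  have pos: "det t > 0" "det z > 0" "det (z + t) > 0"
    using assms zt posdef_det_pos by blast+
  show ?thesis
    unfolding phi_density_def walk_density_def sum posdef_inv_diff(3)[OF assms(2,1)]
      det_matrix_inv[OF posdef_invertible[OF zt]] det_matrix_inv[OF posdef_invertible[OF assms(2)]] trace_add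
    using pos by (simp add: powr_def ln_mult ln_div ln_inverse exp_add[symmetric] algebra_simps)
qed

text \<open>With \<open>y = q x q\<close> and \<open>q\<close> the root of \<open>r\<close>,
  \<open>det x = det y / det r\<close> and \<open>det (1 + x) = det (r + y) / det r\<close>; the
  powers of \<open>det r\<close> combine to \<open>det r powr \<beta>\<close>.\<close>

lemma nn_integral_matrix_beta_II:
  fixes g :: "'n::{finite,linorder} sqmat \<Rightarrow> ennreal"
  assumes r: "r \<in> posdef_mats" and [measurable]: "g \<in> borel_measurable borel"
  shows "(\<integral>\<^sup>+x. g (mat_sqrt r ** x ** mat_sqrt r) \<partial>matrix_beta_II \<alpha> \<beta>)
    = (\<integral>\<^sup>+y. ennreal (walk_density \<alpha> \<beta> r y) * g y \<partial>posdef_mu)"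
proof -
  let ?q = "mat_sqrt r"
  note q = mat_sqrt[OF r]
  have inv: "invertible ?q" and t: "transpose ?q = ?q" using q posdef_invertible posdef_matsD by blast+
  have dr: "det r > 0" using posdef_det_pos[OF r] .
  have det_q: "det (?q ** a ** ?q) = det r * det a" for a
  proof -
    have "det r = det ?q * det ?q" using arg_cong[OF q(2), of det] by (simp add: det_mul)
    then show ?thesis by (simp add: det_mul)
  qed
  let ?f = "\<lambda>x :: 'n sqmat. inverse (matrix_Beta TYPE('n) \<alpha> \<beta>) * det x powr \<alpha> * det (mat 1 + x) powr (- (\<alpha> + \<beta>))"
  have f: "?f x = walk_density \<alpha> \<beta> r (?q ** x ** ?q)" if x: "x \<in> posdef_mats" for x
  proof -
    have "r + ?q ** x ** ?q = ?q ** (mat 1 + x) ** ?q"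
      using q(2) by (simp add: matrix_add_ldistrib matrix_add_rdistrib)
    moreover have "det x > 0" "det (mat 1 + x) > 0"
      using x posdef_add[OF posdef_id x] posdef_det_pos by blast+
    ultimately show ?thesis using dr
      by (simp add: walk_density_def det_q powr_def ln_mult exp_add[symmetric] algebra_simps)
  qed
  have "(\<integral>\<^sup>+x. g (?q ** x ** ?q) \<partial>matrix_beta_II \<alpha> \<beta>) = (\<integral>\<^sup>+x. ennreal (?f x) * g (?q ** x ** ?q) \<partial>posdef_mu)"
    unfolding matrix_beta_II_def by (subst nn_integral_density) (auto intro!: borel_measurable_posdef_mu)
  also have "\<dots> = (\<integral>\<^sup>+x. ennreal (walk_density \<alpha> \<beta> r (?q ** x ** transpose ?q)) * g (?q ** x ** transpose ?q) \<partial>posdef_mu)"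
    unfolding t by (intro nn_integral_cong) (simp only: f space_posdef_mu)
  also have "\<dots> = (\<integral>\<^sup>+y. ennreal (walk_density \<alpha> \<beta> r y) * g y \<partial>posdef_mu)"
    by (rule nn_integral_posdef_mu_congruence[OF inv]) measurable
  finally show ?thesis .
qed

text \<open>With \<open>r = R n\<close>, \<open>b\<close> the inverse of \<open>A n\<close> and
  \<open>x = X (n + 1)\<close>, this is the inverse of \<open>A (n + 1)\<close>.\<close>

definition next_inv_sum :: "'n::{finite,linorder} sqmat \<Rightarrow> 'n sqmat \<Rightarrow> 'n sqmat \<Rightarrow> 'n sqmat" where
  "next_inv_sum r b x = matrix_inv (matrix_inv b + mat_sqrt r ** x ** mat_sqrt r)"

lemma borel_measurable_next_inv_sum [measurable (raw)]:
  assumes [measurable]: "f \<in> borel_measurable M" "g \<in> borel_measurable M" "h \<in> borel_measurable M"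
  shows "(\<lambda>x. next_inv_sum (f x) (g x) (h x)) \<in> borel_measurable M"
  unfolding next_inv_sum_def by measurable

text \<open>One transition in the coordinates \<open>t = b - b'\<close> and \<open>z = b'\<close>,
  with \<open>b\<close> weighted by \<open>w\<close>. The position of the walk enters as a function
  \<open>r\<close> of \<open>b\<close>: it is \<open>b^-1 - (b + s)^-1\<close> for the chain and
  \<open>b^-1\<close> for the initial step.\<close>

lemma nn_integral_step:
  fixes r :: "'n::{finite,linorder} sqmat \<Rightarrow> 'n sqmat" and G :: "'n sqmat \<Rightarrow> 'n sqmat \<Rightarrow> ennreal"
  assumes [measurable]: "r \<in> borel_measurable borel" "w \<in> borel_measurable borel"
    "(\<lambda>(t, z). G t z) \<in> borel_measurable (borel \<Otimes>\<^sub>M borel)"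
    and r: "\<And>b. b \<in> posdef_mats \<Longrightarrow> r b \<in> posdef_mats"
  shows "(\<integral>\<^sup>+b. w b * (\<integral>\<^sup>+x. G (b - next_inv_sum (r b) b x) (next_inv_sum (r b) b x) \<partial>matrix_beta_II \<alpha> \<beta>) \<partial>posdef_mu)
    = (\<integral>\<^sup>+t. \<integral>\<^sup>+z. w (z + t) * ennreal (walk_density \<alpha> \<beta> (r (z + t)) (matrix_inv z - matrix_inv (z + t))) * G t z
        \<partial>posdef_mu \<partial>posdef_mu)"
proof -
  interpret sigma_finite_measure "posdef_mu :: 'n sqmat measure" by (rule sigma_finite_posdef_mu)
  interpret P: pair_sigma_finite "posdef_mu :: 'n sqmat measure" "posdef_mu :: 'n sqmat measure" ..
  let ?K = "\<lambda>b y. ennreal (walk_density \<alpha> \<beta> (r b) y)"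
  let ?H = "\<lambda>b y. w b * ?K b y * G (b - matrix_inv (matrix_inv b + y)) (matrix_inv (matrix_inv b + y))"
  let ?g = "\<lambda>z t. w (z + t) * ?K (z + t) (matrix_inv z - matrix_inv (z + t)) * G t z"
  have "(\<integral>\<^sup>+b. w b * (\<integral>\<^sup>+x. G (b - next_inv_sum (r b) b x) (next_inv_sum (r b) b x) \<partial>matrix_beta_II \<alpha> \<beta>) \<partial>posdef_mu)
      = (\<integral>\<^sup>+b. \<integral>\<^sup>+y. ?H b y \<partial>posdef_mu \<partial>posdef_mu)"
  proof (rule nn_integral_cong)
    fix b :: "'n sqmat" assume "b \<in> space posdef_mu"
    then have b: "b \<in> posdef_mats" by simp
    have "(\<integral>\<^sup>+x. G (b - next_inv_sum (r b) b x) (next_inv_sum (r b) b x) \<partial>matrix_beta_II \<alpha> \<beta>)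
      = (\<integral>\<^sup>+y. ?K b y * G (b - matrix_inv (matrix_inv b + y)) (matrix_inv (matrix_inv b + y)) \<partial>posdef_mu)"
      unfolding next_inv_sum_def
      using nn_integral_matrix_beta_II[OF r[OF b], of "\<lambda>y. G (b - matrix_inv (matrix_inv b + y)) (matrix_inv (matrix_inv b + y))"]
      by simp
    moreover have "w b * (\<integral>\<^sup>+y. ?K b y * G (b - matrix_inv (matrix_inv b + y)) (matrix_inv (matrix_inv b + y)) \<partial>posdef_mu)
        = (\<integral>\<^sup>+y. ?H b y \<partial>posdef_mu)"
      unfolding mult.assoc by (rule nn_integral_cmult[symmetric], rule borel_measurable_posdef_mu) measurable
    ultimately show "w b * (\<integral>\<^sup>+x. G (b - next_inv_sum (r b) b x) (next_inv_sum (r b) b x) \<partial>matrix_beta_II \<alpha> \<beta>)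
        = (\<integral>\<^sup>+y. ?H b y \<partial>posdef_mu)" by simp
  qed
  also have "\<dots> = (\<integral>\<^sup>+z. \<integral>\<^sup>+t. ?H (z + t) (matrix_inv z - matrix_inv (z + t)) \<partial>posdef_mu \<partial>posdef_mu)"
    by (rule posdef_mu_pair_change) measurable
  also have "\<dots> = (\<integral>\<^sup>+z. \<integral>\<^sup>+t. ?g z t \<partial>posdef_mu \<partial>posdef_mu)"
    by (intro nn_integral_cong) (simp add: matrix_inv_inv posdef_invertible)
  also have "\<dots> = (\<integral>\<^sup>+t. \<integral>\<^sup>+z. ?g z t \<partial>posdef_mu \<partial>posdef_mu)"
    by (intro P.Fubini'[symmetric] measurable_posdef_mu_pair) measurable
  finally show ?thesis .
qed

lemma measurable_borel_posdef_mu: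
  assumes "f \<in> measurable (borel \<Otimes>\<^sub>M borel) N"
  shows "f \<in> measurable (borel \<Otimes>\<^sub>M (posdef_mu :: 'n::{finite,linorder} sqmat measure)) N"
proof -
  have "(\<lambda>p. (fst p, snd p)) \<in> measurable (borel \<Otimes>\<^sub>M (posdef_mu :: 'n sqmat measure)) (borel \<Otimes>\<^sub>M borel)"
    by (intro measurable_Pair measurable_compose[OF measurable_snd borel_measurable_posdef_mu]) measurable
  from measurable_compose[OF this assms] show ?thesis by simp
qed

lemma borel_measurable_nn_integral_posdef_mu [measurable (raw)]:
  fixes f :: "'a::topological_space \<Rightarrow> 'n::{finite,linorder} sqmat \<Rightarrow> ennreal"
  assumes "(\<lambda>(x, z). f x z) \<in> borel_measurable (borel \<Otimes>\<^sub>M borel)"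
  shows "(\<lambda>x. \<integral>\<^sup>+z. f x z \<partial>posdef_mu) \<in> borel_measurable borel"
  by (intro sigma_finite_measure.borel_measurable_nn_integral[OF sigma_finite_posdef_mu]
      measurable_borel_posdef_mu assms)

section \<open>The normalising function and the law of the initial state\<close>

definition phi_nn :: "real \<Rightarrow> real \<Rightarrow> 'n::{finite,linorder} sqmat \<Rightarrow> ennreal" where
  "phi_nn \<alpha> \<beta> s = (\<integral>\<^sup>+z. ennreal (phi_density \<alpha> \<beta> s z) \<partial>posdef_mu)"

lemma borel_measurable_phi_nn [measurable]: "phi_nn \<alpha> \<beta> \<in> borel_measurable borel"
  unfolding phi_nn_def[abs_def] by (intro borel_measurable_nn_integral_posdef_mu) measurable

lemma borel_measurable_phi [measurable]:
  "phi \<alpha> \<beta> \<in> borel_measurable (borel :: 'n::{finite,linorder} sqmat measure)"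
  unfolding phi_def[abs_def]
  by (intro sigma_finite_measure.borel_measurable_lebesgue_integral[OF sigma_finite_posdef_mu]
      measurable_borel_posdef_mu) measurable

text \<open>The substitution \<open>z = a^-1\<close>, with \<open>1 + s a = (a^-1 + s) a\<close>.
  Finiteness is not yet known here: for an infinite integral both sides are 0 by convention.\<close>

lemma phi_eq_phi_nn:
  fixes s :: "'n::{finite,linorder} sqmat"
  assumes s: "s \<in> posdef_mats"
  shows "phi \<alpha> \<beta> s = enn2real (phi_nn \<alpha> \<beta> s)"
proof -
  let ?f = "\<lambda>a. det a powr (\<alpha> - \<beta>) * det (mat 1 + s ** a) powr (- \<alpha>) * exp (- trace (matrix_inv a))"
  have f: "?f a = phi_density \<alpha> \<beta> s (matrix_inv a)" if a: "a \<in> posdef_mats" for a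
  proof -
    have inv: "invertible a" using a by (rule posdef_invertible)
    have "mat 1 + s ** a = (matrix_inv a + s) ** a"
      using inv by (simp add: matrix_add_rdistrib invertible_matrix_inv)
    then have det: "det (mat 1 + s ** a) = det (matrix_inv a + s) * det a" by (simp add: det_mul)
    have "det a > 0" "det (matrix_inv a + s) > 0"
      using a s posdef_det_pos posdef_inv posdef_add by blast+
    then show ?thesis unfolding phi_density_def det det_matrix_inv[OF inv]
      by (simp add: powr_def ln_mult ln_inverse exp_add[symmetric] algebra_simps)
  qed
  have "phi \<alpha> \<beta> s = enn2real (\<integral>\<^sup>+a. ennreal (?f a) \<partial>posdef_mu)"
    unfolding phi_def
  proof (rule integral_eq_nn_integral)
    have [measurable]: "(\<lambda>a. det (mat 1 + s ** a)) \<in> borel_measurable borel"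
      by (rule measurable_compose[OF _ borel_measurable_det]) measurable
    show "?f \<in> borel_measurable posdef_mu"
      by (rule borel_measurable_posdef_mu) measurable
  qed simp
  also have "(\<integral>\<^sup>+a. ennreal (?f a) \<partial>posdef_mu) = (\<integral>\<^sup>+a. ennreal (phi_density \<alpha> \<beta> s (matrix_inv a)) \<partial>posdef_mu)"
    by (intro nn_integral_cong) (simp only: f space_posdef_mu)
  also have "\<dots> = phi_nn \<alpha> \<beta> s"
    unfolding phi_nn_def by (rule nn_integral_posdef_mu_inv) measurable
  finally show ?thesis .
qed

text \<open>Inversion invariance turns the inverse Wishart law of \<open>R 0\<close> into a Wishart
  density for its inverse.\<close>

lemma nn_integral_inverse_wishart:
  fixes g :: "'n::{finite,linorder} sqmat \<Rightarrow> ennreal"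
  assumes [measurable]: "g \<in> borel_measurable borel"
  shows "(\<integral>\<^sup>+x. g x \<partial>inverse_wishart \<beta>) = (\<integral>\<^sup>+b. ennreal (inverse (matrix_Gamma TYPE('n) \<beta>) *
    (det b powr \<beta> * exp (- trace b))) * g (matrix_inv b) \<partial>posdef_mu)"
proof -
  let ?c = "inverse (matrix_Gamma TYPE('n) \<beta>)"
  let ?f = "\<lambda>x. ?c * det x powr (- \<beta>) * exp (- trace (matrix_inv x))"
  have "(\<integral>\<^sup>+x. g x \<partial>inverse_wishart \<beta>) = (\<integral>\<^sup>+x. ennreal (?f x) * g x \<partial>posdef_mu)"
    unfolding inverse_wishart_def by (subst nn_integral_density) (auto intro!: borel_measurable_posdef_mu)
  also have "\<dots> = (\<integral>\<^sup>+b. ennreal (?f (matrix_inv b)) * g (matrix_inv b) \<partial>posdef_mu)"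
    by (rule nn_integral_posdef_mu_inv[symmetric]) measurable
  also have "\<dots> = (\<integral>\<^sup>+b. ennreal (?c * (det b powr \<beta> * exp (- trace b))) * g (matrix_inv b) \<partial>posdef_mu)"
  proof (rule nn_integral_cong)
    fix b :: "'n sqmat" assume "b \<in> space posdef_mu"
    then have b: "invertible b" "det b > 0" by (auto simp: posdef_invertible posdef_det_pos)
    then have "det (matrix_inv b) powr (- \<beta>) = det b powr \<beta>"
      by (simp add: det_matrix_inv powr_def ln_inverse)
    then show "ennreal (?f (matrix_inv b)) * g (matrix_inv b)
        = ennreal (?c * (det b powr \<beta> * exp (- trace b))) * g (matrix_inv b)"
      using b by (simp add: matrix_inv_inv mult.assoc)
  qed
  finally show ?thesis .
qed

section \<open>Constants, conditional law and intertwining for fixed parameters\<close>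

text \<open>\<open>\<alpha> \<ge> 0\<close> makes \<open>|x|^-\<alpha>\<close> decreasing, and the
  two unit masses control the constants. The type token \<open>T\<close> names the dimension, which
  \<open>\<alpha>\<close> and \<open>\<beta>\<close> do not determine.\<close>

locale walk_parameters =
  fixes \<alpha> \<beta> :: real and T :: "'n::{finite,linorder} itself"
  assumes \<alpha>_nonneg: "\<alpha> \<ge> 0"
    and prob_wishart: "prob_space (inverse_wishart \<beta> :: 'n sqmat measure)"
    and prob_beta: "prob_space (matrix_beta_II \<alpha> \<beta> :: 'n sqmat measure)"
begin

text \<open>\<open>ennreal\<close> truncates negative numbers to 0, so with a nonpositive constant
  the density would vanish and the total mass would be 0.\<close>

lemma inverse_Gamma_pos: "inverse (matrix_Gamma TYPE('n) \<beta>) > 0"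
proof (rule ccontr)
  let ?c = "inverse (matrix_Gamma TYPE('n) \<beta>)"
  assume "\<not> ?c > 0"
  then have "?c * (det b powr \<beta> * exp (- trace b)) \<le> 0" for b :: "'n sqmat"
    by (intro mult_nonpos_nonneg) auto
  then have "ennreal (?c * (det b powr \<beta> * exp (- trace b))) = 0" for b :: "'n sqmat"
    by (rule ennreal_neg)
  then have "(\<integral>\<^sup>+x. 1 \<partial>(inverse_wishart \<beta> :: 'n sqmat measure)) = 0"
    by (subst nn_integral_inverse_wishart) simp_all
  then show False using prob_space.emeasure_space_1[OF prob_wishart] by simp
qed

lemma inverse_Beta_pos: "inverse (matrix_Beta TYPE('n) \<alpha> \<beta>) > 0"
proof (rule ccontr)
  let ?c = "inverse (matrix_Beta TYPE('n) \<alpha> \<beta>)"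
  assume "\<not> ?c > 0"
  then have "walk_density \<alpha> \<beta> (mat 1) y \<le> 0" for y :: "'n sqmat"
    unfolding walk_density_def mult.assoc by (intro mult_nonpos_nonneg) auto
  then have "ennreal (walk_density \<alpha> \<beta> (mat 1) y) = 0" for y :: "'n sqmat"
    by (rule ennreal_neg)
  then have "(\<integral>\<^sup>+x. 1 \<partial>(matrix_beta_II \<alpha> \<beta> :: 'n sqmat measure)) = 0"
    using nn_integral_matrix_beta_II[of "mat 1 :: 'n sqmat" "\<lambda>_. 1" \<alpha> \<beta>] by (simp add: posdef_id)
  then show False using prob_space.emeasure_space_1[OF prob_beta] by simp
qed

lemma walk_density_nonneg: "walk_density \<alpha> \<beta> (r :: 'n sqmat) y \<ge> 0"
  using inverse_Beta_pos by (simp add: walk_density_def)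

text \<open>\<open>det s \<le> det (z + s)\<close> dominates the integrand by a multiple of the
  Gamma integrand.\<close>

lemma phi_nn_finite:
  assumes s: "(s :: 'n sqmat) \<in> posdef_mats"
  shows "phi_nn \<alpha> \<beta> s < \<top>"
proof -
  let ?g = "\<lambda>x :: 'n sqmat. det x powr \<beta> * exp (- trace x)"
  \<comment> \<open>The Bochner integral of a non-integrable function is 0 by convention, so a
    nonzero \<open>matrix_Gamma\<close> certifies integrability.\<close>
  have "(\<integral>x. ?g x \<partial>posdef_mu) \<noteq> 0" using inverse_Gamma_pos by (simp add: matrix_Gamma_def)
  then have "integrable posdef_mu ?g" using not_integrable_integral_eq by blast
  then have fin: "(\<integral>\<^sup>+x. ennreal (?g x) \<partial>posdef_mu) < \<top>"
    by (simp add: integrable_iff_bounded)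
  have le: "phi_density \<alpha> \<beta> s z \<le> det s powr - \<alpha> * ?g z" if z: "z \<in> posdef_mats" for z
  proof -
    have "det s > 0" "det s \<le> det (z + s)"
      using posdef_det_pos[OF s] posdef_det_mono[OF s z] by (simp_all add: add.commute)
    then have "det (z + s) powr - \<alpha> \<le> det s powr - \<alpha>"
      using \<alpha>_nonneg by (intro powr_mono2') auto
    then have "?g z * det (z + s) powr - \<alpha> \<le> ?g z * det s powr - \<alpha>"
      by (rule mult_left_mono) simp
    then show ?thesis by (simp add: phi_density_def ac_simps)
  qed
  have "phi_nn \<alpha> \<beta> s \<le> (\<integral>\<^sup>+z. ennreal (det s powr - \<alpha>) * ennreal (?g z) \<partial>posdef_mu)"
    unfolding phi_nn_def using le by (intro nn_integral_mono) (simp add: ennreal_mult[symmetric] ennreal_leI)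
  also have "\<dots> = ennreal (det s powr - \<alpha>) * (\<integral>\<^sup>+z. ennreal (?g z) \<partial>posdef_mu)"
    by (rule nn_integral_cmult, rule borel_measurable_posdef_mu) measurable
  also have "\<dots> < \<top>" using fin by (simp add: ennreal_mult_less_top)
  finally show ?thesis .
qed

text \<open>The integrand is strictly positive on the cone, so a zero integral would make
  \<open>posdef_mu\<close> the null measure, and the inverse Wishart law would have mass 0.\<close>

lemma phi_nn_nonzero:
  assumes s: "(s :: 'n sqmat) \<in> posdef_mats"
  shows "phi_nn \<alpha> \<beta> s \<noteq> 0"
proof
  assume "phi_nn \<alpha> \<beta> s = 0"
  moreover have "(\<lambda>z. ennreal (phi_density \<alpha> \<beta> s z)) \<in> borel_measurable posdef_mu"
    by (rule borel_measurable_posdef_mu) measurable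
  ultimately have ae: "AE z in posdef_mu. ennreal (phi_density \<alpha> \<beta> s z) = 0"
    unfolding phi_nn_def by (simp add: nn_integral_0_iff_AE)
  have pos: "phi_density \<alpha> \<beta> s z > 0" if "z \<in> posdef_mats" for z
    using posdef_det_pos[OF that] posdef_det_pos[OF posdef_add[OF that s]] by (simp add: phi_density_def)
  have "AE z in (posdef_mu :: 'n sqmat measure). False"
    using ae AE_space by eventually_elim (use pos in \<open>force simp: not_le\<close>)
  then have "(\<integral>\<^sup>+b. ennreal (inverse (matrix_Gamma TYPE('n) \<beta>) *
    (det b powr \<beta> * exp (- trace b))) * 1 \<partial>(posdef_mu :: 'n sqmat measure)) = (\<integral>\<^sup>+b. 0 \<partial>(posdef_mu :: 'n sqmat measure))"
    by (intro nn_integral_cong_AE) auto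
  then have "(\<integral>\<^sup>+x. 1 \<partial>(inverse_wishart \<beta> :: 'n sqmat measure)) = 0"
    by (subst nn_integral_inverse_wishart) simp_all
  then show False using prob_space.emeasure_space_1[OF prob_wishart] by simp
qed

lemma phi_pos: "(s :: 'n sqmat) \<in> posdef_mats \<Longrightarrow> phi \<alpha> \<beta> s > 0"
  using phi_nn_finite phi_nn_nonzero
  by (simp add: phi_eq_phi_nn enn2real_positive_iff zero_less_iff_neq_zero)

lemma ennreal_phi: "(s :: 'n sqmat) \<in> posdef_mats \<Longrightarrow> ennreal (phi \<alpha> \<beta> s) = phi_nn \<alpha> \<beta> s"
  using phi_nn_finite by (simp add: phi_eq_phi_nn)

lemma phi_nn_cancel: "(s :: 'n sqmat) \<in> posdef_mats \<Longrightarrow> phi_nn \<alpha> \<beta> s * (x / phi_nn \<alpha> \<beta> s) = x"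
  using phi_nn_finite phi_nn_nonzero
  by (simp add: ennreal_times_divide mult.commute[of "phi_nn \<alpha> \<beta> s"] mult_divide_eq_ennreal less_top)

text \<open>Exhibits \<open>Q_bar\<close> as the Doob transform by \<open>phi\<close> of the kernel
  with density \<open>walk_density \<alpha> \<beta> s t * exp (- trace t)\<close>, through
  \<open>1 + s^-1 t = s^-1 (s + t)\<close>.\<close>

lemma nn_integral_Q_bar:
  fixes s :: "'n sqmat"
  assumes s: "s \<in> posdef_mats" and [measurable]: "h \<in> borel_measurable borel"
  shows "(\<integral>\<^sup>+t. h t \<partial>Q_bar \<alpha> \<beta> s)
    = (\<integral>\<^sup>+t. ennreal (walk_density \<alpha> \<beta> s t * exp (- trace t)) * (phi_nn \<alpha> \<beta> t * h t) \<partial>posdef_mu) / phi_nn \<alpha> \<beta> s"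
proof -
  let ?q = "\<lambda>t. phi \<alpha> \<beta> t / phi \<alpha> \<beta> s * inverse (matrix_Beta TYPE('n) \<alpha> \<beta>) * det (matrix_inv s ** t) powr \<alpha> *
        det (mat 1 + matrix_inv s ** t) powr (- (\<alpha> + \<beta>)) * exp (- trace t)"
  let ?w = "\<lambda>t. walk_density \<alpha> \<beta> s t * exp (- trace t)"
  have q: "?q t = ?w t * phi \<alpha> \<beta> t / phi \<alpha> \<beta> s" if t: "t \<in> posdef_mats" for t
  proof -
    have inv: "invertible s" using s by (rule posdef_invertible)
    have pos: "det s > 0" "det t > 0" "det (s + t) > 0" using s t posdef_det_pos posdef_add by blast+
    have "mat 1 + matrix_inv s ** t = matrix_inv s ** (s + t)"
      using inv by (simp add: matrix_add_ldistrib invertible_matrix_inv)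
    then have det: "det (mat 1 + matrix_inv s ** t) = det (s + t) / det s"
      "det (matrix_inv s ** t) = det t / det s"
      using inv by (simp_all add: det_mul det_matrix_inv field_simps)
    have "det (matrix_inv s ** t) powr \<alpha> * det (mat 1 + matrix_inv s ** t) powr (- (\<alpha> + \<beta>))
        = det s powr \<beta> * det t powr \<alpha> * det (s + t) powr (- (\<alpha> + \<beta>))"
      unfolding det using pos by (simp add: powr_def ln_div exp_add[symmetric] algebra_simps)
    then show ?thesis unfolding walk_density_def by (simp add: mult.assoc)
  qed
  have "(\<integral>\<^sup>+t. h t \<partial>Q_bar \<alpha> \<beta> s) = (\<integral>\<^sup>+t. ennreal (?q t) * h t \<partial>posdef_mu)"
    unfolding Q_bar_def by (subst nn_integral_density) (auto intro!: borel_measurable_posdef_mu)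
  also have "\<dots> = (\<integral>\<^sup>+t. ennreal (?w t) * (phi_nn \<alpha> \<beta> t * h t) / phi_nn \<alpha> \<beta> s \<partial>posdef_mu)"
  proof (rule nn_integral_cong)
    fix t :: "'n sqmat" assume "t \<in> space posdef_mu"
    then have t: "t \<in> posdef_mats" by simp
    have "ennreal (?q t) = ennreal (?w t) * phi_nn \<alpha> \<beta> t / phi_nn \<alpha> \<beta> s"
      unfolding q[OF t] ennreal_phi[OF t, symmetric] ennreal_phi[OF s, symmetric]
      using phi_pos[OF t] phi_pos[OF s] walk_density_nonneg[of s t]
      by (simp add: divide_ennreal[symmetric] ennreal_mult)
    then show "ennreal (?q t) * h t = ennreal (?w t) * (phi_nn \<alpha> \<beta> t * h t) / phi_nn \<alpha> \<beta> s"
      by (simp add: divide_ennreal_def ac_simps)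
  qed
  also have "\<dots> = (\<integral>\<^sup>+t. ennreal (?w t) * (phi_nn \<alpha> \<beta> t * h t) \<partial>posdef_mu) / phi_nn \<alpha> \<beta> s"
    by (rule nn_integral_divide, rule borel_measurable_posdef_mu) measurable
  finally show ?thesis .
qed

text \<open>The conditional law of \<open>A(n)\<^sup>-\<^sup>1\<close> given \<open>S(n)\<close>, as an operator on functions of \<open>(S(n), A(n)\<^sup>-\<^sup>1)\<close>.\<close>

definition cond_law :: "('n sqmat \<Rightarrow> 'n sqmat \<Rightarrow> ennreal) \<Rightarrow> 'n sqmat \<Rightarrow> ennreal" where
  "cond_law G s = (\<integral>\<^sup>+z. ennreal (phi_density \<alpha> \<beta> s z) * G s z \<partial>posdef_mu) / phi_nn \<alpha> \<beta> s"

text \<open>The transition operator of the Markov chain \<open>(S(n), A(n)\<^sup>-\<^sup>1)\<close>. In the state \<open>(s, b)\<close> one has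
  \<open>A(n - 1)\<^sup>-\<^sup>1 = b + s\<close>, which determines \<open>R(n) = A(n) - A(n - 1)\<close>.\<close>

definition step_law :: "('n sqmat \<Rightarrow> 'n sqmat \<Rightarrow> ennreal) \<Rightarrow> 'n sqmat \<Rightarrow> 'n sqmat \<Rightarrow> ennreal" where
  "step_law G s b = (\<integral>\<^sup>+x. (let b' = next_inv_sum (matrix_inv b - matrix_inv (b + s)) b x in G (b - b') b')
    \<partial>matrix_beta_II \<alpha> \<beta>)"

lemma borel_measurable_cond_law:
  assumes [measurable]: "(\<lambda>(t, z). G t z) \<in> borel_measurable (borel \<Otimes>\<^sub>M borel)"
  shows "cond_law G \<in> borel_measurable borel"
proof -
  have "(\<lambda>s. \<integral>\<^sup>+z. ennreal (phi_density \<alpha> \<beta> s z) * G s z \<partial>posdef_mu) \<in> borel_measurable borel"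
    by (intro borel_measurable_nn_integral_posdef_mu) measurable
  then show ?thesis unfolding cond_law_def by measurable
qed

lemma borel_measurable_step_law:
  assumes [measurable]: "(\<lambda>(t, z). G t z) \<in> borel_measurable (borel \<Otimes>\<^sub>M borel)"
  shows "(\<lambda>(s, b). step_law G s b) \<in> borel_measurable (borel \<Otimes>\<^sub>M borel)"
proof -
  interpret B: prob_space "matrix_beta_II \<alpha> \<beta> :: 'n sqmat measure" by (rule prob_beta)
  let ?f = "\<lambda>(p, x). (let b' = next_inv_sum (matrix_inv (snd p) - matrix_inv (snd p + fst p)) (snd p) x
    in G (snd p - b') b')"
  have f: "?f \<in> borel_measurable ((borel \<Otimes>\<^sub>M borel) \<Otimes>\<^sub>M borel)"
    unfolding Let_def by measurable
  have "(\<lambda>q. (fst q, snd q)) \<in> measurable ((borel \<Otimes>\<^sub>M borel) \<Otimes>\<^sub>M (matrix_beta_II \<alpha> \<beta> :: 'n sqmat measure))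
      (((borel :: 'n sqmat measure) \<Otimes>\<^sub>M (borel :: 'n sqmat measure)) \<Otimes>\<^sub>M borel)"
    by (intro measurable_Pair measurable_fst measurable_compose[OF measurable_snd])
      (simp cong: measurable_cong_sets add: matrix_beta_II_def measurable_restrict_space1)
  from measurable_compose[OF this f]
  have "?f \<in> borel_measurable ((borel \<Otimes>\<^sub>M borel) \<Otimes>\<^sub>M (matrix_beta_II \<alpha> \<beta> :: 'n sqmat measure))" by simp
  then have "(\<lambda>p. \<integral>\<^sup>+x. ?f (p, x) \<partial>matrix_beta_II \<alpha> \<beta>) \<in> borel_measurable (borel \<Otimes>\<^sub>M borel)"
    by (rule B.borel_measurable_nn_integral_fst)
  then show ?thesis by (simp add: step_law_def case_prod_unfold)
qed

lemma step_law_le_1: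
  assumes "\<And>t z. G t z \<le> 1"
  shows "step_law G s b \<le> 1"
proof -
  have "step_law G s b \<le> (\<integral>\<^sup>+x. 1 \<partial>(matrix_beta_II \<alpha> \<beta> :: 'n sqmat measure))"
    unfolding step_law_def Let_def by (intro nn_integral_mono assms)
  also have "\<dots> = 1" using prob_space.emeasure_space_1[OF prob_beta] by simp
  finally show ?thesis .
qed

lemma cond_law_const:
  assumes s: "s \<in> posdef_mats"
  shows "cond_law (\<lambda>t z. f t) s = f s"
proof -
  have "(\<lambda>z. ennreal (phi_density \<alpha> \<beta> s z)) \<in> borel_measurable posdef_mu"
    by (rule borel_measurable_posdef_mu) measurable
  then have "cond_law (\<lambda>t z. f t) s = phi_nn \<alpha> \<beta> s * f s / phi_nn \<alpha> \<beta> s"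
    unfolding cond_law_def phi_nn_def by (simp add: nn_integral_multc)
  then show ?thesis using phi_nn_cancel[OF s, of "f s"] by (simp add: ennreal_times_divide)
qed

lemma cond_law_mult:
  assumes s: "s \<in> posdef_mats" and [measurable]: "(\<lambda>(t, z). G t z) \<in> borel_measurable (borel \<Otimes>\<^sub>M borel)"
  shows "cond_law (\<lambda>t z. f t * G t z) s = f s * cond_law G s"
proof -
  have "(\<lambda>z. ennreal (phi_density \<alpha> \<beta> s z) * G s z) \<in> borel_measurable posdef_mu"
    by (rule borel_measurable_posdef_mu) measurable
  then show ?thesis
    unfolding cond_law_def by (simp add: mult.left_commute[of _ "f s"] nn_integral_cmult ennreal_times_divide)
qed

lemma cond_law_le_1:
  assumes "s \<in> posdef_mats" "\<And>t z. G t z \<le> 1"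
  shows "cond_law G s \<le> 1"
proof -
  have "cond_law G s \<le> cond_law (\<lambda>_ _. 1) s"
    unfolding cond_law_def using assms(2)
    by (intro divide_right_mono_ennreal nn_integral_mono mult_left_mono) auto
  then show ?thesis using cond_law_const[OF assms(1), of "\<lambda>_. 1"] by simp
qed

text \<open>After the change to \<open>(t, z)\<close> the joint density splits by
  \<open>intertwining_densities\<close>. Integrating out \<open>z\<close> gives
  \<open>phi_nn \<alpha> \<beta> t * cond_law G t\<close>, and this \<open>phi_nn\<close> is the
  numerator of the Doob transform.\<close>

lemma cond_law_intertwines:
  assumes s: "s \<in> posdef_mats" and G [measurable]: "(\<lambda>(t, z). G t z) \<in> borel_measurable (borel \<Otimes>\<^sub>M borel)"
  shows "cond_law (step_law G) s = (\<integral>\<^sup>+t. cond_law G t \<partial>Q_bar \<alpha> \<beta> s)"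
proof -
  let ?r = "\<lambda>b. matrix_inv b - matrix_inv (b + s)"
  note borel_measurable_cond_law[OF G, measurable]
  have "(\<integral>\<^sup>+b. ennreal (phi_density \<alpha> \<beta> s b) * step_law G s b \<partial>posdef_mu)
    = (\<integral>\<^sup>+t. \<integral>\<^sup>+z. ennreal (phi_density \<alpha> \<beta> s (z + t)) *
        ennreal (walk_density \<alpha> \<beta> (?r (z + t)) (matrix_inv z - matrix_inv (z + t))) * G t z \<partial>posdef_mu \<partial>posdef_mu)"
    unfolding step_law_def Let_def by (rule nn_integral_step) (measurable, rule posdef_inv_diff(2)[OF _ s])
  also have "\<dots> = (\<integral>\<^sup>+t. \<integral>\<^sup>+z. ennreal (walk_density \<alpha> \<beta> s t * exp (- trace t)) *
      (ennreal (phi_density \<alpha> \<beta> t z) * G t z) \<partial>posdef_mu \<partial>posdef_mu)"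
  proof (intro nn_integral_cong)
    fix t z :: "'n sqmat" assume "t \<in> space posdef_mu" "z \<in> space posdef_mu"
    then have tz: "t \<in> posdef_mats" "z \<in> posdef_mats" by auto
    have "ennreal (phi_density \<alpha> \<beta> s (z + t)) *
        ennreal (walk_density \<alpha> \<beta> (?r (z + t)) (matrix_inv z - matrix_inv (z + t)))
      = ennreal (walk_density \<alpha> \<beta> s t * exp (- trace t) * phi_density \<alpha> \<beta> t z)"
      unfolding intertwining_densities[OF s tz, symmetric]
      by (simp add: ennreal_mult phi_density_nonneg walk_density_nonneg)
    also have "\<dots> = ennreal (walk_density \<alpha> \<beta> s t * exp (- trace t)) * ennreal (phi_density \<alpha> \<beta> t z)"
      by (simp add: ennreal_mult phi_density_nonneg walk_density_nonneg)
    finally show "ennreal (phi_density \<alpha> \<beta> s (z + t)) *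
        ennreal (walk_density \<alpha> \<beta> (?r (z + t)) (matrix_inv z - matrix_inv (z + t))) * G t z =
        ennreal (walk_density \<alpha> \<beta> s t * exp (- trace t)) * (ennreal (phi_density \<alpha> \<beta> t z) * G t z)"
      by (simp add: mult.assoc)
  qed
  also have "\<dots> = (\<integral>\<^sup>+t. ennreal (walk_density \<alpha> \<beta> s t * exp (- trace t)) * (phi_nn \<alpha> \<beta> t * cond_law G t) \<partial>posdef_mu)"
  proof (rule nn_integral_cong)
    fix t :: "'n sqmat" assume "t \<in> space posdef_mu"
    then have t: "t \<in> posdef_mats" by simp
    have "(\<lambda>z. ennreal (phi_density \<alpha> \<beta> t z) * G t z) \<in> borel_measurable posdef_mu"
      by (rule borel_measurable_posdef_mu) measurable
    then show "(\<integral>\<^sup>+z. ennreal (walk_density \<alpha> \<beta> s t * exp (- trace t)) * (ennreal (phi_density \<alpha> \<beta> t z) * G t z) \<partial>posdef_mu)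
      = ennreal (walk_density \<alpha> \<beta> s t * exp (- trace t)) * (phi_nn \<alpha> \<beta> t * cond_law G t)"
      unfolding cond_law_def phi_nn_cancel[OF t] by (rule nn_integral_cmult)
  qed
  finally show ?thesis
    by (simp add: cond_law_def[of "step_law G"] nn_integral_Q_bar[OF s])
qed

lemma borel_measurable_initial_step:
  assumes [measurable]: "(\<lambda>(t, z). G t z) \<in> borel_measurable (borel \<Otimes>\<^sub>M borel)"
  shows "(\<lambda>r :: 'n sqmat. \<integral>\<^sup>+x. (let b = next_inv_sum r (matrix_inv r) x in G (matrix_inv r - b) b)
      \<partial>matrix_beta_II \<alpha> \<beta>) \<in> borel_measurable borel"
proof -
  interpret B: prob_space "matrix_beta_II \<alpha> \<beta> :: 'n sqmat measure" by (rule prob_beta)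
  let ?f = "\<lambda>(r, x). let b = next_inv_sum r (matrix_inv r) x in G (matrix_inv r - b) b"
  have f: "?f \<in> borel_measurable (borel \<Otimes>\<^sub>M borel)" unfolding Let_def by measurable
  have "(\<lambda>q. (fst q, snd q)) \<in> measurable (borel \<Otimes>\<^sub>M (matrix_beta_II \<alpha> \<beta> :: 'n sqmat measure))
      ((borel :: 'n sqmat measure) \<Otimes>\<^sub>M borel)"
    by (intro measurable_Pair measurable_fst measurable_compose[OF measurable_snd])
      (simp cong: measurable_cong_sets add: matrix_beta_II_def measurable_restrict_space1)
  from measurable_compose[OF this f]
  have "?f \<in> borel_measurable (borel \<Otimes>\<^sub>M (matrix_beta_II \<alpha> \<beta> :: 'n sqmat measure))" by simp
  from B.borel_measurable_nn_integral_fst[OF this] show ?thesis by simp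
  qed

text \<open>The law of the pair at time 1: against \<open>posdef_mu\<close>, \<open>S 1\<close> has
  density proportional to \<open>det t powr \<alpha> * exp (- trace t) * phi \<alpha> \<beta>
  t\<close>, and given \<open>S 1 = t\<close> the second component is averaged by
  \<open>cond_law\<close>.\<close>

lemma nn_integral_initial_step:
  assumes G [measurable]: "(\<lambda>(t, z). G t z) \<in> borel_measurable (borel \<Otimes>\<^sub>M borel)"
  shows "(\<integral>\<^sup>+r. (\<integral>\<^sup>+x. (let b = next_inv_sum r (matrix_inv r) x in G (matrix_inv r - b) b)
      \<partial>matrix_beta_II \<alpha> \<beta>) \<partial>inverse_wishart \<beta>)
    = (\<integral>\<^sup>+t. ennreal (inverse (matrix_Gamma TYPE('n) \<beta>) * (inverse (matrix_Beta TYPE('n) \<alpha> \<beta>) *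
        det t powr \<alpha> * exp (- trace t))) * (phi_nn \<alpha> \<beta> t * cond_law G t) \<partial>posdef_mu)"
proof -
  let ?c = "inverse (matrix_Gamma TYPE('n) \<beta>)" and ?d = "inverse (matrix_Beta TYPE('n) \<alpha> \<beta>)"
  let ?w = "\<lambda>b :: 'n sqmat. ennreal (?c * (det b powr \<beta> * exp (- trace b)))"
  let ?v = "\<lambda>t :: 'n sqmat. ?c * (?d * det t powr \<alpha> * exp (- trace t))"
  let ?I = "\<lambda>r. \<integral>\<^sup>+x. (let b = next_inv_sum r (matrix_inv r) x in G (matrix_inv r - b) b) \<partial>matrix_beta_II \<alpha> \<beta>"
  have I: "?I \<in> borel_measurable borel" by (rule borel_measurable_initial_step[OF G])
  have "(\<integral>\<^sup>+r. ?I r \<partial>inverse_wishart \<beta>) = (\<integral>\<^sup>+b. ?w b * ?I (matrix_inv b) \<partial>posdef_mu)"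
    by (rule nn_integral_inverse_wishart[OF I])
  also have "\<dots> = (\<integral>\<^sup>+b. ?w b * (\<integral>\<^sup>+x. G (b - next_inv_sum (matrix_inv b) b x) (next_inv_sum (matrix_inv b) b x)
      \<partial>matrix_beta_II \<alpha> \<beta>) \<partial>posdef_mu)"
    by (rule nn_integral_cong) (simp add: Let_def matrix_inv_inv posdef_invertible)
  also have "\<dots> = (\<integral>\<^sup>+t. \<integral>\<^sup>+z. ?w (z + t) *
      ennreal (walk_density \<alpha> \<beta> (matrix_inv (z + t)) (matrix_inv z - matrix_inv (z + t))) * G t z \<partial>posdef_mu \<partial>posdef_mu)"
    by (rule nn_integral_step) (measurable, rule posdef_inv)
  also have "\<dots> = (\<integral>\<^sup>+t. \<integral>\<^sup>+z. ennreal (?v t) * (ennreal (phi_density \<alpha> \<beta> t z) * G t z) \<partial>posdef_mu \<partial>posdef_mu)"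
  proof (intro nn_integral_cong)
    fix t z :: "'n sqmat" assume "t \<in> space posdef_mu" "z \<in> space posdef_mu"
    then have tz: "t \<in> posdef_mats" "z \<in> posdef_mats" by auto
    have "?w (z + t) * ennreal (walk_density \<alpha> \<beta> (matrix_inv (z + t)) (matrix_inv z - matrix_inv (z + t)))
      = ennreal (?c * ((det (z + t) powr \<beta> * exp (- trace (z + t))) *
          walk_density \<alpha> \<beta> (matrix_inv (z + t)) (matrix_inv z - matrix_inv (z + t))))"
      using inverse_Gamma_pos by (simp add: ennreal_mult[symmetric] walk_density_nonneg mult.assoc)
    also have "\<dots> = ennreal (?v t * phi_density \<alpha> \<beta> t z)"
      unfolding initial_densities[OF tz] by (simp add: mult.assoc)
    also have "\<dots> = ennreal (?v t) * ennreal (phi_density \<alpha> \<beta> t z)"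
      by (rule ennreal_mult'') (rule phi_density_nonneg)
    finally show "?w (z + t) * ennreal (walk_density \<alpha> \<beta> (matrix_inv (z + t)) (matrix_inv z - matrix_inv (z + t))) * G t z
      = ennreal (?v t) * (ennreal (phi_density \<alpha> \<beta> t z) * G t z)"
      by (simp add: mult.assoc)
  qed
  also have "\<dots> = (\<integral>\<^sup>+t. ennreal (?v t) * (phi_nn \<alpha> \<beta> t * cond_law G t) \<partial>posdef_mu)"
  proof (rule nn_integral_cong)
    fix t :: "'n sqmat" assume "t \<in> space posdef_mu"
    then have t: "t \<in> posdef_mats" by simp
    have "(\<lambda>z. ennreal (phi_density \<alpha> \<beta> t z) * G t z) \<in> borel_measurable posdef_mu"
      by (rule borel_measurable_posdef_mu) measurable
    then show "(\<integral>\<^sup>+z. ennreal (?v t) * (ennreal (phi_density \<alpha> \<beta> t z) * G t z) \<partial>posdef_mu)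
      = ennreal (?v t) * (phi_nn \<alpha> \<beta> t * cond_law G t)"
      unfolding cond_law_def phi_nn_cancel[OF t] by (rule nn_integral_cmult)
  qed
  finally show ?thesis .
qed

section \<open>\<open>Q_bar\<close> as a probability kernel\<close>

lemma sets_Q_bar [simp]: "sets (Q_bar \<alpha> \<beta> (s :: 'n sqmat)) = sets posdef_borel"
  by (simp add: Q_bar_def posdef_borel_def)

lemma space_Q_bar [simp]: "space (Q_bar \<alpha> \<beta> (s :: 'n sqmat)) = posdef_mats"
  by (simp add: Q_bar_def)

lemma space_posdef_borel [simp]: "space posdef_borel = (posdef_mats :: 'n sqmat set)"
  by (simp add: posdef_borel_def space_restrict_space)

lemma sets_posdef_borelD: "B \<in> sets posdef_borel \<Longrightarrow> B \<in> sets (borel :: 'n sqmat measure)"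
  unfolding posdef_borel_def by (subst (asm) sets_restrict_space_iff) auto

text \<open>Both \<open>step_law\<close> and \<open>cond_law\<close> preserve the constant 1, so the
  intertwining relation at the constant 1 says that the total mass is one.\<close>

lemma prob_space_Q_bar:
  assumes s: "(s :: 'n sqmat) \<in> posdef_mats"
  shows "prob_space (Q_bar \<alpha> \<beta> s)"
proof
  have step: "step_law (\<lambda>_ _. 1) = (\<lambda>_ _. 1)"
    unfolding step_law_def Let_def using prob_space.emeasure_space_1[OF prob_beta] by simp
  have "emeasure (Q_bar \<alpha> \<beta> s) (space (Q_bar \<alpha> \<beta> s)) = (\<integral>\<^sup>+t. 1 \<partial>Q_bar \<alpha> \<beta> s)" by simp
  also have "\<dots> = (\<integral>\<^sup>+t. cond_law (\<lambda>_ _. 1) t \<partial>Q_bar \<alpha> \<beta> s)"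
    by (intro nn_integral_cong) (simp add: cond_law_const)
  also have "\<dots> = cond_law (step_law (\<lambda>_ _. 1)) s"
    by (rule cond_law_intertwines[OF s, symmetric]) simp
  also have "\<dots> = 1" unfolding step by (rule cond_law_const[OF s])
  finally show "emeasure (Q_bar \<alpha> \<beta> s) (space (Q_bar \<alpha> \<beta> s)) = 1" .
qed

lemma emeasure_Q_bar:
  assumes s: "(s :: 'n sqmat) \<in> posdef_mats" and B: "B \<in> sets posdef_borel"
  shows "emeasure (Q_bar \<alpha> \<beta> s) B = (\<integral>\<^sup>+t. ennreal (walk_density \<alpha> \<beta> s t * exp (- trace t)) *
    (phi_nn \<alpha> \<beta> t * indicator B t) \<partial>posdef_mu) / phi_nn \<alpha> \<beta> s"
proof -
  have [measurable]: "B \<in> sets borel" using B by (rule sets_posdef_borelD)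
  have "emeasure (Q_bar \<alpha> \<beta> s) B = (\<integral>\<^sup>+t. indicator B t \<partial>Q_bar \<alpha> \<beta> s)" using B by simp
  also have "\<dots> = (\<integral>\<^sup>+t. ennreal (walk_density \<alpha> \<beta> s t * exp (- trace t)) *
      (phi_nn \<alpha> \<beta> t * indicator B t) \<partial>posdef_mu) / phi_nn \<alpha> \<beta> s"
    by (rule nn_integral_Q_bar[OF s]) measurable
  finally show ?thesis .
qed

lemma measurable_Q_bar:
  "Q_bar \<alpha> \<beta> \<in> measurable (posdef_borel :: 'n sqmat measure) (prob_algebra posdef_borel)"
proof (intro measurable_prob_algebraI measurable_subprob_algebra)
  fix B :: "'n sqmat set" assume B: "B \<in> sets posdef_borel"
  then have [measurable]: "B \<in> sets borel" by (rule sets_posdef_borelD)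
  have "(\<lambda>s. \<integral>\<^sup>+t. ennreal (walk_density \<alpha> \<beta> s t * exp (- trace t)) * (phi_nn \<alpha> \<beta> t * indicator B t) \<partial>posdef_mu)
      \<in> borel_measurable (borel :: 'n sqmat measure)"
    by (intro borel_measurable_nn_integral_posdef_mu) measurable
  then have "(\<lambda>s. (\<integral>\<^sup>+t. ennreal (walk_density \<alpha> \<beta> s t * exp (- trace t)) * (phi_nn \<alpha> \<beta> t * indicator B t) \<partial>posdef_mu)
      / phi_nn \<alpha> \<beta> s) \<in> borel_measurable posdef_borel"
    unfolding posdef_borel_def by (intro measurable_restrict_space1) measurable
  then show "(\<lambda>s. emeasure (Q_bar \<alpha> \<beta> s) B) \<in> borel_measurable posdef_borel"
    by (subst measurable_cong[OF emeasure_Q_bar[OF _ B]]) auto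
qed (auto intro: prob_space_Q_bar prob_space_imp_subprob_space)

end

section \<open>The random walk\<close>

lemma measurable_posdef_borel_id: "(\<lambda>x :: 'n::finite sqmat. x) \<in> measurable posdef_borel borel"
  unfolding posdef_borel_def by (intro measurable_restrict_space1) simp

lemma measurable_posdef_borelI:
  fixes f :: "'a \<Rightarrow> 'n::finite sqmat"
  assumes "f \<in> borel_measurable M" "\<And>x. x \<in> space M \<Longrightarrow> f x \<in> posdef_mats"
  shows "f \<in> measurable M posdef_borel"
  unfolding posdef_borel_def using assms by (intro measurable_restrict_space2) auto

locale beta_walk = walk_parameters \<alpha> \<beta> T + prob_space M
  for \<alpha> \<beta> :: real and T :: "'n::{finite,linorder} itself" and M :: "'a measure" +
  fixes R X A S :: "nat \<Rightarrow> 'a \<Rightarrow> 'n sqmat"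
  assumes R0_meas: "R 0 \<in> measurable M posdef_borel"
    and X_meas: "\<And>n. n \<ge> 1 \<Longrightarrow> X n \<in> measurable M posdef_borel"
    and indep: "indep_vars (\<lambda>_. posdef_borel) (\<lambda>n. if n = 0 then R 0 else X n) UNIV"
    and R0_law: "distr M posdef_borel (R 0) = inverse_wishart \<beta>"
    and X_law: "\<And>n. n \<ge> 1 \<Longrightarrow> distr M posdef_borel (X n) = matrix_beta_II \<alpha> \<beta>"
    and R_rec: "\<And>n \<omega>. n \<ge> 1 \<Longrightarrow> \<omega> \<in> space M \<Longrightarrow>
           R n \<omega> = mat_sqrt (R (n - 1) \<omega>) ** X n \<omega> ** mat_sqrt (R (n - 1) \<omega>)"
    and A_def: "\<And>n \<omega>. \<omega> \<in> space M \<Longrightarrow> A n \<omega> = (\<Sum>k=0..n. R k \<omega>)"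
    and S_def: "\<And>n \<omega>. n \<ge> 1 \<Longrightarrow> \<omega> \<in> space M \<Longrightarrow>
           S n \<omega> = matrix_inv (A (n - 1) \<omega>) ** R n \<omega> ** matrix_inv (A n \<omega>)"
begin

definition Y :: "nat \<Rightarrow> 'a \<Rightarrow> 'n sqmat" where
  "Y n = (if n = 0 then R 0 else X n)"

definition b :: "nat \<Rightarrow> 'a \<Rightarrow> 'n sqmat" where
  "b n \<omega> = matrix_inv (A n \<omega>)"

text \<open>The history of the walk itself, generated by \<open>R 0, X 1, ..., X n\<close>. It
  contains \<open>filt n\<close> and makes \<open>b n\<close> measurable, and
  \<open>X (n + 1)\<close> is independent of it.\<close>

definition hist :: "nat \<Rightarrow> 'a measure" where
  "hist n = vimage_algebra (space M) (\<lambda>\<omega>. \<lambda>i\<in>{..n}. Y i \<omega>) (PiM {..n} (\<lambda>_. posdef_borel))"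

definition filt :: "nat \<Rightarrow> 'a measure" where
  "filt n = natural_filtration M 1 posdef_borel S n"

lemma R_Suc: "\<omega> \<in> space M \<Longrightarrow> R (Suc n) \<omega> = mat_sqrt (R n \<omega>) ** X (Suc n) \<omega> ** mat_sqrt (R n \<omega>)"
  using R_rec[of "Suc n"] by simp

lemma R_posdef: "\<omega> \<in> space M \<Longrightarrow> R n \<omega> \<in> posdef_mats"
proof (induction n)
  case 0
  then show ?case using measurable_space[OF R0_meas] by simp
next
  case (Suc n)
  have "X (Suc n) \<omega> \<in> posdef_mats" using measurable_space[OF X_meas, of "Suc n" \<omega>] Suc.prems by simp
  moreover have "mat_sqrt (R n \<omega>) \<in> posdef_mats" using Suc by (intro mat_sqrt)
  ultimately show ?case
    unfolding R_Suc[OF Suc.prems] by (metis posdef_congruence posdef_invertible posdef_matsD(1))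
qed

lemma A_0: "\<omega> \<in> space M \<Longrightarrow> A 0 \<omega> = R 0 \<omega>"
  and A_Suc: "\<omega> \<in> space M \<Longrightarrow> A (Suc n) \<omega> = A n \<omega> + R (Suc n) \<omega>"
  by (simp_all add: A_def)

lemma A_posdef: "\<omega> \<in> space M \<Longrightarrow> A n \<omega> \<in> posdef_mats"
  by (induction n) (simp_all add: A_0 A_Suc R_posdef posdef_add)

lemma inv_b: "\<omega> \<in> space M \<Longrightarrow> matrix_inv (b n \<omega>) = A n \<omega>"
  by (simp add: b_def matrix_inv_inv posdef_invertible A_posdef)

lemma S_Suc: "\<omega> \<in> space M \<Longrightarrow> S (Suc n) \<omega> = b n \<omega> - b (Suc n) \<omega>"
  using S_def[of "Suc n" \<omega>] posdef_inv_diff(1)[OF A_posdef[of \<omega> n] R_posdef[of \<omega> "Suc n"]]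
  by (simp add: b_def A_Suc)

lemma S_posdef: "\<omega> \<in> space M \<Longrightarrow> S (Suc n) \<omega> \<in> posdef_mats"
  using posdef_inv_diff(2)[OF A_posdef[of \<omega> n] R_posdef[of \<omega> "Suc n"]] by (simp add: S_Suc b_def A_Suc)

lemma b_Suc: "\<omega> \<in> space M \<Longrightarrow> b (Suc n) \<omega> = next_inv_sum (R n \<omega>) (b n \<omega>) (X (Suc n) \<omega>)"
  unfolding next_inv_sum_def by (simp add: inv_b b_def[of "Suc n"] A_Suc R_Suc)

lemma b_0: "\<omega> \<in> space M \<Longrightarrow> b 0 \<omega> = matrix_inv (R 0 \<omega>)"
  by (simp add: b_def A_0)

lemma R_Suc_of_b: "\<omega> \<in> space M \<Longrightarrow>
    R (Suc n) \<omega> = matrix_inv (b (Suc n) \<omega>) - matrix_inv (b (Suc n) \<omega> + S (Suc n) \<omega>)"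
  by (simp add: S_Suc inv_b A_Suc)

lemma Y_meas: "Y i \<in> measurable M posdef_borel"
  unfolding Y_def using R0_meas X_meas by auto

lemma Y_vec_meas: "(\<lambda>\<omega>. \<lambda>i\<in>{..n}. Y i \<omega>) \<in> measurable M (PiM {..n} (\<lambda>_. posdef_borel))"
  using Y_meas by (intro measurable_restrict)

section \<open>History of the walk and independence of the next increment\<close>

lemma space_hist [simp]: "space (hist n) = space M"
  by (simp add: hist_def)

lemma sets_hist: "sets (hist n) = {(\<lambda>\<omega>. \<lambda>i\<in>{..n}. Y i \<omega>) -` B \<inter> space M | B. B \<in> sets (PiM {..n} (\<lambda>_. posdef_borel))}"
  unfolding hist_def using measurable_space[OF Y_vec_meas] by (intro sets_vimage_algebra2) auto

lemma sets_hist_subset: "sets (hist n) \<subseteq> sets M"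
  unfolding sets_hist using measurable_sets[OF Y_vec_meas] by auto

lemma hist_imp_measurable: "f \<in> measurable (hist n) N \<Longrightarrow> f \<in> measurable M N"
  using sets_hist_subset by (auto simp: measurable_def)

lemma Y_hist: "i \<le> n \<Longrightarrow> Y i \<in> borel_measurable (hist n)"
proof -
  assume i: "i \<le> n"
  have "(\<lambda>\<omega>. \<lambda>i\<in>{..n}. Y i \<omega>) \<in> measurable (hist n) (PiM {..n} (\<lambda>_. posdef_borel))"
    unfolding hist_def using measurable_space[OF Y_vec_meas] by (intro measurable_vimage_algebra1) auto
  from measurable_compose[OF this measurable_component_singleton, of i] i
  have "Y i \<in> measurable (hist n) posdef_borel" by simp
  from measurable_compose[OF this measurable_posdef_borel_id] show ?thesis by simp
qed

lemma R_hist: "k \<le> n \<Longrightarrow> R k \<in> borel_measurable (hist n)"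
proof (induction k)
  case 0
  then show ?case using Y_hist[of 0 n] by (simp add: Y_def)
next
  case (Suc k)
  then have [measurable]: "R k \<in> borel_measurable (hist n)" "X (Suc k) \<in> borel_measurable (hist n)"
    using Y_hist[of "Suc k" n] by (simp_all add: Y_def)
  have "(\<lambda>\<omega>. mat_sqrt (R k \<omega>) ** X (Suc k) \<omega> ** mat_sqrt (R k \<omega>)) \<in> borel_measurable (hist n)"
    by measurable
  then show ?case by (subst measurable_cong[where g = "\<lambda>\<omega>. mat_sqrt (R k \<omega>) ** X (Suc k) \<omega> ** mat_sqrt (R k \<omega>)"])
    (simp_all add: R_Suc)
qed

lemma b_hist: "k \<le> n \<Longrightarrow> b k \<in> borel_measurable (hist n)"
proof -
  assume "k \<le> n"
  then have "(\<lambda>\<omega>. \<Sum>j=0..k. R j \<omega>) \<in> borel_measurable (hist n)"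
    using R_hist by (intro borel_measurable_sum) auto
  then have "A k \<in> borel_measurable (hist n)"
    by (subst measurable_cong[where g = "\<lambda>\<omega>. \<Sum>j=0..k. R j \<omega>"]) (simp_all add: A_def)
  then show ?thesis unfolding b_def[abs_def] by measurable
qed

lemma S_hist: "Suc k \<le> n \<Longrightarrow> S (Suc k) \<in> measurable (hist n) posdef_borel"
proof (rule measurable_posdef_borelI)
  assume "Suc k \<le> n"
  then have "(\<lambda>\<omega>. b k \<omega> - b (Suc k) \<omega>) \<in> borel_measurable (hist n)"
    using b_hist[of k n] b_hist[of "Suc k" n] by simp
  then show "S (Suc k) \<in> borel_measurable (hist n)"
    by (subst measurable_cong[where g = "\<lambda>\<omega>. b k \<omega> - b (Suc k) \<omega>"]) (simp_all add: S_Suc)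
qed (simp add: S_posdef)

lemma S_hist_borel: "Suc k \<le> n \<Longrightarrow> S (Suc k) \<in> borel_measurable (hist n)"
  using measurable_compose[OF S_hist measurable_posdef_borel_id] by simp

lemma S_meas: "k \<ge> 1 \<Longrightarrow> S k \<in> measurable M posdef_borel"
  using hist_imp_measurable[OF S_hist[of "k - 1" k]] by simp

text \<open>By independence the history and \<open>X (n + 1)\<close> have a product law, so the
  increment can be integrated out with the history held fixed.\<close>

lemma nn_integral_fresh:
  assumes f: "(\<lambda>(\<omega>, x). f \<omega> x) \<in> borel_measurable (hist n \<Otimes>\<^sub>M borel)"
  shows "(\<integral>\<^sup>+\<omega>. f \<omega> (X (Suc n) \<omega>) \<partial>M) = (\<integral>\<^sup>+\<omega>. \<integral>\<^sup>+x. f \<omega> x \<partial>matrix_beta_II \<alpha> \<beta> \<partial>M)"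
proof -
  let ?N = "posdef_borel :: 'n sqmat measure"
  let ?W = "\<lambda>\<omega>. \<lambda>i\<in>{..n}. Y i \<omega>" and ?P = "PiM {..n} (\<lambda>_. ?N)"
  have ind: "indep_var ?P ?W (PiM {Suc n} (\<lambda>_. ?N)) (\<lambda>\<omega>. \<lambda>i\<in>{Suc n}. Y i \<omega>)"
    using indep_var_restrict[OF indep, of "{..n}" "{Suc n}"] by (simp add: Y_def if_distribR)
  have idm: "(\<lambda>\<omega>. \<omega>) \<in> measurable M (hist n)"
    using sets_hist_subset by (auto simp: measurable_def Int_absorb2 dest: sets.sets_into_space)
  have XN: "X (Suc n) \<in> measurable M ?N" using X_meas by simp
  \<comment> \<open>The history becomes a random element through the identity map into
    \<open>hist n\<close>; the product law is checked on rectangles.\<close>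
  have eq: "distr M (hist n) (\<lambda>\<omega>. \<omega>) \<Otimes>\<^sub>M distr M ?N (X (Suc n)) = distr M (hist n \<Otimes>\<^sub>M ?N) (\<lambda>\<omega>. (\<omega>, X (Suc n) \<omega>))"
  proof (rule pair_measure_eqI)
    show "sigma_finite_measure (distr M (hist n) (\<lambda>\<omega>. \<omega>))" "sigma_finite_measure (distr M ?N (X (Suc n)))"
      using prob_space_distr[OF idm] prob_space_distr[OF XN] prob_space_imp_sigma_finite by blast+
    fix E B assume "E \<in> sets (distr M (hist n) (\<lambda>\<omega>. \<omega>))" "B \<in> sets (distr M ?N (X (Suc n)))"
    then have E: "E \<in> sets (hist n)" and B: "B \<in> sets ?N" by auto
    from E obtain D where D: "D \<in> sets ?P" "E = ?W -` D \<inter> space M" unfolding sets_hist by blast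
    have box: "Pi\<^sub>E {Suc n} (\<lambda>_. B) \<in> sets (PiM {Suc n} (\<lambda>_. ?N))"
      using B by (intro sets_PiM_I_finite) auto
    have XB: "(\<lambda>\<omega>. \<lambda>i\<in>{Suc n}. Y i \<omega>) -` Pi\<^sub>E {Suc n} (\<lambda>_. B) \<inter> space M = X (Suc n) -` B \<inter> space M"
      by (auto simp: Y_def PiE_iff)
    have "prob (E \<inter> (X (Suc n) -` B \<inter> space M)) = prob E * prob (X (Suc n) -` B \<inter> space M)"
    proof -
      have "E \<inter> (X (Suc n) -` B \<inter> space M)
          = (\<lambda>\<omega>. (?W \<omega>, \<lambda>i\<in>{Suc n}. Y i \<omega>)) -` (D \<times> Pi\<^sub>E {Suc n} (\<lambda>_. B)) \<inter> space M"
        using XB unfolding D(2) by blast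
      then show ?thesis using indep_varD[OF ind D(1) box] unfolding XB D(2) by simp
    qed
    moreover have "(\<lambda>\<omega>. (\<omega>, X (Suc n) \<omega>)) -` (E \<times> B) \<inter> space M = E \<inter> (X (Suc n) -` B \<inter> space M)"
      "(\<lambda>\<omega>. \<omega>) -` E \<inter> space M = E"
      using sets.sets_into_space[OF E] by auto
    ultimately show "emeasure (distr M (hist n) (\<lambda>\<omega>. \<omega>)) E * emeasure (distr M ?N (X (Suc n))) B
        = emeasure (distr M (hist n \<Otimes>\<^sub>M ?N) (\<lambda>\<omega>. (\<omega>, X (Suc n) \<omega>))) (E \<times> B)"
      using E B by (simp add: emeasure_distr[OF idm] emeasure_distr[OF XN] emeasure_distr[OF measurable_Pair[OF idm XN]]
          emeasure_eq_measure ennreal_mult)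
  qed simp
  then have eq: "distr M (hist n) (\<lambda>\<omega>. \<omega>) \<Otimes>\<^sub>M matrix_beta_II \<alpha> \<beta> = distr M (hist n \<Otimes>\<^sub>M ?N) (\<lambda>\<omega>. (\<omega>, X (Suc n) \<omega>))"
    using X_law[of "Suc n"] by simp
  have fN: "(\<lambda>(\<omega>, x). f \<omega> x) \<in> borel_measurable (hist n \<Otimes>\<^sub>M ?N)"
  proof -
    have "(\<lambda>p. (fst p, snd p)) \<in> measurable (hist n \<Otimes>\<^sub>M ?N) (hist n \<Otimes>\<^sub>M borel)"
      by (intro measurable_Pair measurable_fst measurable_compose[OF measurable_snd measurable_posdef_borel_id])
    from measurable_compose[OF this f] show ?thesis by simp
  qed
  interpret B: prob_space "matrix_beta_II \<alpha> \<beta> :: 'n sqmat measure" by (rule prob_beta)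
  have sB: "sets (matrix_beta_II \<alpha> \<beta> :: 'n sqmat measure) = sets ?N"
    by (simp add: matrix_beta_II_def posdef_borel_def)
  have fB: "(\<lambda>(\<omega>, x). f \<omega> x) \<in> borel_measurable (hist n \<Otimes>\<^sub>M matrix_beta_II \<alpha> \<beta>)"
    using fN by (simp cong: measurable_cong_sets add: sB sets_pair_measure_cong[OF refl sB])
  have fD: "(\<lambda>(\<omega>, x). f \<omega> x) \<in> borel_measurable (distr M (hist n) (\<lambda>\<omega>. \<omega>) \<Otimes>\<^sub>M matrix_beta_II \<alpha> \<beta>)"
    using fB by (subst measurable_cong_sets[OF sets_pair_measure_cong[OF sets_distr refl] refl])
  have "(\<integral>\<^sup>+\<omega>. f \<omega> (X (Suc n) \<omega>) \<partial>M) = (\<integral>\<^sup>+p. (case p of (\<omega>, x) \<Rightarrow> f \<omega> x) \<partial>distr M (hist n \<Otimes>\<^sub>M ?N) (\<lambda>\<omega>. (\<omega>, X (Suc n) \<omega>)))"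
    using fN by (subst nn_integral_distr[OF measurable_Pair[OF idm XN]]) simp_all
  also have "\<dots> = (\<integral>\<^sup>+\<omega>. \<integral>\<^sup>+x. f \<omega> x \<partial>matrix_beta_II \<alpha> \<beta> \<partial>distr M (hist n) (\<lambda>\<omega>. \<omega>))"
    unfolding eq[symmetric] using B.nn_integral_fst[OF fD] by simp
  also have "\<dots> = (\<integral>\<^sup>+\<omega>. \<integral>\<^sup>+x. f \<omega> x \<partial>matrix_beta_II \<alpha> \<beta> \<partial>M)"
    using B.borel_measurable_nn_integral_fst[OF fB] by (subst nn_integral_distr[OF idm]) auto
  finally show ?thesis .
qed

section \<open>The filtration generated by S\<close>

lemma space_filt [simp]: "space (filt n) = space M"
  unfolding filt_def natural_filtration_def by (rule space_measure_of) auto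

lemma sets_filt: "sets (filt n) = sigma_sets (space M) (\<Union>k\<in>{1..n}. {S k -` B \<inter> space M | B. B \<in> sets posdef_borel})"
  unfolding filt_def natural_filtration_def by (rule sets_measure_of) auto

lemma sets_filt_subset_hist: "sets (filt n) \<subseteq> sets (hist n)"
proof -
  have "(\<Union>k\<in>{1..n}. {S k -` B \<inter> space M | B. B \<in> sets posdef_borel}) \<subseteq> sets (hist n)"
  proof clarify
    fix k B assume "k \<in> {1..n}" "B \<in> sets (posdef_borel :: 'n sqmat measure)"
    then show "S k -` B \<inter> space M \<in> sets (hist n)"
      using measurable_sets[OF S_hist[of "k - 1" n], of B] by simp
  qed
  from sets.sigma_sets_subset[OF this] show ?thesis by (simp add: sets_filt)
qed

lemma sets_filt_mono: "sets (filt n) \<subseteq> sets (filt (Suc n))"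
  unfolding sets_filt by (intro sigma_sets_mono' UN_mono) auto

lemma S_filt: "1 \<le> k \<Longrightarrow> k \<le> n \<Longrightarrow> S k \<in> measurable (filt n) posdef_borel"
proof (rule measurableI)
  assume k: "1 \<le> k" "k \<le> n"
  show "S k \<omega> \<in> space posdef_borel" if "\<omega> \<in> space (filt n)" for \<omega>
    using measurable_space[OF S_meas[OF k(1)]] that by simp
  show "S k -` B \<inter> space (filt n) \<in> sets (filt n)" if "B \<in> sets posdef_borel" for B
  proof -
    have "S k -` B \<inter> space M \<in> {S k -` B \<inter> space M | B. B \<in> sets posdef_borel}" using that by blast
    then show ?thesis unfolding sets_filt space_filt using k by (intro sigma_sets.Basic UN_I[of k]) auto
  qed
qed

text \<open>Events \<open>F \<inter> {S (n + 1) \<in> C}\<close> with \<open>F\<close> in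
  \<open>filt n\<close> form an intersection-stable generator of \<open>filt (Suc n)\<close>, so two
  densities that agree there agree throughout. The bound on \<open>f\<close> supplies the finite
  mass for uniqueness.\<close>

lemma filt_eqI:
  assumes f: "f \<in> borel_measurable M" "\<And>\<omega>. \<omega> \<in> space M \<Longrightarrow> f \<omega> \<le> 1"
    and g: "g \<in> borel_measurable M"
    and eq: "\<And>F C. F \<in> sets (filt n) \<Longrightarrow> C \<in> sets posdef_borel \<Longrightarrow>
      (\<integral>\<^sup>+\<omega>. indicator F \<omega> * (indicator C (S (Suc n) \<omega>) * f \<omega>) \<partial>M)
      = (\<integral>\<^sup>+\<omega>. indicator F \<omega> * (indicator C (S (Suc n) \<omega>) * g \<omega>) \<partial>M)"
    and E: "E \<in> sets (filt (Suc n))"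
  shows "(\<integral>\<^sup>+\<omega>. indicator E \<omega> * f \<omega> \<partial>M) = (\<integral>\<^sup>+\<omega>. indicator E \<omega> * (g \<omega> :: ennreal) \<partial>M)"
proof -
  let ?N = "posdef_borel :: 'n sqmat measure"
  let ?P = "{F \<inter> (S (Suc n) -` C \<inter> space M) | F C. F \<in> sets (filt n) \<and> C \<in> sets ?N}"
  have sub: "sets (filt (Suc n)) \<subseteq> sets M" using sets_filt_subset_hist sets_hist_subset by blast
  have P_sub: "?P \<subseteq> sets (filt (Suc n))"
  proof clarify
    fix F C assume "F \<in> sets (filt n)" "C \<in> sets ?N"
    then show "F \<inter> (S (Suc n) -` C \<inter> space M) \<in> sets (filt (Suc n))"
      using measurable_sets[OF S_filt[of "Suc n" "Suc n"], of C] sets_filt_mono[of n] by auto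
  qed
  have "sets (filt (Suc n)) = sigma_sets (space M) ?P"
  proof
    show "sigma_sets (space M) ?P \<subseteq> sets (filt (Suc n))"
      using sets.sigma_sets_subset[OF P_sub] by simp
    have "(\<Union>k\<in>{1..Suc n}. {S k -` B \<inter> space M | B. B \<in> sets ?N}) \<subseteq> sigma_sets (space M) ?P"
    proof clarify
      fix k B assume k: "k \<in> {1..Suc n}" and B: "B \<in> sets ?N"
      show "S k -` B \<inter> space M \<in> sigma_sets (space M) ?P"
      proof (cases "k = Suc n")
        case True
        have "S k -` B \<inter> space M = space M \<inter> (S (Suc n) -` B \<inter> space M)" using True by auto
        moreover have "space M \<in> sets (filt n)" using sets.top[of "filt n"] by simp
        ultimately have "S k -` B \<inter> space M \<in> ?P" using B by blast
        then show ?thesis by (rule sigma_sets.Basic)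
      next
        case False
        then have "S k -` B \<inter> space M \<in> sets (filt n)"
          using k B measurable_sets[OF S_filt[of k n] B] by simp
        moreover have "S k -` B \<inter> space M = (S k -` B \<inter> space M) \<inter> (S (Suc n) -` space ?N \<inter> space M)"
          using measurable_space[OF S_meas[of "Suc n"]] by auto
        ultimately have "S k -` B \<inter> space M \<in> ?P" by blast
        then show ?thesis by (rule sigma_sets.Basic)
      qed
    qed
    from sigma_sets_mono[OF this] show "sets (filt (Suc n)) \<subseteq> sigma_sets (space M) ?P"
      by (simp add: sets_filt)
  qed
  \<comment> \<open>The measure with density \<open>h\<close>, restricted to
    \<open>filt (Suc n)\<close> by pushing it along the identity map.\<close>
  moreover define m where "m h = distr (density M h) (filt (Suc n)) (\<lambda>\<omega>. \<omega>)" for h :: "'a \<Rightarrow> ennreal"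
  have em: "emeasure (m h) E = (\<integral>\<^sup>+\<omega>. indicator E \<omega> * h \<omega> \<partial>M)"
    if "h \<in> borel_measurable M" "E \<in> sets (filt (Suc n))" for h E
  proof -
    have "(\<lambda>\<omega>. \<omega>) \<in> measurable (density M h) (filt (Suc n))"
      using sub by (auto simp: measurable_def Int_absorb2 dest: sets.sets_into_space)
    moreover have "E \<subseteq> space M" using sets.sets_into_space[OF that(2)] by simp
    ultimately show ?thesis using that sub
      by (auto simp: m_def emeasure_distr emeasure_density Int_absorb2 mult.commute intro!: nn_integral_cong)
  qed
  have "m f = m g"
  proof (rule measure_eqI_generator_eq)
    show "Int_stable ?P"
    proof (rule Int_stableI, clarify)
      fix F C F' C' assume *: "F \<in> sets (filt n)" "C \<in> sets ?N" "F' \<in> sets (filt n)" "C' \<in> sets ?N"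
      have "F \<inter> (S (Suc n) -` C \<inter> space M) \<inter> (F' \<inter> (S (Suc n) -` C' \<inter> space M))
          = (F \<inter> F') \<inter> (S (Suc n) -` (C \<inter> C') \<inter> space M)" by auto
      with * show "\<exists>F'' C''. F \<inter> (S (Suc n) -` C \<inter> space M) \<inter> (F' \<inter> (S (Suc n) -` C' \<inter> space M))
          = F'' \<inter> (S (Suc n) -` C'' \<inter> space M) \<and> F'' \<in> sets (filt n) \<and> C'' \<in> sets ?N"
        by (intro exI[of _ "F \<inter> F'"] exI[of _ "C \<inter> C'"]) auto
    qed
    show "?P \<subseteq> Pow (space M)" by auto
    show "emeasure (m f) E = emeasure (m g) E" if P: "E \<in> ?P" for E
    proof -
      from P obtain F C where FC: "E = F \<inter> (S (Suc n) -` C \<inter> space M)" "F \<in> sets (filt n)" "C \<in> sets ?N"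
        by blast
      have ind: "indicator E \<omega> * h = indicator F \<omega> * (indicator C (S (Suc n) \<omega>) * h)" if "\<omega> \<in> space M" for \<omega> and h :: ennreal
        using that by (auto simp: FC(1) indicator_def)
      have "E \<in> sets (filt (Suc n))" using P P_sub by blast
      then show ?thesis using eq[OF FC(2,3)] f(1) g
        by (simp add: em ind cong: nn_integral_cong)
    qed
    show "range (\<lambda>_. space M) \<subseteq> ?P"
    proof -
      have "space M = space M \<inter> (S (Suc n) -` space ?N \<inter> space M)"
        using measurable_space[OF S_meas[of "Suc n"]] by auto
      moreover have "space M \<in> sets (filt n)" using sets.top[of "filt n"] by simp
      ultimately show ?thesis by blast
    qed
    have "(\<integral>\<^sup>+\<omega>. indicator (space M) \<omega> * f \<omega> \<partial>M) \<le> (\<integral>\<^sup>+\<omega>. 1 \<partial>M)"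
      using f(2) by (intro nn_integral_mono) auto
    also have "\<dots> = 1" by (simp add: emeasure_space_1)
    finally have "(\<integral>\<^sup>+\<omega>. indicator (space M) \<omega> * f \<omega> \<partial>M) \<noteq> \<infinity>"
      by (metis ennreal_one_neq_top infinity_ennreal_def top.extremum_uniqueI)
    then show "emeasure (m f) (space M) \<noteq> \<infinity>"
      using em[OF f(1), of "space M"] sets.top[of "filt (Suc n)"] by simp
  qed (auto simp: calculation m_def)
  then show ?thesis using em[OF f(1) E] em[OF g E] by simp
qed

section \<open>Conditional law of b(n) given S(1), ..., S(n), and the Markov property\<close>

text \<open>Expresses, in integrated form, that \<open>cond_law\<close> is the conditional law of
  \<open>b n\<close> given \<open>filt n\<close>; the bound on \<open>G\<close> keeps the integrals
  finite.\<close>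

definition intertwined :: "nat \<Rightarrow> bool" where
  "intertwined n \<longleftrightarrow> (\<forall>F\<in>sets (filt n). \<forall>G. (\<lambda>(t, z). G t z) \<in> borel_measurable (borel \<Otimes>\<^sub>M borel) \<longrightarrow>
    (\<forall>t z. G t z \<le> 1) \<longrightarrow>
    (\<integral>\<^sup>+\<omega>. indicator F \<omega> * G (S n \<omega>) (b n \<omega>) \<partial>M) = (\<integral>\<^sup>+\<omega>. indicator F \<omega> * cond_law G (S n \<omega>) \<partial>M))"

text \<open>Integrating out the increment leaves \<open>step_law\<close> at the old pair; the
  hypothesis averages the old \<open>b\<close>, and the intertwining relation moves this average
  past the step. The event \<open>F\<close> still belongs to the old sigma-algebra.\<close>

lemma intertwined_step:
  assumes I: "intertwined (Suc n)" and F: "F \<in> sets (filt (Suc n))"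
    and G [measurable]: "(\<lambda>(t, z). G t z) \<in> borel_measurable (borel \<Otimes>\<^sub>M borel)" and G1: "\<And>t z. G t z \<le> 1"
  shows "(\<integral>\<^sup>+\<omega>. indicator F \<omega> * G (S (Suc (Suc n)) \<omega>) (b (Suc (Suc n)) \<omega>) \<partial>M)
    = (\<integral>\<^sup>+\<omega>. indicator F \<omega> * (\<integral>\<^sup>+t. cond_law G t \<partial>Q_bar \<alpha> \<beta> (S (Suc n) \<omega>)) \<partial>M)"
proof -
  let ?m = "Suc n"
  let ?f = "\<lambda>\<omega> x. let b' = next_inv_sum (R ?m \<omega>) (b ?m \<omega>) x in indicator F \<omega> * G (b ?m \<omega> - b') b'"
  have [measurable]: "F \<in> sets (hist ?m)" using F sets_filt_subset_hist by blast
  have [measurable]: "R ?m \<in> borel_measurable (hist ?m)" "b ?m \<in> borel_measurable (hist ?m)"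
    using R_hist b_hist by auto
  have "(\<integral>\<^sup>+\<omega>. indicator F \<omega> * G (S (Suc ?m) \<omega>) (b (Suc ?m) \<omega>) \<partial>M) = (\<integral>\<^sup>+\<omega>. ?f \<omega> (X (Suc ?m) \<omega>) \<partial>M)"
    by (rule nn_integral_cong) (simp add: S_Suc b_Suc Let_def)
  also have "\<dots> = (\<integral>\<^sup>+\<omega>. \<integral>\<^sup>+x. ?f \<omega> x \<partial>matrix_beta_II \<alpha> \<beta> \<partial>M)"
    by (rule nn_integral_fresh) (simp only: Let_def, measurable)
  also have "\<dots> = (\<integral>\<^sup>+\<omega>. indicator F \<omega> * step_law G (S ?m \<omega>) (b ?m \<omega>) \<partial>M)"
  proof (rule nn_integral_cong)
    fix \<omega> assume w: "\<omega> \<in> space M"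
    show "(\<integral>\<^sup>+x. ?f \<omega> x \<partial>matrix_beta_II \<alpha> \<beta>) = indicator F \<omega> * step_law G (S ?m \<omega>) (b ?m \<omega>)"
      unfolding step_law_def R_Suc_of_b[OF w, symmetric] Let_def by (cases "\<omega> \<in> F") simp_all
  qed
  also have "\<dots> = (\<integral>\<^sup>+\<omega>. indicator F \<omega> * cond_law (step_law G) (S ?m \<omega>) \<partial>M)"
    using I F borel_measurable_step_law[OF G] step_law_le_1[of G, OF G1] unfolding intertwined_def by blast
  also have "\<dots> = (\<integral>\<^sup>+\<omega>. indicator F \<omega> * (\<integral>\<^sup>+t. cond_law G t \<partial>Q_bar \<alpha> \<beta> (S ?m \<omega>)) \<partial>M)"
    by (intro nn_integral_cong) (simp add: cond_law_intertwines S_posdef)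
  finally show ?thesis .
qed

text \<open>Passes from events at time \<open>n\<close> to events at time \<open>n + 1\<close>. By
  the premise the integral depends on \<open>G\<close> only through \<open>cond_law G\<close>. Now
  \<open>indicator C t * G t z\<close> and \<open>indicator C t * cond_law G t\<close> have the same
  \<open>cond_law\<close>, hence the same integral, for every \<open>C\<close>. The functional
  \<open>J\<close> is left open so that the initial step and the later ones share the
  argument.\<close>

lemma intertwined_SucI:
  assumes *: "\<And>F G. F \<in> sets (filt n) \<Longrightarrow> (\<lambda>(t, z). G t z) \<in> borel_measurable (borel \<Otimes>\<^sub>M borel) \<Longrightarrow>
    (\<And>t z. G t z \<le> 1) \<Longrightarrow>
    (\<integral>\<^sup>+\<omega>. indicator F \<omega> * G (S (Suc n) \<omega>) (b (Suc n) \<omega>) \<partial>M) = J F (\<lambda>t. if t \<in> posdef_mats then cond_law G t else 0)"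
  shows "intertwined (Suc n)"
  unfolding intertwined_def
proof (intro ballI allI impI)
  fix E and G :: "'n sqmat \<Rightarrow> 'n sqmat \<Rightarrow> ennreal"
  assume E: "E \<in> sets (filt (Suc n))" and G [measurable]: "(\<lambda>(t, z). G t z) \<in> borel_measurable (borel \<Otimes>\<^sub>M borel)"
    and G1: "\<forall>t z. G t z \<le> 1"
  note borel_measurable_cond_law[OF G, measurable]
  have [measurable]: "S (Suc n) \<in> borel_measurable M" "b (Suc n) \<in> borel_measurable M"
    using hist_imp_measurable S_hist_borel b_hist by blast+
  \<comment> \<open>The cut-off makes the bound by 1 hold everywhere; \<open>cond_law_le_1\<close>
    gives it on the cone.\<close>
  define L where "L t = (if t \<in> posdef_mats then cond_law G t else 0)" for t
  have L_meas [measurable]: "L \<in> borel_measurable borel" unfolding L_def by measurable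
  have L1: "L t \<le> 1" for t using cond_law_le_1[of t G] G1 by (simp add: L_def)
  show "(\<integral>\<^sup>+\<omega>. indicator E \<omega> * G (S (Suc n) \<omega>) (b (Suc n) \<omega>) \<partial>M) = (\<integral>\<^sup>+\<omega>. indicator E \<omega> * cond_law G (S (Suc n) \<omega>) \<partial>M)"
  proof (rule filt_eqI[OF _ _ _ _ E])
    fix F and C :: "'n sqmat set" assume F: "F \<in> sets (filt n)" and C: "C \<in> sets posdef_borel"
    then have [measurable]: "C \<in> sets borel" by (simp add: sets_posdef_borelD)
    have "(\<integral>\<^sup>+\<omega>. indicator F \<omega> * (indicator C (S (Suc n) \<omega>) * G (S (Suc n) \<omega>) (b (Suc n) \<omega>)) \<partial>M)
        = J F (\<lambda>t. if t \<in> posdef_mats then cond_law (\<lambda>t z. indicator C t * G t z) t else 0)"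
      using G1 by (intro *[OF F, of "\<lambda>t z. indicator C t * G t z"]) (measurable, auto simp: indicator_def)
    also have "(\<lambda>t. if t \<in> posdef_mats then cond_law (\<lambda>t z. indicator C t * G t z) t else 0)
        = (\<lambda>t. if t \<in> posdef_mats then cond_law (\<lambda>t z. indicator C t * L t) t else 0)"
      by (auto simp: cond_law_mult cond_law_const L_def)
    also have "J F \<dots> = (\<integral>\<^sup>+\<omega>. indicator F \<omega> * (indicator C (S (Suc n) \<omega>) * L (S (Suc n) \<omega>)) \<partial>M)"
      using L1 by (intro *[OF F, of "\<lambda>t z. indicator C t * L t", symmetric]) (measurable, auto simp: indicator_def)
    also have "\<dots> = (\<integral>\<^sup>+\<omega>. indicator F \<omega> * (indicator C (S (Suc n) \<omega>) * cond_law G (S (Suc n) \<omega>)) \<partial>M)"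
      by (intro nn_integral_cong) (simp add: L_def S_posdef)
    finally show "(\<integral>\<^sup>+\<omega>. indicator F \<omega> * (indicator C (S (Suc n) \<omega>) * G (S (Suc n) \<omega>) (b (Suc n) \<omega>)) \<partial>M)
      = (\<integral>\<^sup>+\<omega>. indicator F \<omega> * (indicator C (S (Suc n) \<omega>) * cond_law G (S (Suc n) \<omega>)) \<partial>M)" .
  qed (use G1 in \<open>measurable, auto\<close>)
qed

lemma intertwined: "intertwined (Suc n)"
proof (induction n)
  case 0
  \<comment> \<open>The probability of \<open>F\<close> times the integral of \<open>h\<close>
    against the law of \<open>S 1\<close>; the product is right because \<open>filt 0\<close> has no
    generators and is trivial.\<close>
  let ?J = "\<lambda>F h. emeasure M F * (\<integral>\<^sup>+t. ennreal (inverse (matrix_Gamma TYPE('n) \<beta>) *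
    (inverse (matrix_Beta TYPE('n) \<alpha> \<beta>) * det (t :: 'n sqmat) powr \<alpha> * exp (- trace t))) * (phi_nn \<alpha> \<beta> t * h t) \<partial>posdef_mu)"
  have *: "(\<integral>\<^sup>+\<omega>. indicator F \<omega> * G (S (Suc 0) \<omega>) (b (Suc 0) \<omega>) \<partial>M)
      = ?J F (\<lambda>t. if t \<in> posdef_mats then cond_law G t else 0)"
    if F: "F \<in> sets (filt 0)" and G [measurable]: "(\<lambda>(t, z). G t z) \<in> borel_measurable (borel \<Otimes>\<^sub>M borel)"
    for F and G :: "'n sqmat \<Rightarrow> 'n sqmat \<Rightarrow> ennreal"
  proof -
    let ?f = "\<lambda>r x. let b = next_inv_sum r (matrix_inv r) x in G (matrix_inv r - b) b"
    have "(\<lambda>(\<omega>, x). ?f (R 0 \<omega>) x) \<in> borel_measurable (hist 0 \<Otimes>\<^sub>M borel)"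
    proof -
      have [measurable]: "R 0 \<in> borel_measurable (hist 0)" by (rule R_hist) simp
      show ?thesis unfolding Let_def by measurable
    qed
    from nn_integral_fresh[OF this]
    have "(\<integral>\<^sup>+\<omega>. G (S 1 \<omega>) (b 1 \<omega>) \<partial>M) = (\<integral>\<^sup>+\<omega>. \<integral>\<^sup>+x. ?f (R 0 \<omega>) x \<partial>matrix_beta_II \<alpha> \<beta> \<partial>M)"
      using S_Suc[of _ 0] b_Suc[of _ 0] b_0 by (simp add: Let_def cong: nn_integral_cong)
    also have "\<dots> = (\<integral>\<^sup>+r. \<integral>\<^sup>+x. ?f r x \<partial>matrix_beta_II \<alpha> \<beta> \<partial>distr M posdef_borel (R 0))"
    proof (rule nn_integral_distr[OF R0_meas, symmetric])
      show "(\<lambda>r. \<integral>\<^sup>+x. ?f r x \<partial>matrix_beta_II \<alpha> \<beta>) \<in> borel_measurable (distr M posdef_borel (R 0))"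
        using measurable_compose[OF measurable_posdef_borel_id borel_measurable_initial_step[OF G]] by simp
    qed
    also have "\<dots> = ?J (space M) (cond_law G)"
      unfolding R0_law by (simp add: nn_integral_initial_step[OF G] emeasure_space_1)
    finally have all: "(\<integral>\<^sup>+\<omega>. G (S 1 \<omega>) (b 1 \<omega>) \<partial>M) = ?J (space M) (cond_law G)" .
    have "sets (filt 0) = {{}, space M}" by (simp add: sets_filt sigma_sets_empty_eq)
    with F consider "F = {}" | "F = space M" by auto
    then have "(\<integral>\<^sup>+\<omega>. indicator F \<omega> * G (S (Suc 0) \<omega>) (b (Suc 0) \<omega>) \<partial>M) = ?J F (cond_law G)"
    proof cases
      case 2
      have "(\<integral>\<^sup>+\<omega>. indicator F \<omega> * G (S (Suc 0) \<omega>) (b (Suc 0) \<omega>) \<partial>M) = (\<integral>\<^sup>+\<omega>. G (S 1 \<omega>) (b 1 \<omega>) \<partial>M)"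
        by (rule nn_integral_cong) (simp add: 2)
      then show ?thesis using all by (simp only: 2)
    qed simp
    also have "\<dots> = ?J F (\<lambda>t. if t \<in> posdef_mats then cond_law G t else 0)"
      by (intro arg_cong[where f = "(*) _"] nn_integral_cong) simp
    finally show ?thesis .
  qed
  show ?case by (rule intertwined_SucI[where J = ?J]) (rule *)
next
  case (Suc n)
  let ?J = "\<lambda>F h. (\<integral>\<^sup>+\<omega>. indicator F \<omega> * (\<integral>\<^sup>+t. h t \<partial>Q_bar \<alpha> \<beta> (S (Suc n) \<omega>)) \<partial>M)"
  show ?case
  proof (rule intertwined_SucI[where J = ?J])
    fix F and G :: "'n sqmat \<Rightarrow> 'n sqmat \<Rightarrow> ennreal"
    assume "F \<in> sets (filt (Suc n))" "(\<lambda>(t, z). G t z) \<in> borel_measurable (borel \<Otimes>\<^sub>M borel)" "\<And>t z. G t z \<le> 1"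
    from intertwined_step[OF Suc this]
    show "(\<integral>\<^sup>+\<omega>. indicator F \<omega> * G (S (Suc (Suc n)) \<omega>) (b (Suc (Suc n)) \<omega>) \<partial>M)
      = ?J F (\<lambda>t. if t \<in> posdef_mats then cond_law G t else 0)"
      by (simp cong: nn_integral_cong_simp)
  qed
qed

text \<open>A test function of \<open>S\<close> alone is left unchanged by \<open>cond_law\<close>,
  so all reference to \<open>b\<close> disappears from \<open>intertwined_step\<close>.\<close>

lemma nn_integral_transition:
  assumes F: "F \<in> sets (filt (Suc n))" and B: "B \<in> sets posdef_borel"
  shows "(\<integral>\<^sup>+\<omega>. indicator F \<omega> * indicator B (S (Suc (Suc n)) \<omega>) \<partial>M)
    = (\<integral>\<^sup>+\<omega>. indicator F \<omega> * emeasure (Q_bar \<alpha> \<beta> (S (Suc n) \<omega>)) B \<partial>M)"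
proof -
  have [measurable]: "B \<in> sets borel" using B by (rule sets_posdef_borelD)
  have "(\<integral>\<^sup>+\<omega>. indicator F \<omega> * indicator B (S (Suc (Suc n)) \<omega>) \<partial>M)
      = (\<integral>\<^sup>+\<omega>. indicator F \<omega> * (\<integral>\<^sup>+t. cond_law (\<lambda>t z. indicator B t) t \<partial>Q_bar \<alpha> \<beta> (S (Suc n) \<omega>)) \<partial>M)"
    by (rule intertwined_step[OF intertwined F, of "\<lambda>t z. indicator B t"]) (measurable, auto simp: indicator_def)
  also have "\<dots> = (\<integral>\<^sup>+\<omega>. indicator F \<omega> * emeasure (Q_bar \<alpha> \<beta> (S (Suc n) \<omega>)) B \<partial>M)"
  proof (intro nn_integral_cong arg_cong[where f = "(*) _"])
    fix \<omega>
    have "(\<integral>\<^sup>+t. cond_law (\<lambda>t z. indicator B t) t \<partial>Q_bar \<alpha> \<beta> (S (Suc n) \<omega>))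
        = (\<integral>\<^sup>+t. indicator B t \<partial>Q_bar \<alpha> \<beta> (S (Suc n) \<omega>))"
      by (intro nn_integral_cong) (simp add: cond_law_const)
    then show "(\<integral>\<^sup>+t. cond_law (\<lambda>t z. indicator B t) t \<partial>Q_bar \<alpha> \<beta> (S (Suc n) \<omega>)) = emeasure (Q_bar \<alpha> \<beta> (S (Suc n) \<omega>)) B"
      using B by simp
  qed
  finally show ?thesis .
qed

text \<open>The conditional expectation is identified through its integrals over
  \<open>filt n\<close>; \<open>nn_integral_transition\<close> transfers to real integrals because
  both integrands lie between 0 and 1.\<close>

lemma markov_process_S: "markov_process M 1 posdef_borel (Q_bar \<alpha> \<beta>) S"
  unfolding markov_process_def
proof (intro conjI allI impI ballI)
  show "Q_bar \<alpha> \<beta> \<in> measurable posdef_borel (prob_algebra (posdef_borel :: 'n sqmat measure))"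
    by (rule measurable_Q_bar)
  show "S n \<in> measurable M posdef_borel" if "n \<ge> 1" for n using that by (rule S_meas)
  fix n B assume "n \<ge> (1::nat)" and B: "B \<in> sets (posdef_borel :: 'n sqmat measure)"
  then obtain k where n: "n = Suc k" by (cases n) auto
  have subalg: "subalgebra M (filt n)"
    unfolding subalgebra_def using sets_filt_subset_hist sets_hist_subset by auto
  interpret sigma_finite_subalgebra M "filt n"
    by (intro finite_measure_subalgebra_is_sigma_finite finite_measure_subalgebra.intro
        finite_measure_subalgebra_axioms.intro subalg finite_measure_axioms)
  let ?f = "\<lambda>\<omega>. indicator B (S (Suc n) \<omega>) :: real" and ?g = "\<lambda>\<omega>. measure (Q_bar \<alpha> \<beta> (S n \<omega>)) B"
  have S_n: "S n \<in> measurable (filt n) posdef_borel" using S_filt[of n n] n by simp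
  have "(\<lambda>s. emeasure (Q_bar \<alpha> \<beta> s) B) \<in> borel_measurable (posdef_borel :: 'n sqmat measure)"
    using measurable_compose[OF measurable_prob_algebraD[OF measurable_Q_bar] measurable_emeasure_subprob_algebra[OF B]] .
  then have "(\<lambda>s. measure (Q_bar \<alpha> \<beta> s) B) \<in> borel_measurable (posdef_borel :: 'n sqmat measure)"
    unfolding measure_def by measurable
  from measurable_compose[OF S_n this] have g: "?g \<in> borel_measurable (filt n)" .
  have gM [measurable]: "?g \<in> borel_measurable M" using measurable_from_subalg[OF subalg g] .
  have fM [measurable]: "?f \<in> borel_measurable M"
    by (rule measurable_compose[OF S_meas borel_measurable_indicator[OF B]]) simp
  have prob: "prob_space (Q_bar \<alpha> \<beta> (S n \<omega>))" if "\<omega> \<in> space M" for \<omega>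
    unfolding n by (intro prob_space_Q_bar S_posdef that)
  show "AE \<omega> in M. real_cond_exp M (natural_filtration M 1 posdef_borel S n) ?f \<omega> = ?g \<omega>"
    unfolding filt_def[symmetric]
  proof (rule real_cond_exp_charact[OF _ _ _ g])
    show "integrable M ?f" by (rule integrable_const_bound[OF _ fM, of 1]) (auto simp: indicator_def)
    show "integrable M ?g"
      by (rule integrable_const_bound[of _ 1]) (auto intro!: AE_I2 prob_space.prob_le_1 prob)
    fix F assume F: "F \<in> sets (filt n)"
    then have [measurable]: "F \<in> sets M" using subalg by (auto simp: subalgebra_def)
    have "(\<integral>\<omega>\<in>F. ?f \<omega> \<partial>M) = enn2real (\<integral>\<^sup>+\<omega>. indicator F \<omega> * indicator B (S (Suc n) \<omega>) \<partial>M)"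
    proof -
      have "(\<lambda>\<omega>. indicator F \<omega> *\<^sub>R ?f \<omega>) \<in> borel_measurable M" by measurable
      from integral_eq_nn_integral[OF this]
      have "(\<integral>\<omega>\<in>F. ?f \<omega> \<partial>M) = enn2real (\<integral>\<^sup>+\<omega>. ennreal (indicator F \<omega> *\<^sub>R ?f \<omega>) \<partial>M)"
        unfolding set_lebesgue_integral_def by simp
      also have "(\<integral>\<^sup>+\<omega>. ennreal (indicator F \<omega> *\<^sub>R ?f \<omega>) \<partial>M)
          = (\<integral>\<^sup>+\<omega>. indicator F \<omega> * indicator B (S (Suc n) \<omega>) \<partial>M)"
        by (rule nn_integral_cong) (auto simp: indicator_def)
      finally show ?thesis .
    qed
    also have "\<dots> = enn2real (\<integral>\<^sup>+\<omega>. indicator F \<omega> * emeasure (Q_bar \<alpha> \<beta> (S n \<omega>)) B \<partial>M)"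
      using nn_integral_transition[of F k B] F B by (simp add: n)
    also have "(\<integral>\<^sup>+\<omega>. indicator F \<omega> * emeasure (Q_bar \<alpha> \<beta> (S n \<omega>)) B \<partial>M)
        = (\<integral>\<^sup>+\<omega>. ennreal (indicator F \<omega> * ?g \<omega>) \<partial>M)"
    proof (rule nn_integral_cong)
      fix \<omega> assume "\<omega> \<in> space M"
      then interpret Q: prob_space "Q_bar \<alpha> \<beta> (S n \<omega>)" by (rule prob)
      show "indicator F \<omega> * emeasure (Q_bar \<alpha> \<beta> (S n \<omega>)) B = ennreal (indicator F \<omega> * ?g \<omega>)"
        by (simp add: Q.emeasure_eq_measure ennreal_mult ennreal_indicator)
    qed
    also have "enn2real \<dots> = (\<integral>\<omega>\<in>F. ?g \<omega> \<partial>M)"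
      unfolding set_lebesgue_integral_def by (subst integral_eq_nn_integral) auto
    finally show "(\<integral>\<omega>\<in>F. ?f \<omega> \<partial>M) = (\<integral>\<omega>\<in>F. ?g \<omega> \<partial>M)" .
  qed
qed

end

theorem theorem1p1:
  fixes M :: "'a measure"
    and R X A S :: "nat \<Rightarrow> 'a \<Rightarrow> 'n::{finite,linorder} sqmat"
    and \<alpha> \<beta> :: real
  assumes "prob_space M"
    and "\<alpha> > (real CARD('n) - 1) / 2"
    and "\<beta> > (real CARD('n) - 1) / 2"
    and "R 0 \<in> measurable M posdef_borel"
    and "\<And>n. n \<ge> 1 \<Longrightarrow> X n \<in> measurable M posdef_borel"
    and "prob_space.indep_vars M (\<lambda>_. posdef_borel) (\<lambda>n. if n = 0 then R 0 else X n) UNIV"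
    and "distr M posdef_borel (R 0) = inverse_wishart \<beta>"
    and "\<And>n. n \<ge> 1 \<Longrightarrow> distr M posdef_borel (X n) = matrix_beta_II \<alpha> \<beta>"
    and "\<And>n \<omega>. n \<ge> 1 \<Longrightarrow> \<omega> \<in> space M \<Longrightarrow>
           R n \<omega> = mat_sqrt (R (n - 1) \<omega>) ** X n \<omega> ** mat_sqrt (R (n - 1) \<omega>)"
    and "\<And>n \<omega>. \<omega> \<in> space M \<Longrightarrow> A n \<omega> = (\<Sum>k=0..n. R k \<omega>)"
    and "\<And>n \<omega>. n \<ge> 1 \<Longrightarrow> \<omega> \<in> space M \<Longrightarrow>
           S n \<omega> = matrix_inv (A (n - 1) \<omega>) ** R n \<omega> ** matrix_inv (A n \<omega>)"
  shows "markov_process M 1 posdef_borel (Q_bar \<alpha> \<beta>) S"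
proof -
  interpret prob_space M by fact
  have "beta_walk \<alpha> \<beta> M R X A S"
  proof (intro beta_walk.intro walk_parameters.intro beta_walk_axioms.intro)
    have "real CARD('n) \<ge> 1" using zero_less_card_finite[where 'a = 'n] by linarith
    then have "(real CARD('n) - 1) / 2 \<ge> 0" by simp
    with assms(2) show "\<alpha> \<ge> 0" by linarith
    show "prob_space (inverse_wishart \<beta> :: 'n sqmat measure)"
      unfolding assms(7)[symmetric] by (rule prob_space_distr) (rule assms(4))
    show "prob_space (matrix_beta_II \<alpha> \<beta> :: 'n sqmat measure)"
      unfolding assms(8)[of 1, OF order_refl, symmetric] by (rule prob_space_distr) (simp add: assms(5))
  qed (fact assms)+
  then show ?thesis by (rule beta_walk.markov_process_S)
qed

end
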